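(* Under the standing setup below, let $W>1$ and let $s\ge0$ be an integer. For $x\in B(R)$ let $F_x\in C^s(\overline{B(W)})$ be $F_x(y)=f_N(x+y)=(2N)^{-1/2}\sum_{1\le|n|\le N}a_ne(\langle r_n,x\rangle)e(\langle r_n,y\rangle)$. Regard $x\mapsto F_x$ as a random element of $C^s(\overline{B(W)})$ with $x$ distributed according to $\operatorname{vol}_R$, and $F_\mu|_{\overline{B(W)}}$ as a random element of the same space. Then $$\lim_{N\to\infty}\ \limsup_{R\to\infty}\ d_P(F_x,F_\mu)=0,$$ where $d_P$ is the Lévy–Prokhorov distance between the laws of $F_x$ and $F_\mu$ on $C^s(\overline{B(W)})$.
   Context: Standing setup: Fix $m\ge 2$, $e(t)=e^{2\pi it}$, $B(x,\rho)$ open ball, $B(\rho)=B(0,\rho)$. Let $\{r_n\}_{n\ge1}\subset\mathbb S^{m-1}$ be linearly independent over $\mathbb Q$ and not all contained in a hyperplane; $r_{-n}:=-r_n$. Let $a_n\in\mathbb C$ ($n\ne0$), $|a_n|=1$, $a_{-n}=\overline{a_n}$. $f_N(x)=(2N)^{-1/2}\sum_{1\le|n|\le N}a_n e(\langle r_n,x\rangle)$. $\mu_{r,N}=(2N)^{-1}\sum_{1\le|n|\le N}\delta_{r_n}$, assumed (after passing to a subsequence) to converge weak$^*$ to a probability measure $\mu$ on $\mathbb S^{m-1}$. $F_\mu$: centred stationary real Gaussian field on $\mathbb R^m$ with $\mathbb E[F_\mu(x)F_\mu(y)]=\int e(\langle x-y,\lambda\rangle)d\mu(\lambda)$. $\operatorname{vol}_R$: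 uniform probability measure on $B(R)$. Lévy–Prokhorov metric: for Borel probability measures $\mu_1,\mu_2$ on the normed space $S=C^s(\overline{B(W)})$ (norm $\|\cdot\|_{C^s}$), $d_P(\mu_1,\mu_2)=\inf\{\varepsilon>0:\mu_1(A)\le\mu_2(A_{+\varepsilon})+\varepsilon,\ \mu_2(A)\le\mu_1(A_{+\varepsilon})+\varepsilon\ \text{for all Borel }A\subset S\}$, where $A_{+\varepsilon}=\{p\in S:\exists q\in A,\ \|p-q\|_{C^s}<\varepsilon\}$. For random elements $F,F'$ of $S$, $d_P(F,F')$ is $d_P$ of their laws. *)

theory Defs
  imports "HOL-Probability.Probability"
begin

definition ee :: "real \<Rightarrow> complex" where
  "ee t = cis (2 * pi * t)"

definition fN :: "(int \<Rightarrow> complex) \<Rightarrow> (int \<Rightarrow> 'a::euclidean_space) \<Rightarrow> nat \<Rightarrow> 'a \<Rightarrow> complex" where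
  "fN a r N x = complex_of_real (1 / sqrt (2 * real N)) *
      (\<Sum>n\<in>{- int N..int N} - {0}. a n * ee (r n \<bullet> x))"

definition rat_lin_indep :: "(int \<Rightarrow> 'a::euclidean_space) \<Rightarrow> bool" where
  "rat_lin_indep r \<longleftrightarrow>
     (\<forall>F c. finite F \<and> F \<subseteq> {1..} \<and> (\<Sum>n\<in>F. real_of_rat (c n) *\<^sub>R r n) = 0
        \<longrightarrow> (\<forall>n\<in>F. c n = 0))"

definition pderiv_within :: "'a set \<Rightarrow> 'a \<Rightarrow> ('a::euclidean_space \<Rightarrow> real) \<Rightarrow> 'a \<Rightarrow> real" where
  "pderiv_within S i f x = frechet_derivative f (at x within S) i"

fun iter_pd :: "'a set \<Rightarrow> 'a list \<Rightarrow> ('a::euclidean_space \<Rightarrow> real) \<Rightarrow> 'a \<Rightarrow> real" where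
  "iter_pd S [] f = f"
| "iter_pd S (i # l) f = pderiv_within S i (iter_pd S l f)"

definition Cs_on :: "nat \<Rightarrow> 'a set \<Rightarrow> ('a::euclidean_space \<Rightarrow> real) \<Rightarrow> bool" where
  "Cs_on s K f \<longleftrightarrow>
     (\<forall>l. set l \<subseteq> Basis \<and> length l < s \<longrightarrow>
          (\<forall>x\<in>K. iter_pd K l f differentiable (at x within K))) \<and>
     (\<forall>l. set l \<subseteq> Basis \<and> length l \<le> s \<longrightarrow> continuous_on K (iter_pd K l f))"

text \<open>The space C^s(closed ball B(W)); elements are represented as functions
  vanishing outside the closed ball.\<close>
definition Cs_space :: "nat \<Rightarrow> real \<Rightarrow> ('a::euclidean_space \<Rightarrow> real) set" where
  "Cs_space s W = {f. Cs_on s (cball 0 W) f \<and> (\<forall>y. y \<notin> cball 0 W \<longrightarrow> f y = 0)}"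

definition cs_norm :: "nat \<Rightarrow> real \<Rightarrow> ('a::euclidean_space \<Rightarrow> real) \<Rightarrow> real" where
  "cs_norm s W f = Sup {\<bar>iter_pd (cball 0 W) l f y\<bar> | l y.
      set l \<subseteq> Basis \<and> length l \<le> s \<and> y \<in> cball 0 W}"

definition cs_open :: "nat \<Rightarrow> real \<Rightarrow> ('a::euclidean_space \<Rightarrow> real) set \<Rightarrow> bool" where
  "cs_open s W U \<longleftrightarrow> U \<subseteq> Cs_space s W \<and>
     (\<forall>f\<in>U. \<exists>e>0. \<forall>g\<in>Cs_space s W. cs_norm s W (g - f) < e \<longrightarrow> g \<in> U)"

definition cs_borel :: "nat \<Rightarrow> real \<Rightarrow> ('a::euclidean_space \<Rightarrow> real) measure" where
  "cs_borel s W = sigma (Cs_space s W) {U. cs_open s W U}"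

definition cs_enlarge :: "nat \<Rightarrow> real \<Rightarrow> ('a::euclidean_space \<Rightarrow> real) set \<Rightarrow> real
    \<Rightarrow> ('a \<Rightarrow> real) set" where
  "cs_enlarge s W A e = {p\<in>Cs_space s W. \<exists>q\<in>A. cs_norm s W (p - q) < e}"

definition levy_prokhorov ::
  "nat \<Rightarrow> real \<Rightarrow> ('a::euclidean_space \<Rightarrow> real) measure \<Rightarrow> ('a \<Rightarrow> real) measure \<Rightarrow> real" where
  "levy_prokhorov s W M1 M2 = Inf {e. e > 0 \<and>
     (\<forall>A\<in>sets (cs_borel s W).
        measure M1 A \<le> measure M2 (cs_enlarge s W A e) + e \<and>
        measure M2 A \<le> measure M1 (cs_enlarge s W A e) + e)}"

definition centred_normal :: "real \<Rightarrow> real measure" where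
  "centred_normal v = (if v = 0 then return borel 0
                       else density lborel (normal_density 0 (sqrt v)))"

definition cov_kernel :: "'a measure \<Rightarrow> 'a::euclidean_space \<Rightarrow> 'a \<Rightarrow> complex" where
  "cov_kernel \<mu> x y = integral\<^sup>L \<mu> (\<lambda>l. ee ((x - y) \<bullet> l))"

text \<open>P is the law, on C^s(closed ball B(W)), of the restriction of the centred
  stationary real Gaussian field F_mu: every finite linear combination of point
  evaluations is centred normal with the variance prescribed by the covariance.\<close>
definition gaussian_field_law ::
  "nat \<Rightarrow> real \<Rightarrow> 'a measure \<Rightarrow> ('a::euclidean_space \<Rightarrow> real) measure \<Rightarrow> bool" where
  "gaussian_field_law s W \<mu> P \<longleftrightarrow> prob_space P \<and> sets P = sets (cs_borel s W) \<and>
     (\<forall>ys cs. length cs = length ys \<and> set ys \<subseteq> cball 0 W \<longrightarrow>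
        distr P borel (\<lambda>F. \<Sum>i<length ys. cs ! i * F (ys ! i)) =
        centred_normal (Re (\<Sum>i<length ys. \<Sum>j<length ys.
            complex_of_real (cs ! i * cs ! j) * cov_kernel \<mu> (ys ! i) (ys ! j))))"

definition Fx :: "(int \<Rightarrow> complex) \<Rightarrow> (int \<Rightarrow> 'a::euclidean_space) \<Rightarrow> nat \<Rightarrow> real \<Rightarrow> 'a
    \<Rightarrow> 'a \<Rightarrow> real" where
  "Fx a r N W x = (\<lambda>y. if y \<in> cball 0 W then Re (fN a r N (x + y)) else 0)"

definition Fx_law :: "nat \<Rightarrow> real \<Rightarrow> (int \<Rightarrow> complex) \<Rightarrow> (int \<Rightarrow> 'a::euclidean_space) \<Rightarrow> nat
    \<Rightarrow> real \<Rightarrow> ('a \<Rightarrow> real) measure" where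
  "Fx_law s W a r N R = distr (uniform_measure lborel (ball 0 R)) (cs_borel s W) (Fx a r N W)"

end

theory Submission
  imports Defs
begin

text \<open>The restriction of a plane wave to the ball is a power series whose coefficients decay
  super-exponentially, and the Taylor coefficients can be replaced by finite differences of point
  values with small steps. Consequently any random field whose evaluations satisfy a second moment
  bound in terms of the symbol \<open>x \<mapsto> \<Sum> c\<^sub>i e(\<langle>x, y\<^sub>i\<rangle>)\<close> of the functional \<open>F \<mapsto> \<Sum> c\<^sub>i F(y\<^sub>i)\<close> (the limit
  field, and the trigonometric sums once \<open>R\<close> is large) is close in \<open>C\<^sup>s\<close> to a random polynomial of
  bounded degree, uniformly in the field. The comparison of laws thus reduces to finitely many
  characteristic functions of linear combinations of point values. As \<open>R \<rightarrow> \<infinity>\<close> rational independence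
  makes the phases behave like independent ones, and the Salem-Zygmund factorisation
  \<open>exp (i x) \<approx> (1 + i x) exp (- x\<^sup>2 / 2)\<close> gives the central limit theorem without passing to the
  torus.\<close>

section \<open>Calculus of iterated derivatives on convex bodies\<close>

text \<open>Everything hinges on the unit sphere. The frequencies and the spectral measure both live
  there, so a functional whose symbol is at most c on unit vectors has second moment at most 4 c^2
  under either law (for the sums, once R is large). An estimate for characters thus becomes an
  estimate for random fields, and no compactness argument in C^s is required. The Taylor increments
  form an infinite family of functionals, so at fixed N the bound must hold for all functionals from
  one radius on; this is why \<open>trig_poly_mean_square\<close> fixes the threshold for R before
  the coefficients. The factor 4 is 2 for imperfect orthogonality at finite R times 2 for replacing
  a real part by a modulus. Characteristic functions, in contrast, are compared for finitely many
  functionals only, so their threshold may depend on the functional. The other obstacle is that the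
  metric tests all Borel sets at once: their traces in coefficient space are replaced by subsets of
  one finite grid.\<close>

lemma has_derivative_unique_convex:
  fixes f :: "'a::euclidean_space \<Rightarrow> real"
  assumes K: "convex K" "interior K \<noteq> {}" and x: "x \<in> K"
    and f1: "(f has_derivative f1) (at x within K)" and f2: "(f has_derivative f2) (at x within K)"
  shows "f1 = f2"
proof -
  define h where "h v = f1 v - f2 v" for v
  have h: "((\<lambda>_. 0) has_derivative h) (at x within K)"
    using has_derivative_diff[OF f1 f2] by (simp add: h_def[abs_def])
  have lin: "linear h" using h by (rule has_derivative_linear)
  \<comment> \<open>On the segment from x to y, which convexity keeps inside K, the derivative is
    unique even at the endpoint. This kills h only in directions pointing into K; differences of two
    such directions, taken inside \<open>ball z e\<close>, reach every vector.\<close>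
  have h0: "h (y - x) = 0" if y: "y \<in> K" for y
  proof -
    define p where "p t = x + t *\<^sub>R (y - x)" for t :: real
    have p: "(p has_derivative (\<lambda>t. t *\<^sub>R (y - x))) (at 0 within {0..1})"
      unfolding p_def by (auto intro!: derivative_eq_intros)
    have pK: "p ` {0..1} \<subseteq> K"
    proof (clarsimp simp: p_def)
      fix t :: real assume "0 \<le> t" "t \<le> 1"
      then have "(1 - t) *\<^sub>R x + t *\<^sub>R y \<in> K" using K(1) x y by (simp add: convex_alt)
      then show "x + t *\<^sub>R (y - x) \<in> K" by (simp add: algebra_simps)
    qed
    have "((\<lambda>_. 0) has_derivative h) (at (p 0) within p ` {0..1})"
      using has_derivative_subset[OF _ pK] h by (simp add: p_def)
    from diff_chain_within[OF p this]
    have "((\<lambda>_. 0) has_derivative (\<lambda>t. h (t *\<^sub>R (y - x)))) (at 0 within {0..1})"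
      by (simp add: o_def)
    then have "((\<lambda>_. 0::real) has_vector_derivative h (y - x)) (at 0 within {0..1})"
      using lin by (simp add: has_vector_derivative_def linear_scale)
    moreover have "((\<lambda>_. 0::real) has_vector_derivative 0) (at 0 within {0..1})" by simp
    ultimately show ?thesis
      using vector_derivative_unique_within_closed_interval[of 0 1 0 "\<lambda>_. 0::real" "h (y - x)" 0]
      by simp
  qed
  obtain z e where e: "e > 0" "ball z e \<subseteq> K"
    using K(2) by (metis all_not_in_conv mem_interior)
  have "h v = 0" for v
  proof (cases "v = 0")
    case True then show ?thesis using lin by (simp add: linear_0)
  next
    case False
    define t where "t = e / (2 * norm v)"
    have t: "t > 0" using False e by (simp add: t_def)
    have "z + t *\<^sub>R v \<in> K" "z \<in> K"
      using e False by (auto simp: t_def dist_norm intro!: subsetD[OF e(2)])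
    then have "h (z + t *\<^sub>R v - x) - h (z - x) = 0" using h0 by simp
    then have "h ((z + t *\<^sub>R v - x) - (z - x)) = 0" by (simp only: linear_diff[OF lin])
    then have "h (t *\<^sub>R v) = 0" by simp
    then show ?thesis using t lin by (simp add: linear_scale)
  qed
  then show ?thesis by (auto simp: h_def fun_eq_iff)
qed

text \<open>\<open>frechet_derivative\<close> is a choice. On a convex body with interior it is
  forced even at boundary points, so \<open>pderiv_within\<close> can be read off any derivative
  that is exhibited.\<close>

lemma pderiv_within_eq:
  assumes "convex K" "interior K \<noteq> {}" "x \<in> K" "(f has_derivative f') (at x within K)"
  shows "pderiv_within K i f x = f' i"
proof -
  have "(f has_derivative frechet_derivative f (at x within K)) (at x within K)"
    using assms(4) frechet_derivative_works differentiable_def by blast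
  then show ?thesis
    using has_derivative_unique_convex[OF assms] by (simp add: pderiv_within_def)
qed

lemma iter_pd_has_derivative:
  assumes K: "convex K" "interior K \<noteq> {}" and f: "Cs_on s K f"
    and l: "set l \<subseteq> Basis" "length l < s" and x: "x \<in> K"
  shows "(iter_pd K l f has_derivative (\<lambda>h. \<Sum>i\<in>Basis. (h \<bullet> i) * iter_pd K (i # l) f x)) (at x within K)"
proof -
  obtain D where D: "(iter_pd K l f has_derivative D) (at x within K)"
    using f l x unfolding Cs_on_def differentiable_def by blast
  interpret D: linear D using D by (rule has_derivative_linear)
  have "D h = (\<Sum>i\<in>Basis. (h \<bullet> i) * iter_pd K (i # l) f x)" for h
  proof -
    have "D h = D (\<Sum>i\<in>Basis. (h \<bullet> i) *\<^sub>R i)" by (simp add: euclidean_representation)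
    also have "\<dots> = (\<Sum>i\<in>Basis. (h \<bullet> i) * D i)" by (simp add: D.sum D.scale)
    finally show ?thesis using pderiv_within_eq[OF K x D] by simp
  qed
  then have "D = (\<lambda>h. \<Sum>i\<in>Basis. (h \<bullet> i) * iter_pd K (i # l) f x)" by auto
  then show ?thesis using D by simp
qed

text \<open>Iterated derivatives are identified by exhibiting candidates indexed by words. A
  derivative within K sees only the values on K, so the induction may exchange the two functions
  there. Candidates of full length s are differentiable too, which supplies the continuity of the
  top order.\<close>

lemma iter_pd_family:
  assumes K: "convex K" "interior K \<noteq> {}"
    and g0: "\<And>y. y \<in> K \<Longrightarrow> f y = g [] y"
    and der: "\<And>l y. set l \<subseteq> Basis \<Longrightarrow> length l \<le> s \<Longrightarrow> y \<in> K \<Longrightarrow> (g l has_derivative D l y) (at y within K)"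
    and D: "\<And>l y i. set l \<subseteq> Basis \<Longrightarrow> length l < s \<Longrightarrow> y \<in> K \<Longrightarrow> i \<in> Basis \<Longrightarrow> D l y i = g (i # l) y"
  shows "set l \<subseteq> Basis \<Longrightarrow> length l \<le> s \<Longrightarrow> y \<in> K \<Longrightarrow> iter_pd K l f y = g l y"
    and "Cs_on s K f"
proof -
  have eq: "iter_pd K l f y = g l y" if "set l \<subseteq> Basis" "length l \<le> s" "y \<in> K" for l y
    using that
  proof (induction l arbitrary: y)
    case (Cons i l)
    have "(iter_pd K l f has_derivative D l y) (at y within K)"
      using Cons der[of l y] has_derivative_transform[of y K "iter_pd K l f" "g l" "D l y"] by auto
    from pderiv_within_eq[OF K Cons.prems(3) this, of i]
    show ?case using Cons.prems D[of l y i] by simp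
  qed (use g0 in auto)
  then show "set l \<subseteq> Basis \<Longrightarrow> length l \<le> s \<Longrightarrow> y \<in> K \<Longrightarrow> iter_pd K l f y = g l y" .
  have der': "(iter_pd K l f has_derivative D l y) (at y within K)"
    if "set l \<subseteq> Basis" "length l \<le> s" "y \<in> K" for l y
    using has_derivative_transform[OF that(3) _ der[OF that], of "iter_pd K l f"] eq that by auto
  then show "Cs_on s K f"
    unfolding Cs_on_def
    by (fastforce simp: differentiable_def continuous_on_eq_continuous_within
             intro: has_derivative_continuous)
qed

lemma iter_pd_lincomb:
  assumes K: "convex K" "interior K \<noteq> {}" and f: "Cs_on s K f" and g: "Cs_on s K g"
  shows iter_pd_lincomb_eq: "set l \<subseteq> Basis \<Longrightarrow> length l \<le> s \<Longrightarrow> y \<in> K \<Longrightarrow>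
      iter_pd K l (\<lambda>y. c * f y + d * g y) y = c * iter_pd K l f y + d * iter_pd K l g y"
    and Cs_on_lincomb: "Cs_on s K (\<lambda>y. c * f y + d * g y)"
proof -
  let ?h = "\<lambda>y. c * f y + d * g y"
  have der: "((\<lambda>y. c * iter_pd K l f y + d * iter_pd K l g y) has_derivative
        (\<lambda>h. c * (\<Sum>i\<in>Basis. (h \<bullet> i) * iter_pd K (i # l) f y) + d * (\<Sum>i\<in>Basis. (h \<bullet> i) * iter_pd K (i # l) g y)))
        (at y within K)" if "set l \<subseteq> Basis" "length l < s" "y \<in> K" for l y
    by (intro has_derivative_add has_derivative_mult_right iter_pd_has_derivative[OF K f]
          iter_pd_has_derivative[OF K g] that)
  have eq: "iter_pd K l ?h y = c * iter_pd K l f y + d * iter_pd K l g y"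
    if "set l \<subseteq> Basis" "length l \<le> s" "y \<in> K" for l y
    using that
  proof (induction l arbitrary: y)
    case (Cons i l)
    have "i \<in> Basis" using Cons by simp
    have "(iter_pd K l ?h has_derivative
        (\<lambda>h. c * (\<Sum>i\<in>Basis. (h \<bullet> i) * iter_pd K (i # l) f y) + d * (\<Sum>i\<in>Basis. (h \<bullet> i) * iter_pd K (i # l) g y)))
        (at y within K)"
      by (rule has_derivative_transform[OF _ _ der]) (use Cons in auto)
    from pderiv_within_eq[OF K Cons.prems(3) this, of i] \<open>i \<in> Basis\<close>
    show ?case by (simp add: inner_Basis if_distrib if_distribR cong: if_cong)
  qed auto
  then show "set l \<subseteq> Basis \<Longrightarrow> length l \<le> s \<Longrightarrow> y \<in> K \<Longrightarrow>
      iter_pd K l ?h y = c * iter_pd K l f y + d * iter_pd K l g y" .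
  show "Cs_on s K ?h"
    unfolding Cs_on_def
  proof (intro conjI allI impI ballI)
    fix l :: "'a list" and y assume l: "set l \<subseteq> Basis \<and> length l < s" and y: "y \<in> K"
    show "iter_pd K l ?h differentiable at y within K"
      unfolding differentiable_def
      by (rule exI, rule has_derivative_transform[OF _ _ der]) (use l y eq in auto)
  next
    fix l :: "'a list" assume l: "set l \<subseteq> Basis \<and> length l \<le> s"
    have "continuous_on K (\<lambda>y. c * iter_pd K l f y + d * iter_pd K l g y)"
      using f g l by (auto simp: Cs_on_def intro!: continuous_intros)
    then show "continuous_on K (iter_pd K l ?h)"
      using l eq by (subst continuous_on_cong[OF refl, of K]) auto
  qed
qed

lemma Cs_on_diff: 
  assumes "convex K" "interior K \<noteq> {}" "Cs_on s K f" "Cs_on s K g"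
  shows "Cs_on s K (f - g)"
    and iter_pd_diff: "set l \<subseteq> Basis \<Longrightarrow> length l \<le> s \<Longrightarrow> y \<in> K \<Longrightarrow> iter_pd K l (f - g) y = iter_pd K l f y - iter_pd K l g y"
proof -
  have "f - g = (\<lambda>y. 1 * f y + (-1) * g y)" by auto
  then show "Cs_on s K (f - g)"
    "set l \<subseteq> Basis \<Longrightarrow> length l \<le> s \<Longrightarrow> y \<in> K \<Longrightarrow> iter_pd K l (f - g) y = iter_pd K l f y - iter_pd K l g y"
    using Cs_on_lincomb[OF assms, of 1 "-1"] iter_pd_lincomb_eq[OF assms, of l y 1 "-1"] by simp_all
qed

section \<open>The C^s norm on the closed ball and its Borel sets\<close>

lemma cball_body: "W > 0 \<Longrightarrow> convex (cball 0 W :: 'a::euclidean_space set)"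
  "W > 0 \<Longrightarrow> interior (cball 0 W :: 'a::euclidean_space set) \<noteq> {}"
  by auto

text \<open>There are finitely many words, and each derivative is continuous on a compact ball.
  Without boundedness the real \<open>Sup\<close> in \<open>cs_norm\<close> would carry no
  information.\<close>

lemma cs_norm_bdd:
  fixes f :: "'a::euclidean_space \<Rightarrow> real"
  assumes "Cs_on s (cball 0 W) f"
  shows "bdd_above {\<bar>iter_pd (cball 0 W) l f y\<bar> | l y. set l \<subseteq> Basis \<and> length l \<le> s \<and> y \<in> cball 0 W}"
proof -
  let ?A = "{l :: 'a list. set l \<subseteq> Basis \<and> length l \<le> s}"
  have "bdd_above ((\<lambda>y. \<bar>iter_pd (cball 0 W) l f y\<bar>) ` cball 0 W)" if "l \<in> ?A" for l
  proof -
    have "compact ((\<lambda>y. \<bar>iter_pd (cball 0 W) l f y\<bar>) ` cball 0 W)"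
      using assms that by (intro compact_continuous_image continuous_intros) (auto simp: Cs_on_def)
    then show ?thesis by (rule compact_imp_bounded[THEN bounded_imp_bdd_above])
  qed
  then have "bdd_above (\<Union>l\<in>?A. (\<lambda>y. \<bar>iter_pd (cball 0 W) l f y\<bar>) ` cball 0 W)"
    by (subst bdd_above_UN) (auto simp: finite_lists_length_le)
  also have "(\<Union>l\<in>?A. (\<lambda>y. \<bar>iter_pd (cball 0 W) l f y\<bar>) ` cball 0 W) =
    {\<bar>iter_pd (cball 0 W) l f y\<bar> | l y. set l \<subseteq> Basis \<and> length l \<le> s \<and> y \<in> cball 0 W}" by blast
  finally show ?thesis .
qed

lemma iter_pd_le_cs_norm:
  fixes f :: "'a::euclidean_space \<Rightarrow> real"
  assumes "Cs_on s (cball 0 W) f" "set l \<subseteq> Basis" "length l \<le> s" "y \<in> cball 0 W"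
  shows "\<bar>iter_pd (cball 0 W) l f y\<bar> \<le> cs_norm s W f"
  unfolding cs_norm_def by (rule cSup_upper[OF _ cs_norm_bdd]) (use assms in auto)

lemma cs_norm_leI:
  fixes f :: "'a::euclidean_space \<Rightarrow> real"
  assumes "W > 0" "\<And>l y. set l \<subseteq> Basis \<Longrightarrow> length l \<le> s \<Longrightarrow> y \<in> cball 0 W \<Longrightarrow> \<bar>iter_pd (cball 0 W) l f y\<bar> \<le> c"
  shows "cs_norm s W f \<le> c"
  unfolding cs_norm_def
proof (rule cSup_least)
  have "\<bar>iter_pd (cball 0 W) [] f 0\<bar> \<in> {\<bar>iter_pd (cball 0 W) l f y\<bar> | l y. set l \<subseteq> Basis \<and> length l \<le> s \<and> y \<in> cball 0 W}"
    using assms(1) by (intro CollectI exI[of _ "[]"] exI[of _ 0]) auto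
  then show "{\<bar>iter_pd (cball 0 W) l f y\<bar> | l y. set l \<subseteq> Basis \<and> length l \<le> s \<and> y \<in> cball 0 W} \<noteq> {}" by blast
qed (use assms in auto)

lemma cs_norm_triangle:
  fixes f g h :: "'a::euclidean_space \<Rightarrow> real"
  assumes "W > 0" "Cs_on s (cball 0 W) f" "Cs_on s (cball 0 W) g" "Cs_on s (cball 0 W) h"
  shows "cs_norm s W (f - h) \<le> cs_norm s W (f - g) + cs_norm s W (g - h)"
proof (rule cs_norm_leI[OF assms(1)])
  fix l :: "'a list" and y :: 'a
  assume l: "set l \<subseteq> Basis" "length l \<le> s" "y \<in> cball 0 W"
  note K = cball_body[OF assms(1), where 'a='a]
  have "\<bar>iter_pd (cball 0 W) l (f - g) y\<bar> \<le> cs_norm s W (f - g)" "\<bar>iter_pd (cball 0 W) l (g - h) y\<bar> \<le> cs_norm s W (g - h)"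
    by (intro iter_pd_le_cs_norm l Cs_on_diff K assms)+
  then show "\<bar>iter_pd (cball 0 W) l (f - h) y\<bar> \<le> cs_norm s W (f - g) + cs_norm s W (g - h)"
    using l assms by (simp add: iter_pd_diff[OF K])
qed

lemma Cs_space_diff_eval:
  assumes "W > 0" "f \<in> Cs_space s W" "g \<in> Cs_space s W" "y \<in> cball 0 W"
  shows "\<bar>f y - g y\<bar> \<le> cs_norm s W (f - g)"
  using iter_pd_le_cs_norm[of s W "f - g" "[]" y] assms Cs_on_diff[OF cball_body[OF assms(1)], of s f g]
  by (auto simp: Cs_space_def)

lemma space_cs_borel[simp]: "space (cs_borel s W) = Cs_space s W"
  and sets_cs_borel: "sets (cs_borel s W) = sigma_sets (Cs_space s W) {U. cs_open s W U}"
  by (auto simp: cs_borel_def cs_open_def intro!: sets_measure_of space_measure_of)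

lemma cs_open_sets: "cs_open s W U \<Longrightarrow> U \<in> sets (cs_borel s W)"
  by (auto simp: sets_cs_borel)

text \<open>This makes enlargements measurable, so that the measures in
  \<open>levy_prokhorov\<close> are taken of genuine events.\<close>

lemma cs_enlarge_open:
  fixes A :: "('a::euclidean_space \<Rightarrow> real) set"
  assumes "W > 0" "A \<subseteq> Cs_space s W"
  shows "cs_open s W (cs_enlarge s W A e)"
  unfolding cs_open_def
proof (intro conjI ballI)
  fix p assume "p \<in> cs_enlarge s W A e"
  then obtain q where p: "p \<in> Cs_space s W" and q: "q \<in> A" "cs_norm s W (p - q) < e"
    by (auto simp: cs_enlarge_def)
  show "\<exists>d>0. \<forall>g\<in>Cs_space s W. cs_norm s W (g - p) < d \<longrightarrow> g \<in> cs_enlarge s W A e"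
  proof (intro exI[of _ "e - cs_norm s W (p - q)"] conjI ballI impI)
    fix g assume g: "g \<in> Cs_space s W" "cs_norm s W (g - p) < e - cs_norm s W (p - q)"
    have "cs_norm s W (g - q) \<le> cs_norm s W (g - p) + cs_norm s W (p - q)"
      using g p q assms by (intro cs_norm_triangle) (auto simp: Cs_space_def)
    then have "cs_norm s W (g - q) < e" using g q by simp
    then show "g \<in> cs_enlarge s W A e" using g q(1) by (auto simp: cs_enlarge_def)
  qed (use q in simp)
qed (auto simp: cs_enlarge_def)

lemma eval_measurable[measurable]:
  fixes y :: "'a::euclidean_space"
  assumes W: "W > 0" and y: "y \<in> cball 0 W"
  shows "(\<lambda>F. F y) \<in> borel_measurable (cs_borel s W)"
proof (rule borel_measurableI)
  fix S :: "real set" assume S: "open S"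
  have "cs_open s W ((\<lambda>F. F y) -` S \<inter> Cs_space s W)"
    unfolding cs_open_def
  proof (intro conjI ballI)
    fix f assume f: "f \<in> (\<lambda>F. F y) -` S \<inter> Cs_space s W"
    then obtain e where e: "e > 0" "\<And>t. dist t (f y) < e \<Longrightarrow> t \<in> S"
      using S by (auto simp: open_dist)
    show "\<exists>e>0. \<forall>g\<in>Cs_space s W. cs_norm s W (g - f) < e \<longrightarrow> g \<in> (\<lambda>F. F y) -` S \<inter> Cs_space s W"
    proof (intro exI[of _ e] conjI ballI impI)
      fix g assume g: "g \<in> Cs_space s W" "cs_norm s W (g - f) < e"
      then have "\<bar>g y - f y\<bar> < e" using Cs_space_diff_eval[OF W _ _ y, of g s f] f by auto
      then show "g \<in> (\<lambda>F. F y) -` S \<inter> Cs_space s W" using e(2)[of "g y"] g by (auto simp: dist_real_def)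
    qed (use e in auto)
  qed auto
  then show "(\<lambda>F. F y) -` S \<inter> space (cs_borel s W) \<in> sets (cs_borel s W)"
    by (simp add: cs_open_sets)
qed

section \<open>Derivatives of monomials\<close>

text \<open>Monomials are indexed by words, not multi-indices. A multi-index is then counted once
  per ordering, so Taylor's formula has the single factor \<open>1 / fact (length bs)\<close> and
  sums over words of length k are k-th powers (\<open>sum_words_length\<close>).\<close>

definition mon :: "'a::euclidean_space list \<Rightarrow> 'a \<Rightarrow> real" where
  "mon bs y = (\<Prod>b\<leftarrow>bs. y \<bullet> b)"

lemma mon_simps[simp]: "mon [] y = 1" "mon (b # bs) y = (y \<bullet> b) * mon bs y"
  by (simp_all add: mon_def)

text \<open>Leibniz rule, one term per letter. The direction may be any vector, so the same
  recursion yields the whole derivative as a function of the increment.\<close>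

fun mon_deriv :: "'a::euclidean_space \<Rightarrow> 'a list \<Rightarrow> (real \<times> 'a list) list" where
  "mon_deriv i [] = []"
| "mon_deriv i (b # bs) = (i \<bullet> b, bs) # map (\<lambda>(c, \<gamma>). (c, b # \<gamma>)) (mon_deriv i bs)"

definition mon_comb :: "(real \<times> 'a list) list \<Rightarrow> 'a::euclidean_space \<Rightarrow> real" where
  "mon_comb L y = (\<Sum>(c, \<gamma>)\<leftarrow>L. c * mon \<gamma> y)"

lemma mon_comb_simps[simp]: "mon_comb [] y = 0" "mon_comb ((c, \<gamma>) # L) y = c * mon \<gamma> y + mon_comb L y"
  "mon_comb (L @ L') y = mon_comb L y + mon_comb L' y"
  by (simp_all add: mon_comb_def)

lemma mon_comb_Cons_map: "mon_comb (map (\<lambda>(c, \<gamma>). (c, b # \<gamma>)) L) y = (y \<bullet> b) * mon_comb L y"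
  by (induction L) (auto simp: algebra_simps)

lemma mon_comb_scale_map: "mon_comb (map (\<lambda>(d, \<gamma>). (c * d, \<gamma>)) L) y = c * mon_comb L y"
  by (induction L) (auto simp: algebra_simps)

lemma mon_has_derivative:
  "(mon bs has_derivative (\<lambda>h. mon_comb (mon_deriv h bs) y)) (at y within K)"
proof (induction bs)
  case (Cons b bs)
  have eq: "mon (b # bs) = (\<lambda>y. (y \<bullet> b) * mon bs y)" by (simp add: fun_eq_iff)
  have "(mon (b # bs) has_derivative (\<lambda>h. (y \<bullet> b) * mon_comb (mon_deriv h bs) y + (h \<bullet> b) * mon bs y)) (at y within K)"
    unfolding eq by (intro has_derivative_mult has_derivative_inner_left has_derivative_ident Cons)
  then show ?case unfolding eq by (simp add: mon_comb_Cons_map add.commute)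
qed (simp add: mon_def[abs_def])

fun mon_iter :: "'a::euclidean_space list \<Rightarrow> 'a list \<Rightarrow> (real \<times> 'a list) list" where
  "mon_iter [] bs = [(1, bs)]"
| "mon_iter (i # l) bs = concat (map (\<lambda>(c, \<gamma>). map (\<lambda>(d, \<delta>). (c * d, \<delta>)) (mon_deriv i \<gamma>)) (mon_iter l bs))"

lemma mon_comb_deriv:
  "(mon_comb L has_derivative
     (\<lambda>h. mon_comb (concat (map (\<lambda>(c, \<gamma>). map (\<lambda>(d, \<delta>). (c * d, \<delta>)) (mon_deriv h \<gamma>)) L)) y)) (at y within K)"
proof (induction L)
  case (Cons p L)
  obtain c \<gamma> where p: "p = (c, \<gamma>)" by force
  have "((\<lambda>y. c * mon \<gamma> y + mon_comb L y) has_derivative (\<lambda>h. c * mon_comb (mon_deriv h \<gamma>) y +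
    mon_comb (concat (map (\<lambda>(c, \<gamma>). map (\<lambda>(d, \<delta>). (c * d, \<delta>)) (mon_deriv h \<gamma>)) L)) y)) (at y within K)"
    by (intro has_derivative_add has_derivative_mult_right mon_has_derivative Cons)
  moreover have "mon_comb (p # L) = (\<lambda>y. c * mon \<gamma> y + mon_comb L y)" by (simp add: p fun_eq_iff)
  ultimately show ?case by (simp add: p mon_comb_scale_map)
qed (simp add: mon_comb_def[abs_def])

lemma mon_iter_pd:
  assumes K: "convex K" "interior K \<noteq> {}"
  shows mon_iter_pd_eq: "set l \<subseteq> Basis \<Longrightarrow> y \<in> K \<Longrightarrow> iter_pd K l (mon bs) y = mon_comb (mon_iter l bs) y"
    and mon_Cs_on: "Cs_on s K (mon bs)"
proof -
  note * = iter_pd_family[OF K, of "mon bs" "\<lambda>l. mon_comb (mon_iter l bs)" _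
     "\<lambda>l y h. mon_comb (concat (map (\<lambda>(c, \<gamma>). map (\<lambda>(d, \<delta>). (c * d, \<delta>)) (mon_deriv h \<gamma>)) (mon_iter l bs))) y"]
  show "Cs_on s K (mon bs)" by (rule *) (auto intro: mon_comb_deriv)
  show "set l \<subseteq> Basis \<Longrightarrow> y \<in> K \<Longrightarrow> iter_pd K l (mon bs) y = mon_comb (mon_iter l bs) y"
    by (rule *(1)[where s="length l"]) (auto intro: mon_comb_deriv)
qed

lemma mon_le:
  assumes "set bs \<subseteq> Basis" "norm y \<le> W"
  shows "\<bar>mon bs y\<bar> \<le> W ^ length bs"
  using assms(1)
proof (induction bs)
  case (Cons b bs)
  have "\<bar>y \<bullet> b\<bar> \<le> W" using Cons Basis_le_norm[of b y] assms(2) by auto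
  then show ?case using Cons by (auto simp: abs_mult intro!: mult_mono)
qed simp

lemma mon_deriv_bounds:
  assumes "set bs \<subseteq> Basis" "i \<in> Basis"
  shows mon_deriv_weight: "(\<Sum>(c, \<gamma>)\<leftarrow>mon_deriv i bs. \<bar>c\<bar>) \<le> length bs"
    and mon_deriv_words: "(c, \<gamma>) \<in> set (mon_deriv i bs) \<Longrightarrow> set \<gamma> \<subseteq> Basis \<and> length \<gamma> \<le> length bs"
proof -
  show "(\<Sum>(c, \<gamma>)\<leftarrow>mon_deriv i bs. \<bar>c\<bar>) \<le> length bs"
    using assms(1)
  proof (induction bs)
    case (Cons b bs)
    have "\<bar>i \<bullet> b\<bar> \<le> 1" using Cons assms(2) by (auto simp: inner_Basis)
    moreover have "(\<lambda>(c, \<gamma>). \<bar>c\<bar>) \<circ> (\<lambda>(c, \<gamma>). (c, b # \<gamma>)) = (\<lambda>(c :: real, \<gamma> :: 'a list). \<bar>c\<bar>)" by (auto simp: fun_eq_iff)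
    ultimately show ?case using Cons by simp
  qed simp
  show "(c, \<gamma>) \<in> set (mon_deriv i bs) \<Longrightarrow> set \<gamma> \<subseteq> Basis \<and> length \<gamma> \<le> length bs"
    using assms(1) by (induction bs arbitrary: c \<gamma>) fastforce+
qed

text \<open>Each differentiation multiplies the total coefficient by at most the length of the word
  and never lengthens words. Derivatives up to order s therefore cost only a polynomial factor in
  the degree, which the factorial in the Taylor formula absorbs later.\<close>

lemma mon_iter_bounds:
  assumes "set bs \<subseteq> Basis" "set l \<subseteq> Basis"
  shows mon_iter_weight: "(\<Sum>(c, \<gamma>)\<leftarrow>mon_iter l bs. \<bar>c\<bar>) \<le> real (length bs) ^ length l"
    and mon_iter_words: "(c, \<gamma>) \<in> set (mon_iter l bs) \<Longrightarrow> set \<gamma> \<subseteq> Basis \<and> length \<gamma> \<le> length bs"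
proof -
  have words: "set \<gamma> \<subseteq> Basis \<and> length \<gamma> \<le> length bs" 
    if "(c, \<gamma>) \<in> set (mon_iter l bs)" "set l \<subseteq> Basis" for l c \<gamma>
    using that
  proof (induction l arbitrary: c \<gamma>)
    case (Cons i l)
    then obtain c' \<gamma>' d where "(c', \<gamma>') \<in> set (mon_iter l bs)" "(d, \<gamma>) \<in> set (mon_deriv i \<gamma>')" by auto
    then show ?case using Cons.IH[of c' \<gamma>'] Cons.prems mon_deriv_words[of \<gamma>' i d \<gamma>] by force
  qed (use assms in auto)
  then show "(c, \<gamma>) \<in> set (mon_iter l bs) \<Longrightarrow> set \<gamma> \<subseteq> Basis \<and> length \<gamma> \<le> length bs" using assms by blast
  show "(\<Sum>(c, \<gamma>)\<leftarrow>mon_iter l bs. \<bar>c\<bar>) \<le> real (length bs) ^ length l"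
    using assms(2)
  proof (induction l)
    case (Cons i l)
    define L where "L = mon_iter l bs"
    have L: "set \<gamma> \<subseteq> Basis \<and> length \<gamma> \<le> length bs" if "(c, \<gamma>) \<in> set L" for c \<gamma>
      using words[of c \<gamma> l] that Cons by (auto simp: L_def)
    have "(\<Sum>(c, \<gamma>)\<leftarrow>concat (map (\<lambda>(c, \<gamma>). map (\<lambda>(d, \<delta>). (c * d, \<delta>)) (mon_deriv i \<gamma>)) L). \<bar>c\<bar>)
      \<le> (\<Sum>(c, \<gamma>)\<leftarrow>L. \<bar>c\<bar>) * real (length bs)"
      using L
    proof (induction L)
      case (Cons p L)
      obtain c \<gamma> where p: "p = (c, \<gamma>)" by force
      have eq: "(\<Sum>(c, \<gamma>)\<leftarrow>map (\<lambda>(d, \<delta>). (c * d, \<delta>)) M. \<bar>c\<bar>) = \<bar>c\<bar> * (\<Sum>(c, \<gamma>)\<leftarrow>M. \<bar>c\<bar>)" for M :: "(real \<times> 'a list) list"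
        by (induction M) (auto simp: algebra_simps abs_mult)
      have "(\<Sum>(c, \<gamma>)\<leftarrow>mon_deriv i \<gamma>. \<bar>c\<bar>) \<le> length bs"
        using mon_deriv_weight[of \<gamma> i] Cons.prems[of c \<gamma>] \<open>set (i # l) \<subseteq> Basis\<close> by (auto simp: p)
      then have "\<bar>c\<bar> * (\<Sum>(c, \<gamma>)\<leftarrow>mon_deriv i \<gamma>. \<bar>c\<bar>) \<le> \<bar>c\<bar> * length bs" by (intro mult_left_mono) auto
      moreover have "(\<Sum>(c, \<gamma>)\<leftarrow>concat (map (\<lambda>(c, \<gamma>). map (\<lambda>(d, \<delta>). (c * d, \<delta>)) (mon_deriv i \<gamma>)) L). \<bar>c\<bar>)
        \<le> (\<Sum>(c, \<gamma>)\<leftarrow>L. \<bar>c\<bar>) * real (length bs)" using Cons by force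
      ultimately have "\<bar>c\<bar> * (\<Sum>(c, \<gamma>)\<leftarrow>mon_deriv i \<gamma>. \<bar>c\<bar>) +
          (\<Sum>(c, \<gamma>)\<leftarrow>concat (map (\<lambda>(c, \<gamma>). map (\<lambda>(d, \<delta>). (c * d, \<delta>)) (mon_deriv i \<gamma>)) L). \<bar>c\<bar>)
        \<le> (\<bar>c\<bar> + (\<Sum>(c, \<gamma>)\<leftarrow>L. \<bar>c\<bar>)) * real (length bs)" unfolding distrib_right by (rule add_mono)
      then show ?case by (simp add: p eq del: map_map)
    qed simp
    also have "\<dots> \<le> real (length bs) ^ length l * real (length bs)"
      using Cons by (intro mult_right_mono) (auto simp: L_def)
    finally show ?case by (simp add: L_def mult.commute)
  qed simp
qed

lemma mon_comb_le:
  assumes "\<And>c \<gamma>. (c, \<gamma>) \<in> set L \<Longrightarrow> \<bar>mon \<gamma> y\<bar> \<le> B"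
  shows "\<bar>mon_comb L y\<bar> \<le> (\<Sum>(c, \<gamma>)\<leftarrow>L. \<bar>c\<bar>) * B"
  using assms
proof (induction L)
  case (Cons p L)
  obtain c \<gamma> where p: "p = (c, \<gamma>)" by force
  have "\<bar>c\<bar> * \<bar>mon \<gamma> y\<bar> \<le> \<bar>c\<bar> * B" using Cons.prems[of c \<gamma>] by (intro mult_left_mono) (auto simp: p)
  moreover have "\<bar>mon_comb L y\<bar> \<le> (\<Sum>(c, \<gamma>)\<leftarrow>L. \<bar>c\<bar>) * B" using Cons by force
  ultimately show ?case
    using abs_triangle_ineq[of "c * mon \<gamma> y" "mon_comb L y"] by (simp add: p algebra_simps abs_mult)
qed simp

lemma iter_pd_mon_le:
  fixes bs :: "'a::euclidean_space list"
  assumes W: "W \<ge> 1" and bs: "set bs \<subseteq> Basis" and l: "set l \<subseteq> Basis" "length l \<le> s" and y: "y \<in> cball 0 W"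
  shows "\<bar>iter_pd (cball 0 W) l (mon bs) y\<bar> \<le> real (Suc (length bs)) ^ s * W ^ length bs"
proof -
  have "\<bar>mon \<gamma> y\<bar> \<le> W ^ length bs" if "(c, \<gamma>) \<in> set (mon_iter l bs)" for c \<gamma>
  proof -
    note g = mon_iter_words[OF bs l(1) that]
    then have "\<bar>mon \<gamma> y\<bar> \<le> W ^ length \<gamma>" using mon_le[of \<gamma> y W] y by auto
    also have "\<dots> \<le> W ^ length bs" using g W by (intro power_increasing) auto
    finally show ?thesis .
  qed
  then have "\<bar>mon_comb (mon_iter l bs) y\<bar> \<le> (\<Sum>(c, \<gamma>)\<leftarrow>mon_iter l bs. \<bar>c\<bar>) * W ^ length bs" by (rule mon_comb_le)
  also have "\<dots> \<le> real (length bs) ^ length l * W ^ length bs"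
    using W by (intro mult_right_mono mon_iter_weight bs l) auto
  \<comment> \<open>Raising the exponent to s needs a base that is at least 1, which
    \<open>length bs\<close> is not for the empty word.\<close>
  also have "\<dots> \<le> real (Suc (length bs)) ^ length l * W ^ length bs"
    using W by (intro mult_right_mono power_mono) auto
  also have "\<dots> \<le> real (Suc (length bs)) ^ s * W ^ length bs"
    using W l by (intro mult_right_mono power_increasing) auto
  finally show ?thesis using l y W by (subst mon_iter_pd_eq) auto
qed

text \<open>Induction on the word: uniform convergence of the next derivatives gives the limit a
  derivative with the limiting partials, and the induction hypothesis identifies that limit with the
  derivative of f. It transfers C^s estimates from Taylor polynomials to the field itself.\<close>

lemma iter_pd_limit:
  fixes f :: "'a::euclidean_space \<Rightarrow> real"
  assumes K: "convex K" "interior K \<noteq> {}" and f: "Cs_on s K f" and fn: "\<And>n. Cs_on s K (fn n)"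
    and lim: "\<And>y. y \<in> K \<Longrightarrow> (\<lambda>n. fn n y) \<longlonglongrightarrow> f y"
    and cau: "\<And>l. set l \<subseteq> Basis \<Longrightarrow> length l \<le> s \<Longrightarrow> uniformly_Cauchy_on K (\<lambda>n. iter_pd K l (fn n))"
    and l: "set l \<subseteq> Basis" "length l \<le> s" and y: "y \<in> K"
  shows "(\<lambda>n. iter_pd K l (fn n) y) \<longlonglongrightarrow> iter_pd K l f y"
  using l y
proof (induction l arbitrary: y)
  case (Cons i l)
  have "\<exists>g. uniform_limit K (\<lambda>n. iter_pd K (j # l) (fn n)) g sequentially" if "j \<in> Basis" for j
    using Cauchy_uniformly_convergent[OF cau[of "j # l"]] Cons that by (auto simp: uniformly_convergent_on_def)
  then obtain G where G: "\<And>j. j \<in> Basis \<Longrightarrow> uniform_limit K (\<lambda>n. iter_pd K (j # l) (fn n)) (G j) sequentially"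
    by metis
  have "\<exists>g. \<forall>x\<in>K. (\<lambda>n. iter_pd K l (fn n) x) \<longlonglongrightarrow> g x \<and>
      (g has_derivative (\<lambda>h. \<Sum>j\<in>Basis. (h \<bullet> j) * G j x)) (at x within K)"
  proof (rule has_derivative_sequence[OF K(1)])
    show "(iter_pd K l (fn n) has_derivative (\<lambda>h. \<Sum>j\<in>Basis. (h \<bullet> j) * iter_pd K (j # l) (fn n) x)) (at x within K)"
      if "x \<in> K" for n x
      by (rule iter_pd_has_derivative[OF K fn]) (use Cons that in auto)
    fix e :: real assume e: "e > 0"
    let ?e = "e / DIM('a)"
    have "\<forall>\<^sub>F n in sequentially. \<forall>j\<in>Basis. \<forall>x\<in>K. dist (iter_pd K (j # l) (fn n) x) (G j x) < ?e"
      using G e unfolding uniform_limit_iff by (intro eventually_ball_finite) auto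
    then show "\<forall>\<^sub>F n in sequentially. \<forall>x\<in>K. \<forall>h. norm ((\<Sum>j\<in>Basis. (h \<bullet> j) * iter_pd K (j # l) (fn n) x) - (\<Sum>j\<in>Basis. (h \<bullet> j) * G j x)) \<le> e * norm h"
    proof (rule eventually_mono, intro ballI allI)
      fix n x h assume *: "\<forall>j\<in>Basis. \<forall>x\<in>K. dist (iter_pd K (j # l) (fn n) x) (G j x) < ?e" and x: "x \<in> K"
      have "norm ((\<Sum>j\<in>Basis. (h \<bullet> j) * iter_pd K (j # l) (fn n) x) - (\<Sum>j\<in>Basis. (h \<bullet> j) * G j x))
         \<le> (\<Sum>j\<in>Basis. norm ((h \<bullet> j) * (iter_pd K (j # l) (fn n) x - G j x)))"
        unfolding sum_subtractf[symmetric] right_diff_distrib[symmetric] by (rule norm_sum)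
      also have "\<dots> \<le> (\<Sum>j\<in>(Basis::'a set). norm h * ?e)"
      proof (rule sum_mono)
        fix j :: 'a assume j: "j \<in> Basis"
        then have "\<bar>iter_pd K (j # l) (fn n) x - G j x\<bar> \<le> ?e"
          using * x by (auto simp: dist_real_def intro: less_imp_le)
        then show "norm ((h \<bullet> j) * (iter_pd K (j # l) (fn n) x - G j x)) \<le> norm h * ?e"
          unfolding real_norm_def abs_mult using j by (intro mult_mono Basis_le_norm) auto
      qed
      also have "\<dots> = e * norm h" by simp
      finally show "norm ((\<Sum>j\<in>Basis. (h \<bullet> j) * iter_pd K (j # l) (fn n) x) - (\<Sum>j\<in>Basis. (h \<bullet> j) * G j x)) \<le> e * norm h" .
    qed
  next
    show "y \<in> K" by fact
    show "(\<lambda>n. iter_pd K l (fn n) y) \<longlonglongrightarrow> iter_pd K l f y" using Cons by auto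
  qed
  then obtain g where g: "\<And>x. x \<in> K \<Longrightarrow> (\<lambda>n. iter_pd K l (fn n) x) \<longlonglongrightarrow> g x"
    "\<And>x. x \<in> K \<Longrightarrow> (g has_derivative (\<lambda>h. \<Sum>j\<in>Basis. (h \<bullet> j) * G j x)) (at x within K)" by blast
  have eq: "iter_pd K l f x = g x" if "x \<in> K" for x
    by (rule LIMSEQ_unique[OF Cons.IH g(1)]) (use Cons that in auto)
  have "(iter_pd K l f has_derivative (\<lambda>h. \<Sum>j\<in>Basis. (h \<bullet> j) * G j y)) (at y within K)"
    by (rule has_derivative_transform[OF _ _ g(2)]) (use eq Cons in auto)
  from pderiv_within_eq[OF K Cons.prems(3) this, of i]
  have "iter_pd K (i # l) f y = G i y" using Cons.prems by (simp add: inner_Basis if_distrib if_distribR cong: if_cong)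
  then show ?case using tendsto_uniform_limitI[OF G Cons.prems(3)] Cons.prems by auto
qed (use lim in auto)

section \<open>Ball averages of characters\<close>

lemma ee_add: "ee (s + t) = ee s * ee t"
  by (simp add: ee_def cis_mult algebra_simps)

lemma ee_0[simp]: "ee 0 = 1" by (simp add: ee_def)

lemma norm_ee[simp]: "norm (ee t) = 1" by (simp add: ee_def)

lemma ee_sum: "finite S \<Longrightarrow> ee (\<Sum>n\<in>S. f n) = (\<Prod>n\<in>S. ee (f n))"
  by (induction S rule: finite_induct) (auto simp: ee_add)

lemma cnj_ee: "cnj (ee t) = ee (- t)" by (simp add: ee_def cis_cnj)

lemma ee_half: "ee (t + 1 / 2) = - ee t"
  by (simp add: ee_def distrib_left cis_mult[symmetric])

lemma continuous_on_ee[continuous_intros]: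
  "continuous_on A f \<Longrightarrow> continuous_on A (\<lambda>x. ee (f x))"
  unfolding ee_def by (intro continuous_intros)

lemma ee_measurable[measurable]: "ee \<in> borel_measurable borel"
  by (intro borel_measurable_continuous_onI continuous_intros)

lemma ee_inner_measurable[measurable]: "(\<lambda>x. ee (v \<bullet> x)) \<in> borel_measurable borel"
  by (intro borel_measurable_continuous_onI continuous_intros)

lemma ee_diff: "ee (s - t) = ee s * ee (- t)"
  using ee_add[of s "- t"] by simp

lemma integral_uniform_measure:
  fixes f :: "'a \<Rightarrow> 'b::{banach, second_countable_topology}"
  assumes f[measurable]: "f \<in> borel_measurable M" and A[measurable]: "A \<in> sets M"
    and fin: "emeasure M A \<noteq> 0" "emeasure M A \<noteq> \<infinity>"
  shows "integral\<^sup>L (uniform_measure M A) f = (\<integral>x. indicator A x *\<^sub>R f x \<partial>M) /\<^sub>R measure M A"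
proof -
  have pos: "measure M A > 0"
    using fin by (metis emeasure_eq_ennreal_measure ennreal_0 infinity_ennreal_def measure_nonneg order_less_le)
  have "uniform_measure M A = density M (\<lambda>x. ennreal (indicator A x / measure M A))"
    unfolding uniform_measure_def
    using fin pos by (intro density_cong) (auto simp: emeasure_eq_ennreal_measure divide_ennreal indicator_def
        intro!: AE_I2 simp flip: ennreal_1)
  then have "integral\<^sup>L (uniform_measure M A) f = (\<integral>x. (indicator A x / measure M A) *\<^sub>R f x \<partial>M)"
    by (simp add: integral_density pos less_imp_le)
  also have "\<dots> = (\<integral>x. (1 / measure M A) *\<^sub>R (indicator A x *\<^sub>R f x) \<partial>M)"
    by (intro Bochner_Integration.integral_cong) auto
  finally show ?thesis by (simp only: Bochner_Integration.integral_scaleR_right inverse_eq_divide)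
qed

abbreviation volR :: "real \<Rightarrow> 'a::euclidean_space measure" where
  "volR R \<equiv> uniform_measure lborel (ball 0 R)"

lemma emeasure_ball_pos:
  fixes c :: "'a::euclidean_space"
  assumes "R > 0"
  shows "emeasure lborel (ball c R) \<noteq> 0" "emeasure lborel (ball c R) \<noteq> \<infinity>"
proof -
  have "unit_ball_vol (real DIM('a)) * R ^ DIM('a) > 0"
    using assms by (intro mult_pos_pos unit_ball_vol_pos zero_less_power) auto
  then show "emeasure lborel (ball c R) \<noteq> 0" "emeasure lborel (ball c R) \<noteq> \<infinity>"
    using assms unfolding emeasure_ball[OF less_imp_le[OF assms]] by (simp_all add: ennreal_eq_0_iff not_le)
qed

lemma prob_space_volR: "R > 0 \<Longrightarrow> prob_space (volR R :: 'a::euclidean_space measure)"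
  by (intro prob_space_uniform_measure emeasure_ball_pos)

lemma integrable_volR:
  fixes f :: "'a::euclidean_space \<Rightarrow> 'b::{banach, second_countable_topology}"
  assumes "R > 0" "f \<in> borel_measurable borel" "\<And>x. norm (f x) \<le> B"
  shows "integrable (volR R) f"
proof -
  interpret prob_space "volR R :: 'a measure" by (rule prob_space_volR) fact
  show ?thesis using assms(2,3) by (intro integrable_const_bound[where B=B]) auto
qed

text \<open>Translating by a vector that flips the sign of the character turns the mean into
  the relative volume of the symmetric difference of two balls.\<close>
lemma ee_mean_tendsto_0:
  fixes v :: "'a::euclidean_space"
  assumes "v \<noteq> 0"
  shows "((\<lambda>R. \<integral>x. ee (v \<bullet> x) \<partial>volR R) \<longlongrightarrow> 0) at_top"
proof -
  define u where "u = (1 / (2 * (v \<bullet> v))) *\<^sub>R v"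
  have vu: "v \<bullet> u = 1 / 2" using assms by (simp add: u_def)
  define d where "d = norm u"
  define n where "n = DIM('a)"
  have bound: "norm (\<integral>x. ee (v \<bullet> x) \<partial>volR R) \<le> ((1 + d / R) ^ n - (1 - d / R) ^ n) / 2" if R: "R > d" for R
  proof -
    have R0: "R > 0" using R norm_ge_zero[of u] unfolding d_def by linarith
    define I where "I = (\<integral>x. indicator (ball 0 R) x *\<^sub>R ee (v \<bullet> x) \<partial>lborel)"
    have fm: "measure lborel (ball 0 S :: 'a set) = unit_ball_vol n * S ^ n" if "S \<ge> 0" for S
      using that by (simp add: content_ball n_def)
    have int: "integrable lborel (\<lambda>x. indicator A x *\<^sub>R ee (v \<bullet> x))" if "A \<in> sets borel" "bounded A" for A
    proof (rule Bochner_Integration.integrable_bound)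
      show "integrable lborel (indicator A :: 'a \<Rightarrow> real)"
        using that emeasure_bounded_finite[OF that(2)] by (simp add: integrable_indicator_iff)
    qed (use that in \<open>auto simp: indicator_def\<close>)
    have [measurable]: "(\<lambda>x. indicat_real (ball 0 R) x *\<^sub>R ee (v \<bullet> x)) \<in> borel_measurable borel"
      by (intro borel_measurable_scaleR borel_measurable_indicator ee_inner_measurable) auto
    have "I = (\<integral>x. indicator (ball 0 R) x *\<^sub>R ee (v \<bullet> x) \<partial>(distr lborel borel ((+) u)))"
      by (simp add: I_def lborel_distr_plus)
    also have "\<dots> = (\<integral>x. indicator (ball 0 R) (u + x) *\<^sub>R ee (v \<bullet> (u + x)) \<partial>lborel)"
      by (subst integral_distr) auto
    also have "\<dots> = (\<integral>x. - (indicator (ball (-u) R) x *\<^sub>R ee (v \<bullet> x)) \<partial>lborel)"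
      by (intro Bochner_Integration.integral_cong)
         (auto simp: inner_add_right vu indicator_def dist_norm norm_minus_commute ee_half add.commute[of "1/2"])
    finally have I2: "I = - (\<integral>x. indicator (ball (-u) R) x *\<^sub>R ee (v \<bullet> x) \<partial>lborel)" by simp
    have "I + I = (\<integral>x. indicator (ball 0 R) x *\<^sub>R ee (v \<bullet> x) - indicator (ball (-u) R) x *\<^sub>R ee (v \<bullet> x) \<partial>lborel)"
      by (subst Bochner_Integration.integral_diff) (auto intro!: int simp: I2[symmetric] I_def[symmetric])
    \<comment> \<open>Both balls contain \<open>ball 0 (R - d)\<close> and lie in
      \<open>ball 0 (R + d)\<close>, so the two integrands cancel off a shell of width 2 d.\<close>
    also have "norm \<dots> \<le> (\<integral>x. indicator (ball 0 (R + d)) x - indicator (ball 0 (R - d)) x \<partial>(lborel :: 'a measure))"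
    proof (rule Bochner_Integration.integral_norm_bound_integral)
      show "integrable lborel (\<lambda>x. indicator (ball 0 R) x *\<^sub>R ee (v \<bullet> x) - indicator (ball (-u) R) x *\<^sub>R ee (v \<bullet> x))"
        by (intro Bochner_Integration.integrable_diff int) auto
      show "integrable lborel (\<lambda>x :: 'a. indicator (ball 0 (R + d)) x - indicator (ball 0 (R - d)) x :: real)"
        by (intro Bochner_Integration.integrable_diff integrable_real_indicator emeasure_bounded_finite) auto
      fix x :: 'a
      have n1: "norm (x + u) \<le> norm x + d" unfolding d_def by (rule norm_triangle_ineq)
      have n2: "norm x \<le> norm (x + u) + d" unfolding d_def using norm_triangle_ineq4[of "x + u" u] by simp
      have d0: "d \<ge> 0" by (simp add: d_def)
      have b: "x \<in> ball (-u) R \<longleftrightarrow> norm (x + u) < R"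
        by (simp add: dist_norm norm_minus_commute[of "-u" x])
      have 1: "x \<in> ball 0 (R - d) \<Longrightarrow> x \<in> ball 0 R \<and> x \<in> ball (-u) R"
        unfolding b using n1 d0 by auto
      have 2: "x \<in> ball 0 R \<or> x \<in> ball (-u) R \<Longrightarrow> x \<in> ball 0 (R + d)"
        unfolding b using n2 d0 by auto
      show "norm (indicator (ball 0 R) x *\<^sub>R ee (v \<bullet> x) - indicator (ball (-u) R) x *\<^sub>R ee (v \<bullet> x))
         \<le> indicator (ball 0 (R + d)) x - indicator (ball 0 (R - d)) x"
        using 1 2 by (auto simp: indicator_def split: if_splits simp del: mem_ball)
    qed
    also have "\<dots> = measure lborel (ball 0 (R + d) :: 'a set) - measure lborel (ball 0 (R - d) :: 'a set)"
      by (subst Bochner_Integration.integral_diff; (intro integrable_real_indicator emeasure_bounded_finite)?) auto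
    also have "\<dots> = unit_ball_vol n * ((R + d) ^ n - (R - d) ^ n)"
    proof -
      have "0 \<le> R + d" "0 \<le> R - d" using R norm_ge_zero[of u] unfolding d_def by linarith+
      then show ?thesis by (simp add: fm right_diff_distrib)
    qed
    finally have nI: "norm I \<le> unit_ball_vol n * ((R + d) ^ n - (R - d) ^ n) / 2"
      by (metis (no_types, lifting) mult.commute mult_2_right norm_mult norm_numeral pos_le_divide_eq zero_less_numeral)
    have mean: "(\<integral>x. ee (v \<bullet> x) \<partial>volR R) = I /\<^sub>R (unit_ball_vol n * R ^ n)"
      using emeasure_ball_pos[OF R0, of 0] R0 by (subst integral_uniform_measure) (auto simp: I_def fm)
    have ubv: "unit_ball_vol (real n) > 0" by simp
    then have "unit_ball_vol n * R ^ n > 0" using R0 by simp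
    then have "norm (\<integral>x. ee (v \<bullet> x) \<partial>volR R) = norm I / (unit_ball_vol n * R ^ n)"
      unfolding mean norm_scaleR by (simp only: divide_inverse abs_of_pos positive_imp_inverse_positive mult.commute)
    also have "\<dots> \<le> (unit_ball_vol n * ((R + d) ^ n - (R - d) ^ n) / 2) / (unit_ball_vol n * R ^ n)"
      using R0 nI ubv by (intro divide_right_mono) auto
    also have "\<dots> = ((R + d) ^ n - (R - d) ^ n) / R ^ n / 2"
      by (simp add: less_imp_neq[OF ubv, symmetric])
    also have "\<dots> = (((R + d) / R) ^ n - ((R - d) / R) ^ n) / 2"
      unfolding power_divide diff_divide_distrib[of _ _ "R ^ n"] ..
    also have "\<dots> = ((1 + d / R) ^ n - (1 - d / R) ^ n) / 2"
      using R0 by (simp add: add_divide_distrib diff_divide_distrib[of R])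
    finally show ?thesis .
  qed
  have "((\<lambda>R. ((1 + d / R) ^ n - (1 - d / R) ^ n) / 2) \<longlongrightarrow> ((1 + 0) ^ n - (1 - 0) ^ n) / 2) at_top"
    by (intro tendsto_intros tendsto_divide_0[OF tendsto_const] filterlim_at_top_imp_at_infinity filterlim_ident)
       auto
  then have "((\<lambda>R. ((1 + d / R) ^ n - (1 - d / R) ^ n) / 2) \<longlongrightarrow> 0) at_top" by simp
  then show ?thesis
    by (rule Lim_null_comparison[rotated]) (use bound in \<open>auto intro: eventually_mono[OF eventually_gt_at_top[of d]]\<close>)
qed

lemma ee_mean_tendsto:
  fixes v :: "'a::euclidean_space"
  shows "((\<lambda>R. \<integral>x. ee (v \<bullet> x) \<partial>volR R) \<longlongrightarrow> (if v = 0 then 1 else 0)) at_top"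
proof (cases "v = 0")
  case True
  have "\<forall>\<^sub>F R in at_top. (\<integral>x. ee (v \<bullet> x) \<partial>volR R) = 1"
    using eventually_gt_at_top[of 0]
  proof eventually_elim
    case (elim R)
    interpret prob_space "volR R :: 'a measure" by (rule prob_space_volR) fact
    show ?case by (simp add: True prob_space[simplified])
  qed
  then show ?thesis using True by (simp add: tendsto_eventually)
qed (use ee_mean_tendsto_0 in auto)

text \<open>Once every off-diagonal character has mean below 1 / card S, the diagonal and the
  off-diagonal terms each contribute at most card S times C^2. The threshold for R depends on the
  frequencies alone, hence serves all coefficients simultaneously.\<close>

lemma trig_poly_mean_square:
  fixes v :: "'i \<Rightarrow> 'a::euclidean_space"
  assumes S: "finite S" and inj: "inj_on v S"
  shows "\<forall>\<^sub>F R in at_top. \<forall>c. \<forall>C :: real. (\<forall>n\<in>S. cmod (c n) \<le> C) \<longrightarrow>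
     (\<integral>x. (cmod (\<Sum>n\<in>S. c n * ee (v n \<bullet> x)))\<^sup>2 \<partial>volR R) \<le> 2 * card S * C\<^sup>2"
proof -
  define E where "E R n m = (\<integral>x. ee ((v n - v m) \<bullet> x) \<partial>volR R)" for R n m
  have "\<forall>\<^sub>F R in at_top. \<forall>n\<in>S. \<forall>m\<in>S. n \<noteq> m \<longrightarrow> cmod (E R n m) < 1 / card S"
  proof (intro eventually_ball_finite[OF S] ballI)
    fix n m assume nm: "n \<in> S" "m \<in> S"
    then have "card S > 0" using S by (auto simp: card_gt_0_iff)
    show "\<forall>\<^sub>F R in at_top. n \<noteq> m \<longrightarrow> cmod (E R n m) < 1 / card S"
    proof (cases "n = m")
      case False
      then have "((\<lambda>R. E R n m) \<longlongrightarrow> 0) at_top"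
        unfolding E_def using inj nm by (intro ee_mean_tendsto_0) (auto simp: inj_on_def)
      then show ?thesis using \<open>card S > 0\<close> order_tendstoD(2)[OF tendsto_norm[of _ 0], of "\<lambda>R. E R n m" at_top "1 / card S"]
        by (auto elim: eventually_mono)
    qed simp
  qed
  moreover have "\<forall>\<^sub>F R in at_top. R > (0::real)" by (rule eventually_gt_at_top)
  ultimately show ?thesis
  proof eventually_elim
    case (elim R)
    interpret prob_space "volR R :: 'a measure" by (rule prob_space_volR) fact
    show ?case
    proof (intro allI impI)
      fix c :: "'i \<Rightarrow> complex" and C :: real assume c: "\<forall>n\<in>S. cmod (c n) \<le> C"
      let ?Z = "\<lambda>x. \<Sum>n\<in>S. c n * ee (v n \<bullet> x)"
      have int: "integrable (volR R) (\<lambda>x. a * ee (w \<bullet> x))" for a and w :: 'a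
        by (rule integrable_volR[OF elim(2), where B="norm a"]) (auto simp: norm_mult)
      have Eb: "cmod (E R n m) \<le> (if n = m then 1 else 1 / card S)" if "n \<in> S" "m \<in> S" for n m
        using elim(1) that by (auto simp: E_def prob_space[simplified] intro: less_imp_le)
      have "complex_of_real ((cmod (?Z x))\<^sup>2) = (\<Sum>n\<in>S. \<Sum>m\<in>S. (c n * cnj (c m)) * ee ((v n - v m) \<bullet> x))" for x
        unfolding complex_norm_square cnj_sum sum_product complex_cnj_mult cnj_ee inner_diff_left ee_diff
        by (intro sum.cong refl) (simp add: mult_ac)
      then have "complex_of_real (\<integral>x. (cmod (?Z x))\<^sup>2 \<partial>volR R) = (\<integral>x. (\<Sum>n\<in>S. \<Sum>m\<in>S. (c n * cnj (c m)) * ee ((v n - v m) \<bullet> x)) \<partial>volR R)"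
        by (simp flip: integral_complex_of_real)
      also have "\<dots> = (\<Sum>n\<in>S. \<Sum>m\<in>S. (c n * cnj (c m)) * E R n m)"
        unfolding E_def
        by (subst Bochner_Integration.integral_sum, intro Bochner_Integration.integrable_sum int, intro sum.cong refl,
            subst Bochner_Integration.integral_sum, intro int, simp)
      finally have eq: "complex_of_real (\<integral>x. (cmod (?Z x))\<^sup>2 \<partial>volR R) = (\<Sum>n\<in>S. \<Sum>m\<in>S. (c n * cnj (c m)) * E R n m)" .
      have "(\<integral>x. (cmod (?Z x))\<^sup>2 \<partial>volR R) \<le> cmod (\<Sum>n\<in>S. \<Sum>m\<in>S. (c n * cnj (c m)) * E R n m)"
        unfolding eq[symmetric] norm_of_real by (rule abs_ge_self)
      also have "\<dots> \<le> (\<Sum>n\<in>S. \<Sum>m\<in>S. C\<^sup>2 * (if n = m then 1 else 1 / card S))"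
      proof -
        have "cmod (c n * cnj (c m) * E R n m) \<le> C\<^sup>2 * (if n = m then 1 else 1 / card S)"
          if nm: "n \<in> S" "m \<in> S" for n m
        proof -
          have "cmod (c n) * cmod (c m) \<le> C * C" using c nm by (intro mult_mono) (auto intro: order.trans[OF norm_ge_zero])
          then show ?thesis
            unfolding norm_mult complex_mod_cnj power2_eq_square using Eb[OF nm]
            by (rule mult_mono) auto
        qed
        then show ?thesis
          by (intro order.trans[OF norm_sum] sum_mono) blast
      qed
      also have "\<dots> \<le> (\<Sum>n\<in>S. C\<^sup>2 * 2)"
      proof (rule sum_mono)
        fix n assume n: "n \<in> S"
        have "(\<Sum>m\<in>S. if n = m then 1 else 1 / card S) \<le> (\<Sum>m\<in>S. (if n = m then 1 else 0) + 1 / card S)"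
          by (intro sum_mono) auto
        also have "\<dots> = 2" using n S by (simp add: sum.distrib card_gt_0_iff) (use n in auto)
        finally show "(\<Sum>m\<in>S. C\<^sup>2 * (if n = m then 1 else 1 / card S)) \<le> C\<^sup>2 * 2"
          unfolding sum_distrib_left[symmetric] by (intro mult_left_mono) auto
      qed
      finally show "(\<integral>x. (cmod (?Z x))\<^sup>2 \<partial>volR R) \<le> 2 * card S * C\<^sup>2" by (simp add: algebra_simps)
    qed
  qed
qed

section \<open>A central limit theorem for lacunary sums\<close>

text \<open>The product (1 + i x) (1 - x^2/2) differs from the second Taylor polynomial of exp (i x)
  by i x^3/2 only. The three errors |x|^3/6, |x|^3/2 and 2 x^4/8 add up to at most 11/12 of |x|^3
  when |x| is at most 1.\<close>

lemma iexp_McLeish_bound: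
  fixes x :: real
  assumes "\<bar>x\<bar> \<le> 1"
  shows "cmod (iexp x - (1 + \<i> * x) * exp (- x\<^sup>2 / 2)) \<le> \<bar>x\<bar> ^ 3"
proof -
  define r where "r = exp (- x\<^sup>2 / 2) - (1 - x\<^sup>2 / 2)"
  have r: "\<bar>r\<bar> \<le> x ^ 4 / 8"
  proof -
    have "\<bar>exp (- t) - (1 - t)\<bar> \<le> t\<^sup>2 / 2" if "t \<ge> 0" for t :: real
    proof -
      have pos: "1 + t + t\<^sup>2 / 2 > 0" using that by (simp add: add_pos_nonneg)
      have "1 \<le> (1 - t + t\<^sup>2 / 2) * (1 + t + t\<^sup>2 / 2)"
        using that by (simp add: algebra_simps power2_eq_square)
      also have "\<dots> \<le> (1 - t + t\<^sup>2 / 2) * exp t"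
      proof (rule mult_left_mono)
        have "0 \<le> (1 - t)\<^sup>2" by simp
        then show "0 \<le> 1 - t + t\<^sup>2 / 2" by (simp add: power2_diff)
      qed (rule exp_lower_Taylor_quadratic[OF that])
      finally have "exp (- t) \<le> 1 - t + t\<^sup>2 / 2" by (simp add: exp_minus field_simps)
      moreover have "1 - t \<le> exp (- t)" using exp_ge_add_one_self[of "- t"] by simp
      ultimately show ?thesis by (simp add: abs_le_iff)
    qed
    from this[of "x\<^sup>2 / 2"] show ?thesis by (simp add: r_def power_divide power_mult[symmetric])
  qed
  have e: "cmod (iexp x - (1 + \<i> * x - x\<^sup>2 / 2)) \<le> \<bar>x\<bar> ^ 3 / 6"
    using iexp_approx1[of x 2] by (simp add: numeral_eq_Suc power2_eq_square field_simps)
  have n: "cmod (1 + \<i> * x) \<le> 2"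
    using assms norm_triangle_ineq[of 1 "\<i> * complex_of_real x"] by (simp add: norm_mult)
  have eq: "iexp x - (1 + \<i> * x) * exp (- x\<^sup>2 / 2) = (iexp x - (1 + \<i> * x - x\<^sup>2 / 2)) + \<i> * x ^ 3 / 2 - (1 + \<i> * x) * r"
    by (simp add: r_def algebra_simps power2_eq_square power3_eq_cube)
  have "cmod (iexp x - (1 + \<i> * x) * exp (- x\<^sup>2 / 2)) \<le> \<bar>x\<bar> ^ 3 / 6 + \<bar>x\<bar> ^ 3 / 2 + 2 * (x ^ 4 / 8)"
  proof -
    have "cmod (\<i> * complex_of_real (x ^ 3) / 2) = \<bar>x\<bar> ^ 3 / 2" by (simp add: norm_mult norm_divide power_abs del: of_real_power)
    moreover have "cmod ((1 + \<i> * complex_of_real x) * complex_of_real r) \<le> 2 * (x ^ 4 / 8)"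
      unfolding norm_mult norm_of_real by (intro mult_mono n r) auto
    ultimately show ?thesis
      unfolding eq using e norm_triangle_ineq4[of "(iexp x - (1 + \<i> * x - x\<^sup>2 / 2)) + \<i> * x ^ 3 / 2" "(1 + \<i> * x) * r"]
        norm_triangle_ineq[of "iexp x - (1 + \<i> * x - x\<^sup>2 / 2)" "\<i> * x ^ 3 / 2"] by linarith
  qed
  moreover have "x ^ 4 \<le> \<bar>x\<bar> ^ 3"
    using power_decreasing[of 3 4 "\<bar>x\<bar>"] assms by simp
  moreover have "0 \<le> \<bar>x\<bar> ^ 3" by simp
  ultimately show ?thesis by linarith
qed

lemma exp_minus_diff_le:
  fixes a b :: real
  assumes "a \<ge> 0" "b \<ge> 0"
  shows "\<bar>exp (- a) - exp (- b)\<bar> \<le> \<bar>a - b\<bar>"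
proof -
  have *: "exp (- a) - exp (- b) \<le> b - a" if "0 \<le> a" "a \<le> b" for a b :: real
  proof -
    have "exp (- a) - exp (- b) = exp (- a) * (1 - exp (- (b - a)))"
      by (simp add: algebra_simps flip: exp_add)
    also have "\<dots> \<le> 1 * (b - a)"
      using that exp_ge_add_one_self[of "- (b - a)"] by (intro mult_mono) (linarith | simp)+
    finally show ?thesis by simp
  qed
  show ?thesis
    using *[of a b] *[of b a] assms by (cases "a \<le> b") auto
qed

text \<open>The factorisation of the characteristic function of a lacunary sum going back to
  Salem and Zygmund: the product \<open>\<Prod>(1 + i X\<^sub>n)\<close> is a trigonometric polynomial with mean one.\<close>
lemma iexp_sum_bound:
  fixes X :: "'i \<Rightarrow> real" and B v :: real
  assumes S: "finite S" and B: "B \<le> 1" "\<And>n. n \<in> S \<Longrightarrow> \<bar>X n\<bar> \<le> B" and v: "v \<ge> 0"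
  shows "cmod (iexp (\<Sum>n\<in>S. X n) - (\<Prod>n\<in>S. 1 + \<i> * X n) * exp (- v / 2))
    \<le> exp (card S * B\<^sup>2 / 2) * (card S * B ^ 3 + \<bar>(\<Sum>n\<in>S. (X n)\<^sup>2) - v\<bar> / 2)"
proof -
  define T where "T = (\<Prod>n\<in>S. 1 + \<i> * complex_of_real (X n))"
  define u where "u n = iexp (X n) / (1 + \<i> * X n)" for n
  define w where "w n = complex_of_real (exp (- (X n)\<^sup>2 / 2))" for n
  have n1: "cmod (1 + \<i> * complex_of_real x) = sqrt (1 + x\<^sup>2)" for x
    by (simp add: cmod_def)
  have ne: "1 + \<i> * complex_of_real x \<noteq> 0" for x
    by (simp add: complex_eq_iff)
  have ge: "1 \<le> cmod (1 + \<i> * complex_of_real x)" for x by (simp add: n1)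
  have iexp: "iexp (\<Sum>n\<in>S. X n) = T * (\<Prod>n\<in>S. u n)"
  proof -
    have "T * (\<Prod>n\<in>S. u n) = (\<Prod>n\<in>S. iexp (X n))"
      unfolding T_def u_def by (subst prod.distrib[symmetric]) (simp add: ne)
    then show ?thesis by (simp add: exp_sum[OF S] sum_distrib_left)
  qed
  \<comment> \<open>Division by \<open>1 + \<i> * X n\<close>, whose modulus is at least 1, leaves
    factors \<open>u n\<close> and \<open>w n\<close> in the unit disc, so the difference of the
    products is at most the sum of the differences.\<close>
  have uw: "cmod ((\<Prod>n\<in>S. u n) - (\<Prod>n\<in>S. w n)) \<le> card S * B ^ 3"
  proof -
    have "cmod ((\<Prod>n\<in>S. u n) - (\<Prod>n\<in>S. w n)) \<le> (\<Sum>n\<in>S. cmod (u n - w n))"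
      by (intro norm_prod_diff) (auto simp: u_def w_def norm_divide divide_le_eq_1 intro: order.trans[OF _ ge])
    also have "\<dots> \<le> (\<Sum>n\<in>S. B ^ 3)"
    proof (rule sum_mono)
      fix n assume n: "n \<in> S"
      have "u n - w n = (iexp (X n) - (1 + \<i> * X n) * w n) / (1 + \<i> * X n)"
        using ne[of "X n"] by (simp add: u_def field_simps)
      then have "cmod (u n - w n) \<le> cmod (iexp (X n) - (1 + \<i> * X n) * w n)"
        using divide_left_mono[OF ge[of "X n"], of "cmod (iexp (X n) - (1 + \<i> * X n) * w n)"] ne[of "X n"]
        by (simp add: norm_divide del: norm_conv_dist)
      also have "\<dots> \<le> \<bar>X n\<bar> ^ 3" unfolding w_def using B n by (intro iexp_McLeish_bound) force
      also have "\<dots> \<le> B ^ 3" using B n by (intro power_mono) auto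
      finally show "cmod (u n - w n) \<le> B ^ 3" .
    qed
    finally show ?thesis by simp
  qed
  have wv: "cmod ((\<Prod>n\<in>S. w n) - exp (- v / 2)) \<le> \<bar>(\<Sum>n\<in>S. (X n)\<^sup>2) - v\<bar> / 2"
  proof -
    have "(\<Prod>n\<in>S. w n) = complex_of_real (exp (- ((\<Sum>n\<in>S. (X n)\<^sup>2) / 2)))"
      by (simp add: w_def exp_sum[OF S, symmetric] sum_negf sum_divide_distrib flip: of_real_prod)
    then have "cmod ((\<Prod>n\<in>S. w n) - exp (- v / 2)) = \<bar>exp (- ((\<Sum>n\<in>S. (X n)\<^sup>2) / 2)) - exp (- (v / 2))\<bar>"
      by (simp flip: of_real_diff)
    also have "\<dots> \<le> \<bar>(\<Sum>n\<in>S. (X n)\<^sup>2) / 2 - v / 2\<bar>"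
      using v by (intro exp_minus_diff_le) (auto intro: sum_nonneg)
    finally show ?thesis by (simp add: diff_divide_distrib[symmetric])
  qed
  \<comment> \<open>The product is not bounded by 1, but for amplitudes of order card S to the power
    -1/2 this exponential stays bounded.\<close>
  have T: "cmod T \<le> exp (card S * B\<^sup>2 / 2)"
  proof -
    have "cmod T \<le> (\<Prod>n\<in>S. exp (B\<^sup>2 / 2))"
      unfolding T_def prod_norm[symmetric]
    proof (intro prod_mono conjI)
      fix n assume n: "n \<in> S"
      have "1 + (X n)\<^sup>2 \<le> 1 + B\<^sup>2" using B(2)[OF n] by (simp add: abs_le_square_iff[symmetric])
      also have "\<dots> \<le> exp (B\<^sup>2)" by (rule exp_ge_add_one_self)
      also have "\<dots> = (exp (B\<^sup>2 / 2))\<^sup>2" by (simp flip: exp_double)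
      finally show "cmod (1 + \<i> * complex_of_real (X n)) \<le> exp (B\<^sup>2 / 2)"
        unfolding n1 by (simp add: real_le_lsqrt)
    qed auto
    also have "\<dots> = exp (card S * B\<^sup>2 / 2)" by (simp flip: exp_of_nat_mult)
    finally show ?thesis .
  qed
  have "iexp (\<Sum>n\<in>S. X n) - T * exp (- v / 2) = T * ((\<Prod>n\<in>S. u n) - (\<Prod>n\<in>S. w n) + ((\<Prod>n\<in>S. w n) - exp (- v / 2)))"
    unfolding iexp by (simp add: algebra_simps)
  also have "cmod \<dots> \<le> exp (card S * B\<^sup>2 / 2) * (card S * B ^ 3 + \<bar>(\<Sum>n\<in>S. (X n)\<^sup>2) - v\<bar> / 2)"
    unfolding norm_mult by (intro mult_mono T order.trans[OF norm_triangle_ineq] add_mono uw wv) auto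
  finally show ?thesis by (simp add: T_def)
qed

lemma Re_ee_expand: "1 + \<i> * complex_of_real (Re (b * ee t)) = (\<Sum>j\<in>{-1, 0, 1}. (if j = 0 then 1 else if j = 1 then \<i> * b / 2 else \<i> * cnj b / 2) * ee (of_int j * t))"
proof -
  have "complex_of_real (Re (b * ee t)) = (b * ee t + cnj b * ee (- t)) / 2"
    using complex_add_cnj[of "b * ee t"] by (simp add: cnj_ee)
  then show ?thesis by (simp add: field_simps)
qed

text \<open>Multiplied out, the product is a sum of characters whose frequencies are combinations of
  the r n with coefficients -1, 0, 1. By independence only the zero choice has frequency 0, and its
  coefficient is 1; all other characters average out.\<close>

lemma riesz_product_mean:
  fixes r :: "'i \<Rightarrow> 'a::euclidean_space" and b :: "'i \<Rightarrow> complex"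
  assumes S: "finite S" and indep: "\<And>\<kappa> :: 'i \<Rightarrow> int. (\<Sum>n\<in>S. of_int (\<kappa> n) *\<^sub>R r n) = 0 \<Longrightarrow> (\<forall>n\<in>S. \<kappa> n = 0)"
  shows "((\<lambda>R. \<integral>x. (\<Prod>n\<in>S. 1 + \<i> * complex_of_real (Re (b n * ee (r n \<bullet> x)))) \<partial>volR R) \<longlongrightarrow> 1) at_top"
proof -
  define d where "d n j = (if j = 0 then 1 else if j = (1::int) then \<i> * b n / 2 else \<i> * cnj (b n) / 2)" for n j
  define P where "P = PiE S (\<lambda>_. {-1, 0, 1 :: int})"
  define k where "k \<kappa> = (\<Sum>n\<in>S. of_int (\<kappa> n) *\<^sub>R r n)" for \<kappa>
  define z where "z = restrict (\<lambda>_. 0 :: int) S"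
  have finP: "finite P" unfolding P_def using S by (intro finite_PiE) auto
  have zP: "z \<in> P" by (auto simp: z_def P_def)
  have kz: "k \<kappa> = 0 \<longleftrightarrow> \<kappa> = z" if "\<kappa> \<in> P" for \<kappa>
  proof
    assume "k \<kappa> = 0"
    then have "\<forall>n\<in>S. \<kappa> n = 0" unfolding k_def by (rule indep)
    then show "\<kappa> = z" using that by (auto simp: P_def z_def PiE_def extensional_def restrict_def fun_eq_iff)
  qed (auto simp: k_def z_def)
  have expand: "(\<Prod>n\<in>S. 1 + \<i> * complex_of_real (Re (b n * ee (r n \<bullet> x)))) = (\<Sum>\<kappa>\<in>P. (\<Prod>n\<in>S. d n (\<kappa> n)) * ee (k \<kappa> \<bullet> x))" for x
  proof -
    have "(\<Prod>n\<in>S. 1 + \<i> * complex_of_real (Re (b n * ee (r n \<bullet> x)))) = (\<Prod>n\<in>S. \<Sum>j\<in>{-1, 0, 1}. d n j * ee (of_int j * (r n \<bullet> x)))"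
      unfolding Re_ee_expand d_def ..
    also have "\<dots> = (\<Sum>\<kappa>\<in>P. \<Prod>n\<in>S. d n (\<kappa> n) * ee (of_int (\<kappa> n) * (r n \<bullet> x)))"
      unfolding P_def by (intro prod_sum_PiE S) auto
    also have "\<dots> = (\<Sum>\<kappa>\<in>P. (\<Prod>n\<in>S. d n (\<kappa> n)) * ee (k \<kappa> \<bullet> x))"
      by (simp add: prod.distrib ee_sum[OF S, symmetric] k_def inner_sum_left)
    finally show ?thesis .
  qed
  have "((\<lambda>R. \<Sum>\<kappa>\<in>P. (\<Prod>n\<in>S. d n (\<kappa> n)) * (\<integral>x. ee (k \<kappa> \<bullet> x) \<partial>volR R)) \<longlongrightarrow>
       (\<Sum>\<kappa>\<in>P. (\<Prod>n\<in>S. d n (\<kappa> n)) * (if k \<kappa> = 0 then 1 else 0))) at_top"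
    by (intro tendsto_sum tendsto_mult_left ee_mean_tendsto)
  also have "(\<Sum>\<kappa>\<in>P. (\<Prod>n\<in>S. d n (\<kappa> n)) * (if k \<kappa> = 0 then 1 else 0)) = (\<Sum>\<kappa>\<in>P. if \<kappa> = z then 1 else 0)"
    using kz by (intro sum.cong refl) (auto simp: z_def d_def)
  also have "\<dots> = 1" using finP zP by simp
  finally show ?thesis
  proof (rule Lim_transform_eventually)
    show "\<forall>\<^sub>F R in at_top. (\<Sum>\<kappa>\<in>P. (\<Prod>n\<in>S. d n (\<kappa> n)) * (\<integral>x. ee (k \<kappa> \<bullet> x) \<partial>volR R)) =
      (\<integral>x. (\<Prod>n\<in>S. 1 + \<i> * complex_of_real (Re (b n * ee (r n \<bullet> x)))) \<partial>volR R)"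
      using eventually_gt_at_top[of 0]
    proof eventually_elim
      case (elim R)
      have "integrable (volR R) (\<lambda>x. ee (w \<bullet> x))" for w :: 'a
        by (rule integrable_volR[OF elim, where B=1]) auto
      then show ?case unfolding expand by (subst Bochner_Integration.integral_sum) auto
    qed
  qed
qed

lemma inj_on_int_indep:
  fixes r :: "'i \<Rightarrow> 'a::real_vector"
  assumes S: "finite S" and indep: "\<And>\<kappa> :: 'i \<Rightarrow> int. (\<Sum>n\<in>S. of_int (\<kappa> n) *\<^sub>R r n) = 0 \<Longrightarrow> (\<forall>n\<in>S. \<kappa> n = 0)"
  shows "inj_on r S"
proof (rule inj_onI, rule ccontr)
  fix n m assume nm: "n \<in> S" "m \<in> S" "r n = r m" "n \<noteq> m"
  let ?\<kappa> = "\<lambda>i. (if i = n then 1 else 0) - (if i = m then 1 else 0) :: int"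
  have "(\<Sum>i\<in>S. of_int (?\<kappa> i) *\<^sub>R r i) = (\<Sum>i\<in>S. (if i = n then r i else 0) - (if i = m then r i else 0))"
    by (intro sum.cong) auto
  also have "\<dots> = 0" using nm S by (simp add: sum_subtractf)
  finally have "\<forall>i\<in>S. ?\<kappa> i = 0" by (rule indep)
  from bspec[OF this nm(1)] nm(4) show False by simp
qed

text \<open>Averages \<open>iexp_sum_bound\<close> over the ball. The Riesz product costs \<eta>;
  the fluctuation of the sum of squares is itself a trigonometric polynomial with frequencies 2 r n,
  so its mean square is small by near-orthogonality. With B of order card S to the power -1/2, the
  explicit error is of that order too.\<close>

lemma iexp_lacunary_mean:
  fixes r :: "'i \<Rightarrow> 'a::euclidean_space" and b :: "'i \<Rightarrow> complex" and B \<eta> :: real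
  assumes S: "finite S" and indep: "\<And>\<kappa> :: 'i \<Rightarrow> int. (\<Sum>n\<in>S. of_int (\<kappa> n) *\<^sub>R r n) = 0 \<Longrightarrow> (\<forall>n\<in>S. \<kappa> n = 0)"
    and b: "\<And>n. n \<in> S \<Longrightarrow> cmod (b n) \<le> B" and B: "0 \<le> B" "B \<le> 1" and \<eta>: "\<eta> > 0"
  shows "\<forall>\<^sub>F R in at_top. cmod ((\<integral>x. iexp (\<Sum>n\<in>S. Re (b n * ee (r n \<bullet> x))) \<partial>volR R) - exp (- (\<Sum>n\<in>S. (cmod (b n))\<^sup>2 / 2) / 2))
     \<le> \<eta> + exp (card S * B\<^sup>2 / 2) * (card S * B ^ 3 + B\<^sup>2 * sqrt (card S))"
proof -
  define X where "X n x = Re (b n * ee (r n \<bullet> x))" for n x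
  define v where "v = (\<Sum>n\<in>S. (cmod (b n))\<^sup>2 / 2)"
  define T where "T x = (\<Prod>n\<in>S. 1 + \<i> * complex_of_real (X n x))" for x
  define Z where "Z x = (\<Sum>n\<in>S. (b n)\<^sup>2 * ee ((2 *\<^sub>R r n) \<bullet> x))" for x
  have Xb: "\<bar>X n x\<bar> \<le> B" if "n \<in> S" for n x
    using abs_Re_le_cmod[of "b n * ee (r n \<bullet> x)"] b[OF that] by (simp add: X_def norm_mult)
  have inj: "inj_on (\<lambda>n. 2 *\<^sub>R r n) S"
    using inj_on_int_indep[OF S indep] by (simp add: inj_on_def)
  have Xsq: "(\<Sum>n\<in>S. (X n x)\<^sup>2) - v = Re (Z x) / 2" for x
  proof -
    have "(Re w)\<^sup>2 = (cmod w)\<^sup>2 / 2 + Re (w\<^sup>2) / 2" for w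
      by (simp add: cmod_power2 field_simps) (simp add: power2_eq_square)
    moreover have "ee ((2 *\<^sub>R r n) \<bullet> x) = (ee (r n \<bullet> x))\<^sup>2" for n
      by (simp add: power2_eq_square flip: ee_add)
    ultimately have "(X n x)\<^sup>2 = (cmod (b n))\<^sup>2 / 2 + Re ((b n)\<^sup>2 * ee ((2 *\<^sub>R r n) \<bullet> x)) / 2" for n
      unfolding X_def by (simp only: norm_mult norm_ee mult_1_right power_mult_distrib)
    then show ?thesis by (simp add: v_def Z_def sum.distrib sum_divide_distrib)
  qed
  have "\<forall>\<^sub>F R in at_top. \<forall>c. \<forall>C :: real. (\<forall>n\<in>S. cmod (c n) \<le> C) \<longrightarrow>
     (\<integral>x. (cmod (\<Sum>n\<in>S. c n * ee ((2 *\<^sub>R r n) \<bullet> x)))\<^sup>2 \<partial>volR R) \<le> 2 * card S * C\<^sup>2"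
    by (rule trig_poly_mean_square[OF S inj])
  moreover have "\<forall>\<^sub>F R in at_top. dist (\<integral>x. T x \<partial>volR R) 1 < \<eta>"
    using riesz_product_mean[where r=r and b=b, OF S indep] \<eta> unfolding T_def X_def by (rule tendstoD)
  moreover have "\<forall>\<^sub>F R in at_top. R > (0::real)" by (rule eventually_gt_at_top)
  ultimately show ?thesis
  proof eventually_elim
    case (elim R)
    interpret prob_space "volR R :: 'a measure" by (rule prob_space_volR) fact
    have [measurable]: "X n \<in> borel_measurable borel" for n unfolding X_def by measurable
    have [measurable]: "T \<in> borel_measurable borel" unfolding T_def by measurable
    have [measurable]: "Z \<in> borel_measurable borel" unfolding Z_def by measurable
    have bn: "cmod (b n ^ 2) \<le> B\<^sup>2" if "n \<in> S" for n using b[OF that] by (auto simp: norm_power intro: power_mono)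
    have Zb: "cmod (Z x) \<le> card S * B\<^sup>2" for x
      unfolding Z_def by (intro order.trans[OF norm_sum] sum_bounded_above) (simp add: norm_mult bn)
    have Z2: "(\<integral>x. (cmod (Z x))\<^sup>2 \<partial>volR R) \<le> 2 * card S * (B\<^sup>2)\<^sup>2"
      using elim(1)[rule_format, of "\<lambda>n. (b n)\<^sup>2" "B\<^sup>2"] bn by (simp add: Z_def)
    have iZ: "integrable (volR R) (\<lambda>x. cmod (Z x))"
      by (rule integrable_volR[OF elim(3), where B="card S * B\<^sup>2"]) (use Zb in auto)
    have iZ2: "integrable (volR R) (\<lambda>x. (cmod (Z x))\<^sup>2)"
      by (rule integrable_volR[OF elim(3), where B="(card S * B\<^sup>2)\<^sup>2"]) (use Zb in \<open>auto intro!: power_mono\<close>)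
    have Z1: "(\<integral>x. cmod (Z x) \<partial>volR R) \<le> 2 * (B\<^sup>2 * sqrt (card S))"
    proof -
      \<comment> \<open>Nonnegative variance serves as the Cauchy-Schwarz inequality; the resulting
        factor sqrt 2 is rounded up to 2.\<close>
      have "(\<integral>x. cmod (Z x) \<partial>volR R)\<^sup>2 \<le> (\<integral>x. (cmod (Z x))\<^sup>2 \<partial>volR R)"
        using variance_positive[of "\<lambda>x. cmod (Z x)"] variance_eq[OF iZ iZ2] by simp
      also have "\<dots> \<le> 2 * card S * (B\<^sup>2)\<^sup>2" by (rule Z2)
      also have "\<dots> \<le> (2 * (B\<^sup>2 * sqrt (card S)))\<^sup>2" by (simp add: power_mult_distrib mult_right_mono)
      finally show ?thesis by (rule power2_le_imp_le) (use B in auto)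
    qed
    have Tb: "cmod (T x) \<le> 2 ^ card S" for x
    proof -
      have "cmod (1 + \<i> * complex_of_real (X n x)) \<le> 2" if "n \<in> S" for n
        using norm_triangle_ineq[of 1 "\<i> * complex_of_real (X n x)"] Xb[OF that, of x] B by (simp add: norm_mult)
      then have "cmod (T x) \<le> (\<Prod>n\<in>S. 2)" unfolding T_def prod_norm[symmetric] by (intro prod_mono) auto
      then show ?thesis by simp
    qed
    have iT: "integrable (volR R) T" by (rule integrable_volR[OF elim(3)]) (use Tb in auto)
    have iI: "integrable (volR R) (\<lambda>x. iexp (\<Sum>n\<in>S. X n x))"
      by (rule integrable_volR[OF elim(3), where B=1]) auto
    let ?E = "exp (card S * B\<^sup>2 / 2)"
    have v0: "v \<ge> 0" by (auto simp: v_def intro: sum_nonneg)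
    have "cmod (\<integral>x. iexp (\<Sum>n\<in>S. X n x) - T x * exp (- v / 2) \<partial>volR R)
      \<le> (\<integral>x. ?E * (card S * B ^ 3 + cmod (Z x) / 4) \<partial>volR R)"
    proof (rule Bochner_Integration.integral_norm_bound_integral)
      show "integrable (volR R) (\<lambda>x. ?E * (card S * B ^ 3 + cmod (Z x) / 4))" using iZ by auto
      show "integrable (volR R) (\<lambda>x. iexp (\<Sum>n\<in>S. X n x) - T x * exp (- v / 2))" using iI iT by auto
      fix x
      have "cmod (iexp (\<Sum>n\<in>S. X n x) - T x * exp (- v / 2)) \<le> ?E * (card S * B ^ 3 + \<bar>(\<Sum>n\<in>S. (X n x)\<^sup>2) - v\<bar> / 2)"
        unfolding T_def by (intro iexp_sum_bound S B Xb v0)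
      also have "\<dots> \<le> ?E * (card S * B ^ 3 + cmod (Z x) / 4)"
        using abs_Re_le_cmod[of "Z x"] by (intro mult_left_mono add_left_mono) (auto simp: Xsq)
      finally show "cmod (iexp (\<Sum>n\<in>S. X n x) - T x * exp (- v / 2)) \<le> ?E * (card S * B ^ 3 + cmod (Z x) / 4)" .
    qed
    also have "\<dots> = ?E * (card S * B ^ 3 + (\<integral>x. cmod (Z x) \<partial>volR R) / 4)"
      using iZ by (simp add: prob_space[simplified])
    also have "\<dots> \<le> ?E * (card S * B ^ 3 + B\<^sup>2 * sqrt (card S))"
    proof -
      have "0 \<le> B\<^sup>2 * sqrt (card S)" by simp
      then have "(\<integral>x. cmod (Z x) \<partial>volR R) / 4 \<le> B\<^sup>2 * sqrt (card S)" using Z1 by linarith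
      then show ?thesis by (intro mult_left_mono add_left_mono) auto
    qed
    also have "(\<integral>x. iexp (\<Sum>n\<in>S. X n x) - T x * exp (- v / 2) \<partial>volR R)
        = (\<integral>x. iexp (\<Sum>n\<in>S. X n x) \<partial>volR R) - (\<integral>x. T x \<partial>volR R) * exp (- v / 2)"
      using iI iT by simp
    finally have 1: "cmod ((\<integral>x. iexp (\<Sum>n\<in>S. X n x) \<partial>volR R) - (\<integral>x. T x \<partial>volR R) * exp (- v / 2))
      \<le> ?E * (card S * B ^ 3 + B\<^sup>2 * sqrt (card S))" .
    have "cmod ((\<integral>x. T x \<partial>volR R) * exp (- v / 2) - exp (- v / 2)) = cmod ((\<integral>x. T x \<partial>volR R) - 1) * exp (- v / 2)"
    proof -
      have "(\<integral>x. T x \<partial>volR R) * exp (- v / 2) - exp (- v / 2) = ((\<integral>x. T x \<partial>volR R) - 1) * complex_of_real (exp (- v / 2))"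
        by (simp add: left_diff_distrib)
      then show ?thesis by (simp only: norm_mult norm_of_real abs_exp_cancel)
    qed
    also have "\<dots> \<le> \<eta> * 1" using elim(2) v0 \<eta> by (intro mult_mono) (auto simp: dist_norm)
    finally have 2: "cmod ((\<integral>x. T x \<partial>volR R) * exp (- v / 2) - exp (- v / 2)) \<le> \<eta>" by simp
    show ?case
      using norm_diff_triangle_le[OF 1 2] by (simp add: X_def v_def add.commute)
  qed
qed

section \<open>Joint laws and characteristic functions\<close>

inductive trig_poly :: "'i set \<Rightarrow> (('i \<Rightarrow> real) \<Rightarrow> complex) \<Rightarrow> bool" for I where
  char: "trig_poly I (\<lambda>v. c * iexp (\<Sum>i\<in>I. \<xi> i * v i))"
| add: "trig_poly I f \<Longrightarrow> trig_poly I g \<Longrightarrow> trig_poly I (\<lambda>v. f v + g v)"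

lemma trig_poly_mult:
  assumes "trig_poly I f" "trig_poly I g"
  shows "trig_poly I (\<lambda>v. f v * g v)"
  using assms
proof induction
  case (char c \<xi>)
  from char.prems show ?case
  proof induction
    case (char d \<zeta>)
    have "(\<lambda>v. c * iexp (\<Sum>i\<in>I. \<xi> i * v i) * (d * iexp (\<Sum>i\<in>I. \<zeta> i * v i)))
      = (\<lambda>v. (c * d) * iexp (\<Sum>i\<in>I. (\<xi> i + \<zeta> i) * v i))"
      by (auto simp: fun_eq_iff distrib_right sum.distrib distrib_left exp_add)
    then show ?case by (simp only: trig_poly.char)
  qed (auto simp: distrib_left intro: trig_poly.add)
qed (auto simp: distrib_right intro: trig_poly.add)

lemma trig_poly_const: "trig_poly I (\<lambda>_. c)"
  using trig_poly.char[of I c "\<lambda>_. 0"] by simp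

lemma trig_poly_sin:
  assumes "finite I" "i \<in> I"
  shows "trig_poly I (\<lambda>v. complex_of_real (sin (w * v i)))"
proof -
  have *: "(\<Sum>j\<in>I. (if j = i then t else 0) * v j) = t * v i" for t :: real and v
    using assms by (simp add: if_distrib if_distribR cong: if_cong)
  have "complex_of_real (sin x) = (1 / (2 * \<i>)) * iexp x + (- 1 / (2 * \<i>)) * iexp (- x)" for x
    by (simp add: sin_of_real[symmetric] sin_exp_eq field_simps)
  then have "(\<lambda>v. complex_of_real (sin (w * v i))) = (\<lambda>v. (1 / (2 * \<i>)) * iexp (\<Sum>j\<in>I. (if j = i then w else 0) * v j)
      + (- 1 / (2 * \<i>)) * iexp (\<Sum>j\<in>I. (if j = i then - w else 0) * v j))"
    unfolding * by simp
  then show ?thesis by (simp only: trig_poly.intros)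
qed

definition joint_char :: "'i set \<Rightarrow> 'm measure \<Rightarrow> ('i \<Rightarrow> 'm \<Rightarrow> real) \<Rightarrow> ('i \<Rightarrow> real) \<Rightarrow> complex" where
  "joint_char I M V \<xi> = (\<integral>x. iexp (\<Sum>i\<in>I. \<xi> i * V i x) \<partial>M)"

text \<open>The explicit list exposes the frequencies and coefficients as data, from which finitely
  many test frequencies and a tolerance are extracted in \<open>joint_law_close\<close>.\<close>

definition trig_sum :: "'i set \<Rightarrow> (complex \<times> ('i \<Rightarrow> real)) list \<Rightarrow> ('i \<Rightarrow> real) \<Rightarrow> complex" where
  "trig_sum I T v = (\<Sum>(c, \<xi>)\<leftarrow>T. c * iexp (\<Sum>i\<in>I. \<xi> i * v i))"

lemma trig_poly_ex_sum: "trig_poly I f \<Longrightarrow> \<exists>T. f = trig_sum I T"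
proof (induction rule: trig_poly.induct)
  case (char c \<xi>)
  show ?case by (intro exI[of _ "[(c, \<xi>)]"]) (simp add: trig_sum_def fun_eq_iff)
next
  case (add f g)
  then obtain T T' where "f = trig_sum I T" "g = trig_sum I T'" by blast
  then show ?case by (intro exI[of _ "T @ T'"]) (simp add: trig_sum_def fun_eq_iff)
qed

lemma trig_sum_mean:
  assumes "prob_space M" "\<And>i. i \<in> I \<Longrightarrow> V i \<in> borel_measurable M"
  shows "has_bochner_integral M (\<lambda>x. trig_sum I T (\<lambda>i. V i x)) (\<Sum>(c, \<xi>)\<leftarrow>T. c * joint_char I M V \<xi>)"
proof (induction T)
  case (Cons p T)
  interpret prob_space M by fact
  obtain c \<xi> where p: "p = (c, \<xi>)" by force
  have [measurable]: "(\<lambda>x. \<Sum>i\<in>I. \<xi> i * V i x) \<in> borel_measurable M"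
    using assms(2) by (intro borel_measurable_sum borel_measurable_times) auto
  have "(\<lambda>x. iexp (\<Sum>i\<in>I. \<xi> i * V i x)) \<in> borel_measurable M" by measurable
  then have "integrable M (\<lambda>x. iexp (\<Sum>i\<in>I. \<xi> i * V i x))"
    by (rule integrable_const_bound[rotated, where B=1]) simp
  then have "has_bochner_integral M (\<lambda>x. c * iexp (\<Sum>i\<in>I. \<xi> i * V i x)) (c * joint_char I M V \<xi>)"
    unfolding joint_char_def by (intro has_bochner_integral_mult_right has_bochner_integral_integrable)
  from has_bochner_integral_add[OF this Cons] show ?case by (simp add: p trig_sum_def)
qed (simp add: trig_sum_def has_bochner_integral_zero)

lemma joint_char_sum_close:
  assumes "\<And>\<xi>. \<xi> \<in> snd ` set T \<Longrightarrow> cmod (joint_char I M V \<xi> - joint_char I M' V' \<xi>) \<le> \<eta>"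
  shows "cmod ((\<Sum>(c, \<xi>)\<leftarrow>T. c * joint_char I M V \<xi>) - (\<Sum>(c, \<xi>)\<leftarrow>T. c * joint_char I M' V' \<xi>)) \<le> (\<Sum>(c, \<xi>)\<leftarrow>T. cmod c) * \<eta>"
  using assms
proof (induction T)
  case (Cons p T)
  obtain c \<xi> where p: "p = (c, \<xi>)" by force
  let ?s = "\<lambda>M V. \<Sum>(c, \<xi>)\<leftarrow>T. c * joint_char I M V \<xi>"
  have "cmod (c * (joint_char I M V \<xi> - joint_char I M' V' \<xi>)) \<le> cmod c * \<eta>"
    unfolding norm_mult using Cons.prems by (intro mult_left_mono) (auto simp: p)
  moreover have "cmod (?s M V - ?s M' V') \<le> (\<Sum>(c, \<xi>)\<leftarrow>T. cmod c) * \<eta>" using Cons by simp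
  ultimately have "cmod (c * (joint_char I M V \<xi> - joint_char I M' V' \<xi>) + (?s M V - ?s M' V'))
      \<le> cmod c * \<eta> + (\<Sum>(c, \<xi>)\<leftarrow>T. cmod c) * \<eta>"
    by (rule norm_triangle_mono)
  then show ?case by (simp add: p algebra_simps)
qed simp

text \<open>Stands in for the cube with index set I: pinning the other coordinates to 0 makes it
  compact in the product topology of all functions and lets the coordinates in I separate its
  points.\<close>

definition cube :: "'i set \<Rightarrow> ('i \<Rightarrow> real) set" where
  "cube I = {s. \<forall>i. s i \<in> (if i \<in> I then {-1..1} else {0})}"

lemma compact_cube: "compact (cube (I :: 'i::countable set))"
proof -
  have "compactin (product_topology (\<lambda>_ :: 'i. euclideanreal) UNIV) (PiE UNIV (\<lambda>i. if i \<in> I then {-1..1} else {0}))"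
    unfolding compactin_PiE by auto
  moreover have "PiE UNIV (\<lambda>i. if i \<in> I then {-1..1} else {0 :: real}) = cube I"
    by (auto simp: cube_def PiE_def Pi_def)
  ultimately show ?thesis by (simp add: euclidean_product_topology)
qed

definition sin_coord :: "'i set \<Rightarrow> real \<Rightarrow> ('i \<Rightarrow> real) \<Rightarrow> 'i \<Rightarrow> real" where
  "sin_coord I w v = (\<lambda>i. if i \<in> I then sin (w * v i) else 0)"

lemma sin_coord_cube: "sin_coord I w v \<in> cube I"
  by (auto simp: sin_coord_def cube_def)

text \<open>Polynomials in the sines of the coordinates are trigonometric polynomials.
  Stone-Weierstrass on the compact cube therefore approximates uniformly over all v, with no tail to
  cut off.\<close>

lemma cube_trig_approx:
  fixes I :: "'i::countable set"
  assumes I: "finite I" and H: "continuous_on (cube I) H" and e: "e > 0"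
  shows "\<exists>g. trig_poly I (\<lambda>v. complex_of_real (g v)) \<and> (\<forall>v. \<bar>H (sin_coord I w v) - g v\<bar> < e)"
proof -
  define R where "R = {f :: ('i \<Rightarrow> real) \<Rightarrow> real. continuous_on (cube I) f \<and> trig_poly I (\<lambda>v. complex_of_real (f (sin_coord I w v)))}"
  interpret function_ring_on R "cube I"
  proof
    show "compact (cube I)" by (rule compact_cube)
    fix x y :: "'i \<Rightarrow> real" assume xy: "x \<in> cube I" "y \<in> cube I" "x \<noteq> y"
    then obtain i where i: "x i \<noteq> y i" by auto
    have "i \<in> I"
    proof (rule ccontr)
      assume "i \<notin> I"
      then have "x i = 0" "y i = 0" using xy unfolding cube_def by (auto split: if_splits dest!: spec[of _ i])
      then show False using i by simp
    qed
    then have "(\<lambda>s. s i) \<in> R"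
      using trig_poly_sin[OF I, of i w] by (auto simp: R_def sin_coord_def intro: continuous_on_subset[OF continuous_on_product_coordinates])
    then show "\<exists>f\<in>R. f x \<noteq> f y" using i by (intro bexI[of _ "\<lambda>s. s i"])
  qed (auto simp: R_def intro!: continuous_intros trig_poly_const trig_poly.add trig_poly_mult)
  obtain f where "f \<in> R" "\<forall>s\<in>cube I. \<bar>H s - f s\<bar> < e" using Stone_Weierstrass_basic[OF H e] by blast
  then show ?thesis
    by (intro exI[of _ "\<lambda>v. f (sin_coord I w v)"]) (auto simp: R_def sin_coord_cube)
qed

section \<open>Tail bounds and continuous covers by cubes\<close>

lemma (in prob_space) second_moment_tail:
  fixes C m :: real
  assumes I: "finite I" and V: "\<And>i. i \<in> I \<Longrightarrow> V i \<in> borel_measurable M"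
    and C: "\<And>i. i \<in> I \<Longrightarrow> (\<integral>\<^sup>+x. ennreal ((V i x)\<^sup>2) \<partial>M) \<le> ennreal C" and m: "m > 0" "C \<ge> 0"
  shows "prob {x \<in> space M. \<exists>i\<in>I. m < \<bar>V i x\<bar>} \<le> card I * C / m\<^sup>2"
proof -
  have "prob {x \<in> space M. m < \<bar>V i x\<bar>} \<le> C / m\<^sup>2" if i: "i \<in> I" for i
  proof -
    note [measurable] = V[OF i]
    have "emeasure M {x \<in> space M. m < \<bar>V i x\<bar>} \<le> emeasure M ({x \<in> space M. 1 \<le> ennreal (1 / m\<^sup>2) * ennreal ((V i x)\<^sup>2)})"
    proof (rule emeasure_mono)
      show "{x \<in> space M. m < \<bar>V i x\<bar>} \<subseteq> {x \<in> space M. 1 \<le> ennreal (1 / m\<^sup>2) * ennreal ((V i x)\<^sup>2)}"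
      proof clarify
        fix x assume "m < \<bar>V i x\<bar>"
        then have "m\<^sup>2 \<le> (V i x)\<^sup>2" using m by (simp add: abs_le_square_iff[symmetric])
        then show "1 \<le> ennreal (1 / m\<^sup>2) * ennreal ((V i x)\<^sup>2)"
          using m by (simp add: ennreal_mult'[symmetric] ennreal_1[symmetric] del: ennreal_1)
      qed
    qed measurable
    also have "\<dots> \<le> ennreal (1 / m\<^sup>2) * (\<integral>\<^sup>+x. ennreal ((V i x)\<^sup>2) * indicator (space M) x \<partial>M)"
      using nn_integral_Markov_inequality[of "\<lambda>x. ennreal ((V i x)\<^sup>2)" "space M" M "ennreal (1 / m\<^sup>2)"] by simp
    also have "\<dots> \<le> ennreal (1 / m\<^sup>2) * ennreal C"
      using C[OF i] by (intro mult_left_mono) (auto cong: nn_integral_cong simp: indicator_def)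
    also have "\<dots> = ennreal (C / m\<^sup>2)" using m by (simp add: ennreal_mult'[symmetric])
    finally show ?thesis using m by (simp add: emeasure_eq_measure)
  qed
  then have "(\<Sum>i\<in>I. prob {x \<in> space M. m < \<bar>V i x\<bar>}) \<le> (\<Sum>i\<in>I. C / m\<^sup>2)" by (rule sum_mono)
  moreover have "prob (\<Union>i\<in>I. {x \<in> space M. m < \<bar>V i x\<bar>}) \<le> (\<Sum>i\<in>I. prob {x \<in> space M. m < \<bar>V i x\<bar>})"
    using V by (intro finite_measure_subadditive_finite I) (auto intro!: predE)
  moreover have "(\<Union>i\<in>I. {x \<in> space M. m < \<bar>V i x\<bar>}) = {x \<in> space M. \<exists>i\<in>I. m < \<bar>V i x\<bar>}" by blast
  ultimately show ?thesis by simp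
qed

definition bump :: "real \<Rightarrow> real \<Rightarrow> real" where
  "bump \<rho> t = max 0 (min 1 (2 - \<bar>t\<bar> / \<rho>))"

lemma bump_bounds: "0 \<le> bump \<rho> t" "bump \<rho> t \<le> 1" by (auto simp: bump_def)

lemma bump_1: "\<rho> > 0 \<Longrightarrow> \<bar>t\<bar> \<le> \<rho> \<Longrightarrow> bump \<rho> t = 1"
  by (auto simp: bump_def divide_le_eq_1)

lemma bump_neq_0: "\<rho> > 0 \<Longrightarrow> bump \<rho> t \<noteq> 0 \<Longrightarrow> \<bar>t\<bar> < 2 * \<rho>"
proof (rule ccontr)
  assume "\<rho> > 0" "bump \<rho> t \<noteq> 0" "\<not> \<bar>t\<bar> < 2 * \<rho>"
  then have "2 \<le> \<bar>t\<bar> / \<rho>" by (simp add: pos_le_divide_eq)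
  then show False using \<open>bump \<rho> t \<noteq> 0\<close> by (simp add: bump_def)
qed

text \<open>Continuous substitute for the indicator of a union of cubes about the points of
  \<open>Q\<close>. Multiplying the complements keeps the values in [0, 1] however many cubes
  overlap.\<close>

definition cover_fun :: "'i set \<Rightarrow> real \<Rightarrow> ('i \<Rightarrow> real) set \<Rightarrow> ('i \<Rightarrow> real) \<Rightarrow> real" where
  "cover_fun I \<rho> Q s = 1 - (\<Prod>c\<in>Q. 1 - (\<Prod>i\<in>I. bump \<rho> (s i - c i)))"

lemma cover_fun_bounds: "0 \<le> cover_fun I \<rho> Q s" "cover_fun I \<rho> Q s \<le> 1"
proof -
  have 1: "0 \<le> (\<Prod>i\<in>I. bump \<rho> (s i - c i))" "(\<Prod>i\<in>I. bump \<rho> (s i - c i)) \<le> 1" for c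
    by (auto intro!: prod_nonneg prod_le_1 bump_bounds)
  then have "0 \<le> (\<Prod>c\<in>Q. 1 - (\<Prod>i\<in>I. bump \<rho> (s i - c i)))" "(\<Prod>c\<in>Q. 1 - (\<Prod>i\<in>I. bump \<rho> (s i - c i))) \<le> 1"
    by (auto intro!: prod_nonneg prod_le_1)
  then show "0 \<le> cover_fun I \<rho> Q s" "cover_fun I \<rho> Q s \<le> 1" by (auto simp: cover_fun_def)
qed

lemma cover_fun_1:
  assumes "finite Q" "\<rho> > 0" "c \<in> Q" "\<And>i. i \<in> I \<Longrightarrow> \<bar>s i - c i\<bar> \<le> \<rho>"
  shows "cover_fun I \<rho> Q s = 1"
proof -
  have "(\<Prod>i\<in>I. bump \<rho> (s i - c i)) = 1" using assms by (intro prod.neutral) (auto intro: bump_1)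
  then have "(\<Prod>c\<in>Q. 1 - (\<Prod>i\<in>I. bump \<rho> (s i - c i))) = 0" using assms by (intro prod_zero) auto
  then show ?thesis by (simp add: cover_fun_def)
qed

lemma cover_fun_neq_0:
  assumes "finite I" "\<rho> > 0" "cover_fun I \<rho> Q s \<noteq> 0"
  shows "\<exists>c\<in>Q. \<forall>i\<in>I. \<bar>s i - c i\<bar> < 2 * \<rho>"
proof (rule ccontr)
  assume *: "\<not> ?thesis"
  have "(\<Prod>i\<in>I. bump \<rho> (s i - c i)) = 0" if c: "c \<in> Q" for c
  proof -
    from * c obtain i where "i \<in> I" "\<not> \<bar>s i - c i\<bar> < 2 * \<rho>" by blast
    then show ?thesis using bump_neq_0[OF assms(2), of "s i - c i"] assms(1) by (auto intro!: prod_zero)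
  qed
  then show False using assms(3) by (simp add: cover_fun_def)
qed

lemma continuous_on_cover_fun: "\<rho> > 0 \<Longrightarrow> continuous_on A (cover_fun I \<rho> Q)"
proof -
  assume \<rho>: "\<rho> > 0"
  have s: "continuous_on A (\<lambda>s. s i - c)" for i c
    by (intro continuous_on_diff continuous_on_const continuous_on_subset[OF continuous_on_product_coordinates]) auto
  show ?thesis
    unfolding cover_fun_def bump_def
    by (intro continuous_on_diff continuous_on_prod continuous_on_max continuous_on_min continuous_on_divide
        continuous_on_rabs continuous_on_const s) (use \<rho> in auto)
qed

lemma cover_fun_measurable:
  assumes "\<And>i. i \<in> I \<Longrightarrow> V i \<in> borel_measurable M"
  shows "(\<lambda>x. cover_fun I \<rho> Q (sin_coord I w (\<lambda>i. V i x))) \<in> borel_measurable M"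
proof -
  have "(\<lambda>x. cover_fun I \<rho> Q (sin_coord I w (\<lambda>i. V i x)))
     = (\<lambda>x. 1 - (\<Prod>c\<in>Q. 1 - (\<Prod>i\<in>I. max 0 (min 1 (2 - \<bar>sin (w * V i x) - c i\<bar> / \<rho>)))))"
    by (auto simp: cover_fun_def bump_def sin_coord_def intro!: prod.cong)
  moreover have "(\<lambda>x. max 0 (min 1 (2 - \<bar>sin (w * V i x) - c\<bar> / \<rho>))) \<in> borel_measurable M" if "i \<in> I" for i c
    using assms[OF that] by measurable
  then have "(\<lambda>x. 1 - (\<Prod>c\<in>Q. 1 - (\<Prod>i\<in>I. max 0 (min 1 (2 - \<bar>sin (w * V i x) - c i\<bar> / \<rho>))))) \<in> borel_measurable M"
    by (intro borel_measurable_diff borel_measurable_prod borel_measurable_const)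
  ultimately show ?thesis by simp
qed

text \<open>The scaling maps [-m, m] onto [-pi/2, pi/2], where the sine has a uniformly continuous
  inverse. Outside that range the sine is not injective; those values are discarded by the tail
  bound.\<close>

lemma arcsin_modulus:
  fixes m \<delta> :: real
  assumes m: "m > 0" and \<delta>: "\<delta> > 0"
  obtains \<rho> where "\<rho> > 0"
    "\<And>v v'. \<bar>v\<bar> \<le> m \<Longrightarrow> \<bar>v'\<bar> \<le> m \<Longrightarrow> \<bar>sin (pi / (2 * m) * v) - sin (pi / (2 * m) * v')\<bar> < \<rho> \<Longrightarrow> \<bar>v - v'\<bar> < \<delta>"
proof -
  define w where "w = pi / (2 * m)"
  have w: "w > 0" using m by (simp add: w_def)
  have "uniformly_continuous_on {-1..1} arcsin"
    by (intro compact_uniformly_continuous continuous_on_arcsin') auto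
  then obtain \<rho> where \<rho>: "\<rho> > 0"
    "\<And>s t. s \<in> {-1..1} \<Longrightarrow> t \<in> {-1..1} \<Longrightarrow> dist s t < \<rho> \<Longrightarrow> dist (arcsin s) (arcsin t) < w * \<delta>"
    unfolding uniformly_continuous_on_def using w \<delta> by (metis mult_pos_pos)
  have arcsin: "arcsin (sin (w * v)) = w * v" if "\<bar>v\<bar> \<le> m" for v
  proof -
    have "\<bar>w * v\<bar> \<le> w * m" unfolding abs_mult using w that by (intro mult_mono) auto
    also have "w * m = pi / 2" using m by (simp add: w_def)
    finally show ?thesis by (intro arcsin_sin) (auto simp: abs_le_iff)
  qed
  show ?thesis
  proof (rule that[OF \<rho>(1)])
    fix v v' assume v: "\<bar>v\<bar> \<le> m" "\<bar>v'\<bar> \<le> m" "\<bar>sin (pi / (2 * m) * v) - sin (pi / (2 * m) * v')\<bar> < \<rho>"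
    then have "dist (arcsin (sin (w * v))) (arcsin (sin (w * v'))) < w * \<delta>"
      by (intro \<rho>(2)) (auto simp: dist_real_def w_def)
    then have "w * \<bar>v - v'\<bar> < w * \<delta>"
      using w by (simp add: arcsin v dist_real_def abs_mult right_diff_distrib[symmetric])
    then show "\<bar>v - v'\<bar> < \<delta>" using w by simp
  qed
qed

lemma finite_net_interval:
  fixes \<rho> :: real
  assumes "\<rho> > 0"
  obtains Z where "finite Z" "\<And>s. s \<in> {-1..1} \<Longrightarrow> \<exists>c\<in>Z. \<bar>s - c\<bar> \<le> \<rho>"
proof -
  have "\<forall>e>0. \<exists>Z. finite Z \<and> {-1..1::real} \<subseteq> (\<Union>c\<in>Z. ball c e)"
    using compact_Icc[of "-1::real" 1] by (auto simp only: compact_eq_totally_bounded)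
  from this[rule_format, OF assms] obtain Z where Z: "finite Z" "{-1..1::real} \<subseteq> (\<Union>c\<in>Z. ball c \<rho>)"
    by blast
  have "\<exists>c\<in>Z. \<bar>s - c\<bar> \<le> \<rho>" if s: "s \<in> {-1..1}" for s
  proof -
    from subsetD[OF Z(2) s] obtain c where "c \<in> Z" "s \<in> ball c \<rho>" by (rule UN_E)
    then show ?thesis by (intro bexI[of _ c]) (auto simp: dist_real_def)
  qed
  then show ?thesis by (rule that[OF Z(1)])
qed

section \<open>Comparing finite-dimensional laws through characteristic functions\<close>

definition second_moments_le :: "'i set \<Rightarrow> real \<Rightarrow> 'm measure \<Rightarrow> ('i \<Rightarrow> 'm \<Rightarrow> real) \<Rightarrow> bool" where
  "second_moments_le I C M V \<longleftrightarrow> prob_space M \<and>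
    (\<forall>i\<in>I. V i \<in> borel_measurable M \<and> (\<integral>\<^sup>+x. ennreal ((V i x)\<^sup>2) \<partial>M) \<le> ennreal C)"

text \<open>One half of the Levy-Prokhorov comparison of the laws of \<open>V\<close> and \<open>V'\<close>, phrased so that no
  measurability of images in \<open>\<real>\<^sup>I\<close> is needed.\<close>
definition law_le :: "'i set \<Rightarrow> real \<Rightarrow> real \<Rightarrow> 'm measure \<Rightarrow> ('i \<Rightarrow> 'm \<Rightarrow> real) \<Rightarrow> 'n measure \<Rightarrow> ('i \<Rightarrow> 'n \<Rightarrow> real) \<Rightarrow> bool" where
  "law_le I \<delta> \<epsilon> M V M' V' \<longleftrightarrow> (\<forall>X\<in>sets M. \<forall>Y\<in>sets M'.
    (\<forall>x\<in>X. \<forall>y\<in>space M'. (\<forall>i\<in>I. \<bar>V i x - V' i y\<bar> < \<delta>) \<longrightarrow> y \<in> Y) \<longrightarrow> measure M X \<le> measure M' Y + \<epsilon>)"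

text \<open>Since the functions \<open>cover_fun I \<rho> Q\<close> attached to subsets \<open>Q\<close> of a fixed grid form a finite
  family, finitely many values of the characteristic functions control the comparison of all
  pairs of events simultaneously.\<close>
lemma joint_law_close:
  fixes I :: "'i::countable set" and C \<epsilon> \<delta> :: real
  assumes I: "finite I" and \<epsilon>: "\<epsilon> > 0" and \<delta>: "\<delta> > 0" and C: "C \<ge> 0"
  obtains \<Xi> :: "('i \<Rightarrow> real) set" and \<eta> :: real where "finite \<Xi>" "\<eta> > 0"
    "\<And>(M :: 'm measure) V (M' :: 'n measure) V'. second_moments_le I C M V \<Longrightarrow> second_moments_le I C M' V' \<Longrightarrow>
      (\<And>\<xi>. \<xi> \<in> \<Xi> \<Longrightarrow> cmod (joint_char I M V \<xi> - joint_char I M' V' \<xi>) \<le> \<eta>) \<Longrightarrow> law_le I \<delta> \<epsilon> M V M' V'"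
proof -
  \<comment> \<open>Chosen so that Chebyshev and a union bound over I leave tails of probability at
    most \<epsilon>/4; the summand 1 keeps m positive.\<close>
  define m where "m = sqrt (4 * (card I * C + 1) / \<epsilon>)"
  have CI: "card I * C \<ge> 0" using C by simp
  have m: "m > 0" "card I * C / m\<^sup>2 \<le> \<epsilon> / 4"
  proof -
    show "m > 0" using CI \<epsilon> by (simp add: m_def)
    have "m\<^sup>2 = 4 * (card I * C + 1) / \<epsilon>" using CI \<epsilon> by (simp add: m_def)
    then have "card I * C \<le> \<epsilon> / 4 * m\<^sup>2" using \<epsilon> by simp
    then show "card I * C / m\<^sup>2 \<le> \<epsilon> / 4" using \<open>m > 0\<close> by (subst pos_divide_le_eq) auto
  qed
  define w where "w = pi / (2 * m)"
  obtain \<rho>' where \<rho>': "\<rho>' > 0"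
    "\<And>v v'. \<bar>v\<bar> \<le> m \<Longrightarrow> \<bar>v'\<bar> \<le> m \<Longrightarrow> \<bar>sin (w * v) - sin (w * v')\<bar> < \<rho>' \<Longrightarrow> \<bar>v - v'\<bar> < \<delta>"
    using arcsin_modulus[OF m(1) \<delta>] unfolding w_def by blast
  \<comment> \<open>A grid point lies within \<rho> of the sines of V and within 2 \<rho> of those
    of V'; together this stays below 3 \<rho>.\<close>
  define \<rho> where "\<rho> = \<rho>' / 3"
  have \<rho>: "\<rho> > 0" using \<rho>' by (simp add: \<rho>_def)
  obtain Z where Z: "finite Z" "\<And>s. s \<in> {-1..1} \<Longrightarrow> \<exists>c\<in>Z. \<bar>s - c\<bar> \<le> \<rho>"
    using finite_net_interval[OF \<rho>] by blast
  define G where "G = PiE I (\<lambda>_. Z)"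
  have finG: "finite G" unfolding G_def using I Z by (intro finite_PiE) auto
  have "\<exists>g. trig_poly I (\<lambda>v. complex_of_real (g v)) \<and> (\<forall>v. \<bar>cover_fun I \<rho> Q (sin_coord I w v) - g v\<bar> < \<epsilon> / 16)" for Q
    by (rule cube_trig_approx[OF I continuous_on_cover_fun[OF \<rho>]]) (use \<epsilon> in simp)
  then obtain g where g: "\<And>Q. trig_poly I (\<lambda>v. complex_of_real (g Q v))"
    "\<And>Q v. \<bar>cover_fun I \<rho> Q (sin_coord I w v) - g Q v\<bar> < \<epsilon> / 16" by metis
  obtain T where T: "\<And>Q v. complex_of_real (g Q v) = trig_sum I (T Q) v"
    using trig_poly_ex_sum[OF g(1)] by metis
  define C' where "C' Q = (\<Sum>(c, \<xi>)\<leftarrow>T Q. cmod c)" for Q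
  have C0: "C' Q \<ge> 0" for Q unfolding C'_def by (intro sum_list_nonneg) auto
  define \<Xi> where "\<Xi> = (\<Union>Q\<in>Pow G. snd ` set (T Q))"
  \<comment> \<open>Makes the change of characteristic functions cost at most \<epsilon>/8 for every
    \<open>Q\<close>. With two tails of \<epsilon>/4 and two approximation errors of \<epsilon>/16
    the total is 3 \<epsilon>/4.\<close>
  define \<eta> where "\<eta> = \<epsilon> / (8 * (1 + (\<Sum>Q\<in>Pow G. C' Q)))"
  have Cs: "0 \<le> (\<Sum>Q\<in>Pow G. C' Q)" by (intro sum_nonneg C0)
  have \<eta>: "\<eta> > 0" using \<epsilon> Cs by (simp add: \<eta>_def add_pos_nonneg)
  have C\<eta>: "C' Q * \<eta> \<le> \<epsilon> / 8" if "Q \<in> Pow G" for Q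
  proof -
    have "C' Q \<le> (\<Sum>Q\<in>Pow G. C' Q)" using C0 that finG by (intro member_le_sum) auto
    then have "C' Q * \<eta> \<le> (1 + (\<Sum>Q\<in>Pow G. C' Q)) * \<eta>" using \<eta> by (intro mult_right_mono) auto
    also have "\<dots> = \<epsilon> / 8"
    proof -
      have "1 + (\<Sum>Q\<in>Pow G. C' Q) \<noteq> 0" using Cs by linarith
      moreover have "T * (\<epsilon> / (8 * T)) = \<epsilon> / 8" if "T \<noteq> 0" for T using that by simp
      ultimately show ?thesis unfolding \<eta>_def by blast
    qed
    finally show ?thesis .
  qed
  show ?thesis
  proof (rule that)
    show "finite \<Xi>" unfolding \<Xi>_def using finG by auto
    show "\<eta> > 0" by fact
    fix M :: "'m measure" and V and M' :: "'n measure" and V'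
    assume VM: "second_moments_le I C M V" "second_moments_le I C M' V'"
      and jc: "\<And>\<xi>. \<xi> \<in> \<Xi> \<Longrightarrow> cmod (joint_char I M V \<xi> - joint_char I M' V' \<xi>) \<le> \<eta>"
    have M: "prob_space M" "prob_space M'"
      and V: "\<And>i. i \<in> I \<Longrightarrow> V i \<in> borel_measurable M" and V': "\<And>i. i \<in> I \<Longrightarrow> V' i \<in> borel_measurable M'"
      and V2: "\<And>i. i \<in> I \<Longrightarrow> (\<integral>\<^sup>+x. ennreal ((V i x)\<^sup>2) \<partial>M) \<le> ennreal C"
      and V2': "\<And>i. i \<in> I \<Longrightarrow> (\<integral>\<^sup>+x. ennreal ((V' i x)\<^sup>2) \<partial>M') \<le> ennreal C"
      using VM by (auto simp: second_moments_le_def)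
    interpret M: prob_space M by fact
    interpret M': prob_space M' by fact
    show "law_le I \<delta> \<epsilon> M V M' V'"
      unfolding law_le_def
    proof (intro ballI impI)
      fix X Y assume X: "X \<in> sets M" and Y: "Y \<in> sets M'"
        and XY': "\<forall>x\<in>X. \<forall>y\<in>space M'. (\<forall>i\<in>I. \<bar>V i x - V' i y\<bar> < \<delta>) \<longrightarrow> y \<in> Y"
      have XY: "y \<in> Y" if "x \<in> X" "y \<in> space M'" "\<And>i. i \<in> I \<Longrightarrow> \<bar>V i x - V' i y\<bar> < \<delta>" for x y
        using XY' that by blast
      define out where "out = {x \<in> space M. \<exists>i\<in>I. m < \<bar>V i x\<bar>}"
      define out' where "out' = {y \<in> space M'. \<exists>i\<in>I. m < \<bar>V' i y\<bar>}"
      have mout[measurable]: "out \<in> sets M" "out' \<in> sets M'"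
      proof -
        have "out = (\<Union>i\<in>I. {x \<in> space M. m < \<bar>V i x\<bar>})" "out' = (\<Union>i\<in>I. {x \<in> space M'. m < \<bar>V' i x\<bar>})"
          by (auto simp: out_def out'_def)
        moreover have "{x \<in> space M. m < \<bar>V i x\<bar>} \<in> sets M" "{x \<in> space M'. m < \<bar>V' i x\<bar>} \<in> sets M'" if "i \<in> I" for i
          using V[OF that] V'[OF that] by measurable
        ultimately show "out \<in> sets M" "out' \<in> sets M'" using I by auto
      qed
      have pout: "M.prob out \<le> \<epsilon> / 4" "M'.prob out' \<le> \<epsilon> / 4"
        using M.second_moment_tail[where V=V, OF I V V2 m(1) C] M'.second_moment_tail[where V=V', OF I V' V2' m(1) C] m(2)
        unfolding out_def out'_def by linarith+
      \<comment> \<open>The image of X is recorded only through the grid points it comes close to.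
        Each of them remembers a witness in X, and this witness is compared below with any y on
        which \<open>h'\<close> is nonzero.\<close>
      define Q where "Q = {c \<in> G. \<exists>x\<in>X. (\<forall>i\<in>I. \<bar>V i x\<bar> \<le> m \<and> \<bar>sin (w * V i x) - c i\<bar> \<le> \<rho>)}"
      have QG: "Q \<in> Pow G" by (auto simp: Q_def)
      then have finQ: "finite Q" using finG by (auto intro: finite_subset)
      define h where "h x = cover_fun I \<rho> Q (sin_coord I w (\<lambda>i. V i x))" for x
      define h' where "h' x = cover_fun I \<rho> Q (sin_coord I w (\<lambda>i. V' i x))" for x
      have [measurable]: "h \<in> borel_measurable M" "h' \<in> borel_measurable M'"
        unfolding h_def h'_def using V V' by (auto intro: cover_fun_measurable)
      have ih: "integrable M h" by (rule M.integrable_const_bound[where B=1]) (auto simp: h_def cover_fun_bounds abs_le_iff order.trans[OF _ cover_fun_bounds(1)])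
      have ih': "integrable M' h'" by (rule M'.integrable_const_bound[where B=1]) (auto simp: h'_def cover_fun_bounds abs_le_iff order.trans[OF _ cover_fun_bounds(1)])
      let ?jc = "\<lambda>c \<xi>. c * joint_char I M V \<xi>" and ?jc' = "\<lambda>c \<xi>. c * joint_char I M' V' \<xi>"
      have bi: "has_bochner_integral M (\<lambda>x. complex_of_real (g Q (\<lambda>i. V i x))) (\<Sum>(c, \<xi>)\<leftarrow>T Q. ?jc c \<xi>)"
        "has_bochner_integral M' (\<lambda>x. complex_of_real (g Q (\<lambda>i. V' i x))) (\<Sum>(c, \<xi>)\<leftarrow>T Q. ?jc' c \<xi>)"
        unfolding T by (intro trig_sum_mean M V V'; assumption)+
      have gi: "integrable M (\<lambda>x. g Q (\<lambda>i. V i x))" "integrable M' (\<lambda>x. g Q (\<lambda>i. V' i x))"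
        using bi[THEN integrable.intros, THEN integrable_Re] by simp_all
      have ind: "integrable M (indicator A :: 'm \<Rightarrow> real)" if "A \<in> sets M" for A
        using that by (intro integrable_real_indicator) (auto simp: M.emeasure_eq_measure)
      have ind': "integrable M' (indicator A :: 'n \<Rightarrow> real)" if "A \<in> sets M'" for A
        using that by (intro integrable_real_indicator) (auto simp: M'.emeasure_eq_measure)
      have "M.prob X = (\<integral>x. indicator X x \<partial>M)" using X by simp
      also have "\<dots> \<le> (\<integral>x. h x + indicator out x \<partial>M)"
      proof (rule integral_mono)
        fix x assume x: "x \<in> space M"
        show "indicator X x \<le> h x + indicator out x"
        proof (cases "x \<in> X \<and> x \<notin> out")
          case True
          then have Vm: "\<bar>V i x\<bar> \<le> m" if "i \<in> I" for i using that x by (force simp: out_def)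
          have "\<forall>i. \<exists>c\<in>Z. \<bar>sin (w * V i x) - c\<bar> \<le> \<rho>" using Z(2) by simp
          then obtain c where c: "\<And>i. c i \<in> Z" "\<And>i. \<bar>sin (w * V i x) - c i\<bar> \<le> \<rho>" by metis
          have "restrict c I \<in> Q" using c Vm True by (auto simp: Q_def G_def intro!: bexI[of _ x])
          then have "h x = 1" unfolding h_def
            by (rule cover_fun_1[OF finQ \<rho>]) (auto simp: sin_coord_def c)
          then show ?thesis by (simp add: indicator_def)
        qed (use cover_fun_bounds(1)[of I \<rho> Q] in \<open>auto simp: indicator_def h_def\<close>)
      qed (intro Bochner_Integration.integrable_add ind ih X mout)+
      also have "\<dots> = (\<integral>x. h x \<partial>M) + M.prob out"
        by (subst Bochner_Integration.integral_add[OF ih ind]) auto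
      finally have 1: "M.prob X \<le> (\<integral>x. h x \<partial>M) + \<epsilon> / 4" using pout by simp
      have "(\<integral>x. h' x \<partial>M') \<le> (\<integral>x. indicator Y x + indicator out' x \<partial>M')"
      proof (rule integral_mono)
        fix y assume y: "y \<in> space M'"
        show "h' y \<le> indicator Y y + indicator out' y"
        proof (cases "y \<in> out' \<or> h' y = 0")
          case False
          then obtain c where c: "c \<in> Q" "\<And>i. i \<in> I \<Longrightarrow> \<bar>sin (w * V' i y) - c i\<bar> < 2 * \<rho>"
            using cover_fun_neq_0[OF I \<rho>, of Q "sin_coord I w (\<lambda>i. V' i y)"] by (auto simp: h'_def sin_coord_def)
          then obtain x where x: "x \<in> X" "\<And>i. i \<in> I \<Longrightarrow> \<bar>V i x\<bar> \<le> m" "\<And>i. i \<in> I \<Longrightarrow> \<bar>sin (w * V i x) - c i\<bar> \<le> \<rho>"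
            by (auto simp: Q_def)
          have "y \<in> Y"
          proof (rule XY[OF x(1) y])
            fix i assume i: "i \<in> I"
            have "\<bar>sin (w * V i x) - sin (w * V' i y)\<bar> < \<rho>'"
              using x(3)[OF i] c(2)[OF i] unfolding \<rho>_def by linarith
            moreover have "\<bar>V' i y\<bar> \<le> m" using False y i by (force simp: out'_def)
            ultimately show "\<bar>V i x - V' i y\<bar> < \<delta>" using x(2)[OF i] by (intro \<rho>'(2))
          qed
          then show ?thesis using cover_fun_bounds(2)[of I \<rho> Q "sin_coord I w (\<lambda>i. V' i y)"] by (auto simp: h'_def indicator_def)
        next
          case True
          then show ?thesis using cover_fun_bounds(2)[of I \<rho> Q "sin_coord I w (\<lambda>i. V' i y)"] by (auto simp: h'_def indicator_def)
        qed
      qed (intro Bochner_Integration.integrable_add ind' ih' Y mout)+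
      also have "\<dots> = M'.prob Y + M'.prob out'"
        using Y by (subst Bochner_Integration.integral_add[OF ind' ind']) auto
      finally have 2: "(\<integral>x. h' x \<partial>M') \<le> M'.prob Y + \<epsilon> / 4" using pout by simp
      have hg: "(\<integral>x. h x \<partial>M) \<le> (\<integral>x. g Q (\<lambda>i. V i x) + \<epsilon> / 16 \<partial>M)"
      proof (intro integral_mono ih)
        show "h x \<le> g Q (\<lambda>i. V i x) + \<epsilon> / 16" for x
          using g(2)[of Q "\<lambda>i. V i x"] unfolding h_def by linarith
      qed (use gi in auto)
      have hg': "(\<integral>x. g Q (\<lambda>i. V' i x) - \<epsilon> / 16 \<partial>M') \<le> (\<integral>x. h' x \<partial>M')"
      proof (intro integral_mono ih')
        show "g Q (\<lambda>i. V' i x) - \<epsilon> / 16 \<le> h' x" for x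
          using g(2)[of Q "\<lambda>i. V' i x"] unfolding h'_def by linarith
      qed (use gi in auto)
      have "cmod ((\<Sum>(c, \<xi>)\<leftarrow>T Q. ?jc c \<xi>) - (\<Sum>(c, \<xi>)\<leftarrow>T Q. ?jc' c \<xi>)) \<le> C' Q * \<eta>"
        unfolding C'_def using QG by (intro joint_char_sum_close jc) (auto simp: \<Xi>_def)
      then have "cmod ((\<integral>x. complex_of_real (g Q (\<lambda>i. V i x)) \<partial>M) - (\<integral>x. complex_of_real (g Q (\<lambda>i. V' i x)) \<partial>M')) \<le> C' Q * \<eta>"
        unfolding bi[THEN has_bochner_integral_integral_eq] .
      then have "\<bar>(\<integral>x. g Q (\<lambda>i. V i x) \<partial>M) - (\<integral>x. g Q (\<lambda>i. V' i x) \<partial>M')\<bar> \<le> C' Q * \<eta>"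
        by (simp flip: of_real_diff)
      with C\<eta>[OF QG] have 3: "(\<integral>x. g Q (\<lambda>i. V i x) \<partial>M) \<le> (\<integral>x. g Q (\<lambda>i. V' i x) \<partial>M') + \<epsilon> / 8" by linarith
      have "(\<integral>x. h x \<partial>M) \<le> (\<integral>x. g Q (\<lambda>i. V i x) \<partial>M) + \<epsilon> / 16"
        using hg gi by (simp add: M.prob_space)
      moreover have "(\<integral>x. g Q (\<lambda>i. V' i x) \<partial>M') - \<epsilon> / 16 \<le> (\<integral>x. h' x \<partial>M')"
        using hg' gi by (simp add: M'.prob_space)
      ultimately show "M.prob X \<le> M'.prob Y + \<epsilon>" using 1 2 3 \<epsilon> by linarith
    qed
  qed
qed

section \<open>Point evaluations and finite differences\<close>

text \<open>A functional given by coefficients and evaluation points. It is polymorphic in the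
  values so that one list acts on real fields and, as \<open>symbol\<close>, on complex
  characters.\<close>

definition lin_comb :: "(real \<times> 'a) list \<Rightarrow> ('a \<Rightarrow> 'b::real_vector) \<Rightarrow> 'b" where
  "lin_comb L g = (\<Sum>(c, y)\<leftarrow>L. c *\<^sub>R g y)"

abbreviation symbol :: "(real \<times> 'a::euclidean_space) list \<Rightarrow> 'a \<Rightarrow> complex" where
  "symbol L x \<equiv> lin_comb L (\<lambda>y. ee (x \<bullet> y))"

lemma lin_comb_simps[simp]:
  "lin_comb [] g = 0" "lin_comb ((c, y) # L) g = c *\<^sub>R g y + lin_comb L g"
  "lin_comb (L @ L') g = lin_comb L g + lin_comb L' g"
  by (simp_all add: lin_comb_def)

lemma lin_comb_map_scale: "lin_comb (map (\<lambda>(c, y). (a * c, y)) L) g = a *\<^sub>R lin_comb L g"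
  by (induction L) (auto simp: scaleR_add_right)

lemma lin_comb_map_shift: "lin_comb (map (\<lambda>(c, y). (c, y + v)) L) g = lin_comb L (\<lambda>y. g (y + v))"
  by (induction L) auto

lemma lin_comb_mult_right: "lin_comb L (\<lambda>y. g y * (a :: complex)) = lin_comb L g * a"
  by (induction L) (auto simp: distrib_right)

text \<open>A single list has to serve real and complex functions at once. The bound variable g has
  one fixed type, hence the two clauses.\<close>

lemma lin_comb_sum:
  fixes L :: "'i \<Rightarrow> (real \<times> 'a) list"
  assumes "finite A"
  shows "\<exists>L'. (\<forall>g :: 'a \<Rightarrow> real. lin_comb L' g = (\<Sum>i\<in>A. c i *\<^sub>R lin_comb (L i) g)) \<and>
    (\<forall>g :: 'a \<Rightarrow> complex. lin_comb L' g = (\<Sum>i\<in>A. c i *\<^sub>R lin_comb (L i) g)) \<and>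
    snd ` set L' \<subseteq> (\<Union>i\<in>A. snd ` set (L i))"
  using assms
proof induction
  case empty
  show ?case by (intro exI[of _ "[]"]) auto
next
  case (insert i A)
  then obtain L' where L': "\<forall>g :: 'a \<Rightarrow> real. lin_comb L' g = (\<Sum>i\<in>A. c i *\<^sub>R lin_comb (L i) g)"
    "\<forall>g :: 'a \<Rightarrow> complex. lin_comb L' g = (\<Sum>i\<in>A. c i *\<^sub>R lin_comb (L i) g)"
    "snd ` set L' \<subseteq> (\<Union>i\<in>A. snd ` set (L i))" by blast
  let ?L = "map (\<lambda>(d, y). (c i * d, y)) (L i)"
  have "snd ` set ?L = snd ` set (L i)" by (simp add: image_image case_prod_beta)
  then have "snd ` set (?L @ L') = snd ` set (L i) \<union> snd ` set L'" by (simp only: set_append image_Un)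
  also have "\<dots> \<subseteq> (\<Union>i\<in>insert i A. snd ` set (L i))"
    unfolding UN_insert by (rule Un_mono[OF order_refl L'(3)])
  finally show ?case
    by (intro exI[of _ "?L @ L'"] conjI allI)
       (simp_all only: lin_comb_simps(3) lin_comb_map_scale sum.insert[OF insert.hyps] L'(1)[rule_format] L'(2)[rule_format])
qed

text \<open>Control of the second moment of a linear combination of point evaluations by its symbol;
  shared by the limit field and, for large radii, by the laws of the trigonometric sums.\<close>
definition spectral_bound :: "nat \<Rightarrow> real \<Rightarrow> ('a::euclidean_space \<Rightarrow> real) measure \<Rightarrow> bool" where
  "spectral_bound s W M \<longleftrightarrow> prob_space M \<and> sets M = sets (cs_borel s W) \<and> (\<forall>L c. snd ` set L \<subseteq> cball 0 W \<longrightarrow>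
     (\<forall>x. norm x = 1 \<longrightarrow> cmod (symbol L x) \<le> c) \<longrightarrow>
     (\<integral>\<^sup>+F. ennreal ((lin_comb L F)\<^sup>2) \<partial>M) \<le> ennreal (4 * c\<^sup>2))"

lemma lin_comb_measurable:
  fixes L :: "(real \<times> 'a::euclidean_space) list"
  assumes "W > 0" "snd ` set L \<subseteq> cball 0 W" "sets M = sets (cs_borel s W)"
  shows "(\<lambda>F. lin_comb L F) \<in> borel_measurable M"
proof -
  have "(\<lambda>F. lin_comb L F) \<in> borel_measurable (cs_borel s W)"
    using assms(2)
  proof (induction L)
    case (Cons p L)
    obtain c y where p: "p = (c, y)" by force
    have [measurable]: "(\<lambda>F. F y) \<in> borel_measurable (cs_borel s W)" "(\<lambda>F. lin_comb L F) \<in> borel_measurable (cs_borel s W)"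
      using Cons assms(1) by (auto simp: p intro!: eval_measurable)
    show ?case unfolding p lin_comb_simps by measurable
  next
    case Nil
    show ?case unfolding lin_comb_simps by simp
  qed
  then show ?thesis using measurable_cong_sets[OF assms(3) refl] by blast
qed

text \<open>The inequality |t| \<le> t^2 / (4 c) + c replaces Cauchy-Schwarz, and the choice of
  weights balances the two terms at c each. Working with nonnegative integrals avoids separate
  integrability proofs.\<close>

lemma spectral_bound_abs:
  fixes M :: "('a::euclidean_space \<Rightarrow> real) measure"
  assumes M: "spectral_bound s W M" and W: "W > 0" and L: "snd ` set L \<subseteq> cball 0 W" and "c > 0"
    and sym: "\<And>x. norm x = 1 \<Longrightarrow> cmod (symbol L x) \<le> c"
  shows "(\<integral>\<^sup>+F. ennreal \<bar>lin_comb L F\<bar> \<partial>M) \<le> ennreal (2 * c)"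
proof -
  interpret prob_space M using M by (simp add: spectral_bound_def)
  have [measurable]: "(\<lambda>F. lin_comb L F) \<in> borel_measurable M"
    using lin_comb_measurable[OF W L] M by (simp add: spectral_bound_def)
  have "\<bar>t\<bar> \<le> 1 / (4 * c) * t\<^sup>2 + c" for t :: real
  proof -
    have "0 \<le> (\<bar>t\<bar> - 2 * c)\<^sup>2" by simp
    then have "4 * c * \<bar>t\<bar> \<le> t\<^sup>2 + 4 * c\<^sup>2" by (simp add: power2_diff power_mult_distrib mult_ac)
    then show ?thesis using \<open>c > 0\<close> by (simp add: field_simps power2_eq_square)
  qed
  then have "(\<integral>\<^sup>+F. ennreal \<bar>lin_comb L F\<bar> \<partial>M) \<le> (\<integral>\<^sup>+F. ennreal (1 / (4 * c)) * ennreal ((lin_comb L F)\<^sup>2) + ennreal c \<partial>M)"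
    using \<open>c > 0\<close> by (intro nn_integral_mono) (simp add: ennreal_mult'[symmetric] ennreal_plus[symmetric] del: ennreal_plus)
  also have "\<dots> = ennreal (1 / (4 * c)) * (\<integral>\<^sup>+F. ennreal ((lin_comb L F)\<^sup>2) \<partial>M) + ennreal c"
    by (simp add: nn_integral_add nn_integral_cmult emeasure_space_1)
  also have "\<dots> \<le> ennreal (1 / (4 * c)) * ennreal (4 * c\<^sup>2) + ennreal c"
    using assms by (intro add_mono mult_left_mono) (auto simp: spectral_bound_def)
  also have "\<dots> = ennreal (2 * c)"
    using \<open>c > 0\<close> by (simp add: ennreal_mult'[symmetric] ennreal_plus[symmetric] power2_eq_square del: ennreal_plus)
  finally show ?thesis .
qed

section \<open>Iterated forward difference quotients at the origin and their symbols\<close>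

fun fdiff :: "real \<Rightarrow> 'a::real_vector list \<Rightarrow> (real \<times> 'a) list" where
  "fdiff h [] = [(1, 0)]"
| "fdiff h (b # bs) = map (\<lambda>(c, y). ((1 / h) * c, y)) (map (\<lambda>(c, y). (c, y + h *\<^sub>R b)) (fdiff h bs))
     @ map (\<lambda>(c, y). ((- 1 / h) * c, y)) (fdiff h bs)"

lemma fdiff_points:
  fixes bs :: "'a::euclidean_space list"
  assumes "set bs \<subseteq> Basis" "h \<ge> 0" "p \<in> set (fdiff h bs)"
  shows "norm (snd p) \<le> h * length bs"
  using assms(1,3)
proof (induction bs arbitrary: p)
  case (Cons b bs)
  then obtain c y where y: "(c, y) \<in> set (fdiff h bs)" "snd p = y \<or> snd p = y + h *\<^sub>R b" by auto
  have "norm y \<le> h * length bs" using Cons y(1) by force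
  moreover have "norm (y + h *\<^sub>R b) \<le> norm y + h" using Cons assms(2) norm_triangle_ineq[of y "h *\<^sub>R b"] by auto
  ultimately show ?case using y(2) assms(2) by (auto simp: distrib_left)
qed simp

text \<open>Symbol of one forward difference quotient with step h; it tends to 2 pi i t, the symbol
  of the derivative.\<close>

definition dsym :: "real \<Rightarrow> real \<Rightarrow> complex" where
  "dsym h t = (ee (h * t) - 1) / h"

lemma fdiff_symbol: "symbol (fdiff h bs) x = (\<Prod>b\<leftarrow>bs. dsym h (x \<bullet> b))"
proof (induction bs)
  case (Cons b bs)
  have "symbol (fdiff h (b # bs)) x =
    (1 / h) *\<^sub>R (symbol (fdiff h bs) x * ee (h * (x \<bullet> b))) + (- 1 / h) *\<^sub>R symbol (fdiff h bs) x"
    by (simp only: fdiff.simps lin_comb_simps lin_comb_map_scale lin_comb_map_shift inner_add_right inner_scaleR_right ee_add lin_comb_mult_right)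
  also have "\<dots> = dsym h (x \<bullet> b) * symbol (fdiff h bs) x"
    by (simp add: dsym_def scaleR_conv_of_real diff_divide_distrib left_diff_distrib)
  finally show ?case by (simp add: Cons.IH)
qed simp

lemma ee_iexp: "ee t = iexp (2 * pi * t)"
  by (simp add: ee_def cis_conv_exp)

lemma dsym_bound: "h > 0 \<Longrightarrow> \<bar>t\<bar> \<le> 1 \<Longrightarrow> cmod (dsym h t) \<le> 2 * pi"
proof -
  assume h: "h > 0" and t: "\<bar>t\<bar> \<le> 1"
  have "cmod (ee (h * t) - 1) \<le> \<bar>2 * pi * (h * t)\<bar>"
    using iexp_approx1[of "2 * pi * (h * t)" 0] by (simp add: ee_iexp)
  also have "\<dots> \<le> 2 * pi * h" using h t by (simp add: abs_mult)
  finally show ?thesis using h by (simp add: dsym_def norm_divide pos_divide_le_eq)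
qed

lemma dsym_approx: "h > 0 \<Longrightarrow> \<bar>t\<bar> \<le> 1 \<Longrightarrow> cmod (dsym h t - 2 * pi * \<i> * t) \<le> (2 * pi)\<^sup>2 * h / 2"
proof -
  assume h: "h > 0" and t: "\<bar>t\<bar> \<le> 1"
  have "dsym h t - 2 * pi * \<i> * t = (ee (h * t) - (1 + \<i> * (2 * pi * (h * t)))) / h"
    using h by (simp add: dsym_def field_simps)
  then have "cmod (dsym h t - 2 * pi * \<i> * t) = cmod (ee (h * t) - (1 + \<i> * (2 * pi * (h * t)))) / h"
    using h by (simp add: norm_divide)
  also have "cmod (ee (h * t) - (1 + \<i> * (2 * pi * (h * t)))) \<le> (2 * pi * (h * t))\<^sup>2 / 2"
    using iexp_approx1[of "2 * pi * (h * t)" 1] by (simp add: ee_iexp numeral_2_eq_2)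
  also have "(2 * pi * (h * t))\<^sup>2 / 2 \<le> (2 * pi)\<^sup>2 * h\<^sup>2 * 1 / 2"
    using t by (auto simp: power_mult_distrib abs_square_le_1 intro!: mult_left_le)
  also have "(2 * pi)\<^sup>2 * h\<^sup>2 * 1 / 2 / h = (2 * pi)\<^sup>2 * h / 2" using h by (simp add: power2_eq_square)
  finally show ?thesis using h by (simp add: divide_right_mono)
qed

lemma prod_dsym_bound:
  fixes x :: "'a::euclidean_space"
  assumes "h > 0" "set bs \<subseteq> Basis" "norm x = 1"
  shows "cmod (\<Prod>b\<leftarrow>bs. dsym h (x \<bullet> b)) \<le> (2 * pi) ^ length bs"
  using assms(2)
proof (induction bs)
  case (Cons b bs)
  have "cmod (dsym h (x \<bullet> b)) \<le> 2 * pi" using Cons assms Basis_le_norm[of b x] by (intro dsym_bound) auto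
  then show ?case using Cons by (auto simp: norm_mult intro!: mult_mono)
qed simp

text \<open>For either step a factor is close to the exact value 2 pi i t, and the factors are
  exchanged one at a time. The lemma measures the effect of refining the step in a Taylor
  coefficient.\<close>

lemma prod_dsym_diff:
  fixes x :: "'a::euclidean_space"
  assumes h: "h > 0" "h' > 0" and bs: "set bs \<subseteq> Basis" and x: "norm x = 1"
  shows "cmod ((\<Prod>b\<leftarrow>bs. dsym h (x \<bullet> b)) - (\<Prod>b\<leftarrow>bs. dsym h' (x \<bullet> b))) \<le> length bs * (2 * pi) ^ Suc (length bs) * (h + h')"
  using bs
proof (induction bs)
  case (Cons b bs)
  let ?P = "\<lambda>h. \<Prod>b\<leftarrow>bs. dsym h (x \<bullet> b)" and ?A = "2 * pi"
  have b: "\<bar>x \<bullet> b\<bar> \<le> 1" using Cons x Basis_le_norm[of b x] by auto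
  have d: "cmod (dsym h (x \<bullet> b) - dsym h' (x \<bullet> b)) \<le> ?A\<^sup>2 * (h + h')"
  proof -
    have "cmod (dsym h (x \<bullet> b) - dsym h' (x \<bullet> b)) \<le> ?A\<^sup>2 * h / 2 + ?A\<^sup>2 * h' / 2"
      using norm_triangle_le_diff[OF add_mono[OF dsym_approx[OF h(1) b] dsym_approx[OF h(2) b]]] by simp
    also have "\<dots> \<le> ?A\<^sup>2 * (h + h')" using h by (simp add: field_simps)
    finally show ?thesis .
  qed
  have "(\<Prod>b\<leftarrow>b # bs. dsym h (x \<bullet> b)) - (\<Prod>b\<leftarrow>b # bs. dsym h' (x \<bullet> b)) =
     dsym h (x \<bullet> b) * (?P h - ?P h') + (dsym h (x \<bullet> b) - dsym h' (x \<bullet> b)) * ?P h'"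
    by (simp add: algebra_simps)
  also have "cmod \<dots> \<le> ?A * (length bs * ?A ^ Suc (length bs) * (h + h')) + (?A\<^sup>2 * (h + h')) * ?A ^ length bs"
  proof (rule order.trans[OF norm_triangle_ineq add_mono])
    show "cmod (dsym h (x \<bullet> b) * (?P h - ?P h')) \<le> ?A * (length bs * ?A ^ Suc (length bs) * (h + h'))"
      unfolding norm_mult by (rule mult_mono) (use dsym_bound[OF h(1) b] Cons in auto)
    show "cmod ((dsym h (x \<bullet> b) - dsym h' (x \<bullet> b)) * ?P h') \<le> (?A\<^sup>2 * (h + h')) * ?A ^ length bs"
      unfolding norm_mult by (rule mult_mono) (use d prod_dsym_bound[OF h(2) _ x, of bs] Cons h in auto)
  qed
  also have "\<dots> = length (b # bs) * ?A ^ Suc (length (b # bs)) * (h + h')"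
    by (simp add: algebra_simps power2_eq_square)
  finally show ?case .
qed simp

section \<open>Sums over words in the basis\<close>

definition words :: "nat \<Rightarrow> 'a::euclidean_space list set" where
  "words n = {bs. set bs \<subseteq> Basis \<and> length bs \<le> n}"

lemma finite_words[simp]: "finite (words n)"
  unfolding words_def by (rule finite_lists_length_le) simp

text \<open>Multinomial theorem without multinomial coefficients: expanding the power without
  collecting equal terms gives one term per word.\<close>

lemma sum_words_length:
  fixes f :: "'a::euclidean_space \<Rightarrow> 'b::comm_semiring_1"
  shows "(\<Sum>bs | set bs \<subseteq> Basis \<and> length bs = k. \<Prod>b\<leftarrow>bs. f b) = (\<Sum>b\<in>Basis. f b) ^ k"
proof (induction k)
  case 0
  have "{bs :: 'a list. set bs \<subseteq> Basis \<and> length bs = 0} = {[]}" by auto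
  then show ?case by simp
next
  case (Suc k)
  let ?L = "\<lambda>k. {bs :: 'a list. set bs \<subseteq> Basis \<and> length bs = k}"
  have "(\<Sum>bs\<in>?L (Suc k). \<Prod>b\<leftarrow>bs. f b) = (\<Sum>p\<in>Basis \<times> ?L k. f (fst p) * (\<Prod>b\<leftarrow>snd p. f b))"
    by (rule sum.reindex_bij_witness[of _ "\<lambda>p. fst p # snd p" "\<lambda>bs. (hd bs, tl bs)"])
       (auto simp: length_Suc_conv)
  also have "\<dots> = (\<Sum>b\<in>Basis. f b) * (\<Sum>bs\<in>?L k. \<Prod>b\<leftarrow>bs. f b)"
    by (simp add: sum_product sum.cartesian_product case_prod_beta)
  finally show ?case by (simp add: Suc)
qed

lemma sum_words:
  fixes f :: "'a::euclidean_space \<Rightarrow> 'b::comm_semiring_1"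
  shows "(\<Sum>bs\<in>words n. (\<Prod>b\<leftarrow>bs. f b) * g (length bs)) = (\<Sum>k\<le>n. (\<Sum>b\<in>Basis. f b) ^ k * g k)"
proof -
  let ?L = "\<lambda>k. {bs :: 'a list. set bs \<subseteq> Basis \<and> length bs = k}"
  have "words n = (\<Union>k\<le>n. ?L k)" by (auto simp: words_def)
  then have "(\<Sum>bs\<in>words n. (\<Prod>b\<leftarrow>bs. f b) * g (length bs)) = (\<Sum>k\<le>n. \<Sum>bs\<in>?L k. (\<Prod>b\<leftarrow>bs. f b) * g (length bs))"
    by (simp add: sum.UNION_disjoint[OF _ _ ] finite_lists_length_eq disjoint_iff)
  also have "\<dots> = (\<Sum>k\<le>n. (\<Sum>bs\<in>?L k. \<Prod>b\<leftarrow>bs. f b) * g k)"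
    by (simp add: sum_distrib_right)
  finally show ?thesis by (simp add: sum_words_length)
qed

lemma sum_words_card:
  fixes g :: "nat \<Rightarrow> real"
  shows "(\<Sum>bs\<in>(words n :: 'a::euclidean_space list set). g (length bs)) = (\<Sum>k\<le>n. real DIM('a) ^ k * g k)"
proof -
  have 1: "(\<Prod>b\<leftarrow>bs. (1::real)) = 1" for bs :: "'a list" by (induction bs) auto
  show ?thesis using sum_words[of "\<lambda>_ :: 'a. 1 :: real" g n] by (simp add: 1)
qed

section \<open>Uniform polynomial approximation of random fields\<close>

text \<open>Step size and degree cutoff are tied to the same n: errors then decay like
  \<open>(1 / 2) ^ n\<close>, and evaluation points stay within distance n * 2^-n \<le> 1 of the
  origin. Words longer than n carry the zero functional, so Taylor polynomials of different degrees
  can be summed over a common set of words.\<close>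

definition coef :: "nat \<Rightarrow> 'a::euclidean_space list \<Rightarrow> (real \<times> 'a) list" where
  "coef n bs = (if length bs \<le> n then fdiff ((1 / 2) ^ n) bs else [])"

text \<open>The Taylor polynomial at the origin, with derivatives replaced by finite differences.\<close>
definition taylor :: "nat \<Rightarrow> ('a::euclidean_space \<Rightarrow> real) \<Rightarrow> 'a \<Rightarrow> real" where
  "taylor n F y = (\<Sum>bs\<in>words n. lin_comb (coef n bs) F / fact (length bs) * mon bs y)"

definition incr :: "nat \<Rightarrow> 'a::euclidean_space list \<Rightarrow> (real \<times> 'a) list" where
  "incr n bs = coef (Suc n) bs @ map (\<lambda>(c, y). (- 1 * c, y)) (coef n bs)"

lemma lin_comb_incr: "lin_comb (incr n bs) g = lin_comb (coef (Suc n) bs) g - lin_comb (coef n bs) g"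
  unfolding incr_def lin_comb_simps(3) lin_comb_map_scale[of "- 1"] scaleR_minus1_left by (rule add_uminus_conv_diff)

lemma coef_points:
  assumes "bs \<in> words m" "W \<ge> 1"
  shows "snd ` set (coef n bs) \<subseteq> cball 0 W"
proof
  fix y assume "y \<in> snd ` set (coef n bs)"
  then obtain p where p: "p \<in> set (fdiff ((1 / 2) ^ n) bs)" "y = snd p" "length bs \<le> n"
    by (auto simp: coef_def split: if_splits)
  have "norm y \<le> (1 / 2) ^ n * length bs"
    unfolding p(2) using assms by (intro fdiff_points p(1)) (auto simp: words_def)
  also have "\<dots> \<le> (1 / 2) ^ n * 2 ^ n"
  proof (intro mult_left_mono)
    have "real (length bs) \<le> real n" using p(3) by simp
    also have "\<dots> \<le> 2 ^ n" by (rule less_imp_le[OF of_nat_less_two_power])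
    finally show "real (length bs) \<le> 2 ^ n" .
  qed simp
  also have "\<dots> = 1" by (simp add: power_mult_distrib[symmetric])
  finally show "y \<in> cball 0 W" using assms by simp
qed

lemma incr_points:
  assumes "bs \<in> words m" "W \<ge> 1"
  shows "snd ` set (incr n bs) \<subseteq> cball 0 W"
proof -
  have "snd ` set (map (\<lambda>(c, y). (- 1 * c, y)) (coef n bs)) = snd ` set (coef n bs)"
    by (simp add: image_image case_prod_beta)
  then show ?thesis using coef_points[OF assms] unfolding incr_def set_append image_Un by blast
qed

lemma coef_symbol_bound:
  fixes x :: "'a::euclidean_space"
  assumes "bs \<in> words m" "norm x = 1"
  shows "cmod (symbol (coef n bs) x) \<le> (2 * pi) ^ length bs"
  using prod_dsym_bound[of "(1 / 2) ^ n" bs x] assms by (auto simp: coef_def fdiff_symbol words_def)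

lemma power_4_pi: "2 ^ k * (2 * pi) ^ k = (4 * pi) ^ k"
proof -
  have "(4 * pi) ^ k = (2 * (2 * pi)) ^ k" by simp
  also have "\<dots> = 2 ^ k * (2 * pi) ^ k" by (rule power_mult_distrib)
  finally show ?thesis by (rule sym)
qed

text \<open>For old words the smallness comes from refining the step. A new word, of length n + 1,
  has no smallness of its own; the factor 2^-n is bought by doubling the base from 2 pi to 4 pi,
  which the factorial in \<open>weight\<close> can afford.\<close>

lemma incr_symbol_bound:
  fixes x :: "'a::euclidean_space"
  assumes bs: "bs \<in> words (Suc n)" and x: "norm x = 1"
  shows "cmod (symbol (incr n bs) x) \<le> (1 / 2) ^ n * (4 * pi) ^ Suc (length bs)"
proof (cases "length bs \<le> n")
  case True
  let ?k = "length bs"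
  have "cmod (symbol (incr n bs) x) \<le> ?k * (2 * pi) ^ Suc ?k * ((1 / 2) ^ Suc n + (1 / 2) ^ n)"
    unfolding lin_comb_incr using True bs x
    by (simp only: coef_def fdiff_symbol if_True le_SucI) (intro prod_dsym_diff, auto simp: words_def)
  also have "\<dots> \<le> ?k * (2 * pi) ^ Suc ?k * (2 * (1 / 2) ^ n)"
    by (intro mult_left_mono) auto
  also have "\<dots> = (1 / 2) ^ n * ((2 * real ?k) * (2 * pi) ^ Suc ?k)" by simp
  also have "\<dots> \<le> (1 / 2) ^ n * (2 ^ Suc ?k * (2 * pi) ^ Suc ?k)"
  proof (intro mult_left_mono mult_right_mono)
    show "2 * real ?k \<le> 2 ^ Suc ?k" using of_nat_less_two_power[of ?k, where 'a=real] by simp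
  qed auto
  also have "\<dots> = (1 / 2) ^ n * (4 * pi) ^ Suc ?k" unfolding power_4_pi ..
  finally show ?thesis .
next
  case False
  then have k: "length bs = Suc n" using bs by (auto simp: words_def)
  have "cmod (symbol (incr n bs) x) = cmod (symbol (coef (Suc n) bs) x)"
    using False by (simp add: lin_comb_incr) (simp add: coef_def)
  also have "\<dots> \<le> (2 * pi) ^ Suc n" using coef_symbol_bound[OF bs x, of "Suc n"] k by simp
  also have "\<dots> = (1 / 2) ^ n * (2 ^ n * (2 * pi) ^ Suc n)" by (simp add: power_divide)
  also have "\<dots> \<le> (1 / 2) ^ n * (4 * pi) ^ Suc (length bs)"
  proof (intro mult_left_mono)
    have "2 ^ n * (2 * pi) ^ Suc n \<le> 2 ^ Suc n * (2 * pi) ^ Suc n" by (intro mult_right_mono) auto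
    also have "\<dots> = (4 * pi) ^ Suc n" by (rule power_4_pi)
    also have "\<dots> \<le> (4 * pi) ^ Suc (length bs)" using pi_gt3 k by (intro power_increasing) auto
    finally show "2 ^ n * (2 * pi) ^ Suc n \<le> (4 * pi) ^ Suc (length bs)" .
  qed auto
  finally show ?thesis .
qed

text \<open>Bound, from \<open>iter_pd_mon_le\<close>, for the derivatives up to order s of a
  monomial of degree k divided by k!.\<close>

definition weight :: "nat \<Rightarrow> real \<Rightarrow> nat \<Rightarrow> real" where
  "weight s W k = real (Suc k) ^ s * W ^ k / fact k"

lemma weight_nonneg: "W \<ge> 0 \<Longrightarrow> weight s W k \<ge> 0"
  by (simp add: weight_def)

section \<open>C^s estimates for polynomials indexed by words\<close>

lemma iter_pd_mon_sum:
  fixes a :: "'a::euclidean_space list \<Rightarrow> real"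
  assumes K: "convex K" "interior K \<noteq> {}" and A: "finite A"
  shows "Cs_on s K (\<lambda>y. \<Sum>bs\<in>A. a bs * mon bs y) \<and>
    (\<forall>l y. set l \<subseteq> Basis \<longrightarrow> length l \<le> s \<longrightarrow> y \<in> K \<longrightarrow>
      iter_pd K l (\<lambda>y. \<Sum>bs\<in>A. a bs * mon bs y) y = (\<Sum>bs\<in>A. a bs * iter_pd K l (mon bs) y))"
  using A
proof induction
  case empty
  have "Cs_on s K (\<lambda>y. 0 * mon [] y + 0 * mon [] y :: real)"
    by (rule Cs_on_lincomb[OF K mon_Cs_on[OF K] mon_Cs_on[OF K]])
  moreover have "iter_pd K l (\<lambda>y. 0 * mon [] y + 0 * mon [] y) y = 0"
    if "set l \<subseteq> Basis" "length l \<le> s" "y \<in> K" for l y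
    using iter_pd_lincomb_eq[OF K mon_Cs_on[OF K] mon_Cs_on[OF K] that, of 0 "[]" 0 "[]"] by simp
  ultimately show ?case by simp
next
  case (insert bs A)
  let ?g = "\<lambda>y. \<Sum>bs\<in>A. a bs * mon bs y"
  have eq: "(\<lambda>y. \<Sum>bs\<in>insert bs A. a bs * mon bs y) = (\<lambda>y. a bs * mon bs y + 1 * ?g y)"
    using insert by simp
  have g: "Cs_on s K ?g" using insert by blast
  have "iter_pd K l (\<lambda>y. a bs * mon bs y + 1 * ?g y) y = (\<Sum>bs\<in>insert bs A. a bs * iter_pd K l (mon bs) y)"
    if "set l \<subseteq> Basis" "length l \<le> s" "y \<in> K" for l y
  proof -
    have "iter_pd K l (\<lambda>y. a bs * mon bs y + 1 * ?g y) y = a bs * iter_pd K l (mon bs) y + 1 * iter_pd K l ?g y"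
      by (rule iter_pd_lincomb_eq[OF K mon_Cs_on[OF K] g that])
    also have "iter_pd K l ?g y = (\<Sum>bs\<in>A. a bs * iter_pd K l (mon bs) y)" using insert.IH that by blast
    finally show ?thesis using insert.hyps by simp
  qed
  moreover have "Cs_on s K (\<lambda>y. a bs * mon bs y + 1 * ?g y)"
    by (rule Cs_on_lincomb[OF K mon_Cs_on[OF K] g])
  ultimately show ?case unfolding eq by blast
qed

lemma taylor_Cs_on:
  assumes "convex K" "interior K \<noteq> {}"
  shows "Cs_on s K (taylor n F)"
  unfolding taylor_def[abs_def]
  by (rule conjunct1[OF iter_pd_mon_sum[OF assms finite_words, of s "\<lambda>bs. lin_comb (coef n bs) F / fact (length bs)" n]])

lemma iter_pd_taylor:
  assumes "convex K" "interior K \<noteq> {}" "set l \<subseteq> Basis" "y \<in> K" "n \<le> m"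
  shows "iter_pd K l (taylor n F) y = (\<Sum>bs\<in>words m. lin_comb (coef n bs) F / fact (length bs) * iter_pd K l (mon bs) y)"
proof -
  have "iter_pd K l (taylor n F) y = (\<Sum>bs\<in>words n. lin_comb (coef n bs) F / fact (length bs) * iter_pd K l (mon bs) y)"
    using iter_pd_mon_sum[OF assms(1,2) finite_words, of "length l" "\<lambda>bs. lin_comb (coef n bs) F / fact (length bs)" n] assms
    unfolding taylor_def[abs_def] by blast
  also have "\<dots> = (\<Sum>bs\<in>words m. lin_comb (coef n bs) F / fact (length bs) * iter_pd K l (mon bs) y)"
    using assms(5) by (intro sum.mono_neutral_left finite_words) (auto simp: words_def coef_def)
  finally show ?thesis .
qed

lemma mon_sum_bound:
  fixes a :: "'a::euclidean_space list \<Rightarrow> real"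
  assumes W: "W \<ge> 1" and l: "set l \<subseteq> Basis" "length l \<le> s" and y: "y \<in> cball 0 W"
  shows "\<bar>\<Sum>bs\<in>words m. a bs / fact (length bs) * iter_pd (cball 0 W) l (mon bs) y\<bar>
    \<le> (\<Sum>bs\<in>words m. \<bar>a bs\<bar> * weight s W (length bs))"
proof (rule order.trans[OF sum_abs sum_mono])
  fix bs :: "'a list" assume "bs \<in> words m"
  then have "\<bar>iter_pd (cball 0 W) l (mon bs) y\<bar> \<le> real (Suc (length bs)) ^ s * W ^ length bs"
    by (intro iter_pd_mon_le W l y) (auto simp: words_def)
  then have "\<bar>a bs\<bar> / fact (length bs) * \<bar>iter_pd (cball 0 W) l (mon bs) y\<bar> \<le> \<bar>a bs\<bar> / fact (length bs) * (real (Suc (length bs)) ^ s * W ^ length bs)"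
    by (intro mult_left_mono) auto
  then show "\<bar>a bs / fact (length bs) * iter_pd (cball 0 W) l (mon bs) y\<bar> \<le> \<bar>a bs\<bar> * weight s W (length bs)"
    by (simp add: weight_def abs_mult)
qed

text \<open>Closeness in C^s without suprema and without membership in \<open>Cs_space\<close>.
  Taylor polynomials need not vanish outside the ball, so they are in general not elements of that
  space.\<close>

definition cs_close :: "nat \<Rightarrow> real \<Rightarrow> ('a::euclidean_space \<Rightarrow> real) \<Rightarrow> ('a \<Rightarrow> real) \<Rightarrow> real \<Rightarrow> bool" where
  "cs_close s W f g c \<longleftrightarrow> (\<forall>l y. set l \<subseteq> Basis \<longrightarrow> length l \<le> s \<longrightarrow> y \<in> cball 0 W \<longrightarrow>
    \<bar>iter_pd (cball 0 W) l f y - iter_pd (cball 0 W) l g y\<bar> \<le> c)"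

lemma cs_close_triangle:
  fixes f g h :: "'a::euclidean_space \<Rightarrow> real"
  assumes "cs_close s W f g c" "cs_close s W g h d" "c + d \<le> e"
  shows "cs_close s W f h e"
  unfolding cs_close_def
proof (intro allI impI)
  fix l :: "'a list" and y :: 'a assume *: "set l \<subseteq> Basis" "length l \<le> s" "y \<in> cball 0 W"
  have "\<bar>iter_pd (cball 0 W) l f y - iter_pd (cball 0 W) l g y\<bar> \<le> c" "\<bar>iter_pd (cball 0 W) l g y - iter_pd (cball 0 W) l h y\<bar> \<le> d"
    using assms(1,2) * unfolding cs_close_def by blast+
  then show "\<bar>iter_pd (cball 0 W) l f y - iter_pd (cball 0 W) l h y\<bar> \<le> e" using assms(3) by linarith
qed

lemma cs_close_sym: "cs_close s W f g c \<Longrightarrow> cs_close s W g f c"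
  by (simp add: cs_close_def abs_minus_commute)

definition incr_size :: "nat \<Rightarrow> real \<Rightarrow> nat \<Rightarrow> ('a::euclidean_space \<Rightarrow> real) \<Rightarrow> real" where
  "incr_size s W n F = (\<Sum>bs\<in>words (Suc n). \<bar>lin_comb (incr n bs) F\<bar> * weight s W (length bs))"

lemma incr_size_nonneg: "W \<ge> 0 \<Longrightarrow> incr_size s W n F \<ge> 0"
  by (auto simp: incr_size_def intro!: sum_nonneg mult_nonneg_nonneg weight_nonneg)

lemma taylor_increment:
  assumes W: "W \<ge> 1"
  shows "cs_close s W (taylor (Suc n) F) (taylor n F) (incr_size s W n F)"
  unfolding cs_close_def
proof (intro allI impI)
  fix l :: "'a list" and y :: 'a assume l: "set l \<subseteq> Basis" "length l \<le> s" and y: "y \<in> cball 0 W"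
  have K: "convex (cball 0 W :: 'a set)" "interior (cball 0 W :: 'a set) \<noteq> {}" using W by auto
  have "iter_pd (cball 0 W) l (taylor (Suc n) F) y - iter_pd (cball 0 W) l (taylor n F) y
    = (\<Sum>bs\<in>words (Suc n). lin_comb (incr n bs) F / fact (length bs) * iter_pd (cball 0 W) l (mon bs) y)"
    using iter_pd_taylor[OF K l(1) y, of "Suc n" "Suc n" F] iter_pd_taylor[OF K l(1) y, of n "Suc n" F]
    by (simp add: lin_comb_incr diff_divide_distrib left_diff_distrib sum_subtractf)
  then show "\<bar>iter_pd (cball 0 W) l (taylor (Suc n) F) y - iter_pd (cball 0 W) l (taylor n F) y\<bar> \<le> incr_size s W n F"
    using mon_sum_bound[OF W l y] unfolding incr_size_def by simp
qed

lemma taylor_Lipschitz: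
  assumes W: "W \<ge> 1"
  shows "cs_close s W (taylor n F) (taylor n F')
    (\<Sum>bs\<in>words n. \<bar>lin_comb (coef n bs) F - lin_comb (coef n bs) F'\<bar> * weight s W (length bs))"
  unfolding cs_close_def
proof (intro allI impI)
  fix l :: "'a list" and y :: 'a assume l: "set l \<subseteq> Basis" "length l \<le> s" and y: "y \<in> cball 0 W"
  have K: "convex (cball 0 W :: 'a set)" "interior (cball 0 W :: 'a set) \<noteq> {}" using W by auto
  have "iter_pd (cball 0 W) l (taylor n F) y - iter_pd (cball 0 W) l (taylor n F') y
    = (\<Sum>bs\<in>words n. (lin_comb (coef n bs) F - lin_comb (coef n bs) F') / fact (length bs) * iter_pd (cball 0 W) l (mon bs) y)"
    unfolding iter_pd_taylor[OF K l(1) y order_refl]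
    by (simp add: diff_divide_distrib left_diff_distrib sum_subtractf)
  then show "\<bar>iter_pd (cball 0 W) l (taylor n F) y - iter_pd (cball 0 W) l (taylor n F') y\<bar>
    \<le> (\<Sum>bs\<in>words n. \<bar>lin_comb (coef n bs) F - lin_comb (coef n bs) F'\<bar> * weight s W (length bs))"
    using mon_sum_bound[OF W l y] by simp
qed

section \<open>Mean size of the Taylor increments\<close>

lemma exp_partial_sum_le:
  fixes y :: real
  assumes "y \<ge> 0"
  shows "(\<Sum>k\<le>n. y ^ k / fact k) \<le> exp y"
proof -
  have "(\<lambda>k. y ^ k / fact k) sums exp y"
    using exp_converges[of y] by (simp add: divide_inverse mult.commute)
  then show ?thesis using assms sum_le_suminf[of "\<lambda>k. y ^ k / fact k" "{..n}"] by (auto simp: sums_iff)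
qed

text \<open>A single term of the exponential series gives (k+1)^s \<le> s! exp (k+1). The loss from
  s derivatives is thereby geometric in k, and the remaining sum is again an exponential
  series.\<close>

lemma weighted_sum_le:
  fixes x :: real
  assumes x: "x \<ge> 0" and W: "W \<ge> 0"
  shows "(\<Sum>k\<le>n. x ^ k * weight s W k) \<le> fact s * exp 1 * exp (x * W * exp 1)"
proof -
  have "x ^ k * weight s W k \<le> fact s * exp 1 * ((x * W * exp 1) ^ k / fact k)" for k
  proof -
    have "real (Suc k) ^ s / fact s \<le> (\<Sum>j\<le>s. real (Suc k) ^ j / fact j)"
      by (intro member_le_sum) auto
    also have "\<dots> \<le> exp (real (Suc k))" by (rule exp_partial_sum_le) simp
    finally have "real (Suc k) ^ s \<le> fact s * exp (real (Suc k))" by (simp add: pos_divide_le_eq mult.commute)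
    also have "exp (real (Suc k)) = exp 1 * exp 1 ^ k"
      by (simp add: exp_add exp_of_nat_mult[of k 1, simplified])
    finally have "x ^ k * (real (Suc k) ^ s * W ^ k / fact k) \<le> x ^ k * ((fact s * (exp 1 * exp 1 ^ k)) * W ^ k / fact k)"
      using x W by (intro mult_left_mono divide_right_mono mult_right_mono) auto
    then show ?thesis by (simp add: weight_def power_mult_distrib mult_ac)
  qed
  then have "(\<Sum>k\<le>n. x ^ k * weight s W k) \<le> (\<Sum>k\<le>n. fact s * exp 1 * ((x * W * exp 1) ^ k / fact k))" by (rule sum_mono)
  also have "\<dots> = fact s * exp 1 * (\<Sum>k\<le>n. (x * W * exp 1) ^ k / fact k)" by (simp add: sum_distrib_left)
  also have "\<dots> \<le> fact s * exp 1 * exp (x * W * exp 1)"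
    using x W by (intro mult_left_mono exp_partial_sum_le) auto
  finally show ?thesis .
qed

text \<open>There are DIM('a)^k words of length k, each costing at most 2 * 2^-n * (4 pi)^(k+1) in
  mean. The factorial in \<open>weight\<close> sums these uniformly in n, leaving the geometric
  factor; T depends on the dimension, s and W, not on the law.\<close>

lemma incr_size_mean:
  assumes W: "W > 1"
  obtains T where "T > 0" "\<And>(M :: ('a::euclidean_space \<Rightarrow> real) measure) n. spectral_bound s W M \<Longrightarrow>
    (\<integral>\<^sup>+F. ennreal (incr_size s W n F) \<partial>M) \<le> ennreal (T * (1 / 2) ^ n)"
proof -
  define X where "X = 4 * pi * real DIM('a)"
  define T where "T = 8 * pi * (fact s * exp 1 * exp (X * W * exp 1))"
  have "(\<integral>\<^sup>+F. ennreal (incr_size s W n F) \<partial>M) \<le> ennreal (T * (1 / 2) ^ n)"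
    if M: "spectral_bound s W M" for M :: "('a \<Rightarrow> real) measure" and n
  proof -
    let ?q = "\<lambda>k. (1 / 2) ^ n * (4 * pi) ^ Suc k :: real"
    have m[measurable]: "(\<lambda>F. lin_comb (incr n bs) F) \<in> borel_measurable M" if "bs \<in> words (Suc n)" for bs :: "'a list"
      using W incr_points[OF that, of W n] M by (intro lin_comb_measurable) (auto simp: spectral_bound_def)
    have "(\<integral>\<^sup>+F. ennreal (incr_size s W n F) \<partial>M) = (\<integral>\<^sup>+F. (\<Sum>bs\<in>(words (Suc n) :: 'a list set). ennreal \<bar>lin_comb (incr n bs) F\<bar> * ennreal (weight s W (length bs))) \<partial>M)"
      unfolding incr_size_def using W
      by (intro nn_integral_cong) (simp add: ennreal_mult' weight_nonneg sum_nonneg flip: sum_ennreal)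
    also have "\<dots> = (\<Sum>bs\<in>(words (Suc n) :: 'a list set). \<integral>\<^sup>+F. ennreal \<bar>lin_comb (incr n bs) F\<bar> * ennreal (weight s W (length bs)) \<partial>M)"
      using m by (intro nn_integral_sum) measurable
    also have "\<dots> = (\<Sum>bs\<in>(words (Suc n) :: 'a list set). (\<integral>\<^sup>+F. ennreal \<bar>lin_comb (incr n bs) F\<bar> \<partial>M) * ennreal (weight s W (length bs)))"
      using m by (intro sum.cong refl nn_integral_multc) measurable
    also have "\<dots> \<le> (\<Sum>bs\<in>(words (Suc n) :: 'a list set). ennreal (2 * ?q (length bs)) * ennreal (weight s W (length bs)))"
    proof (rule sum_mono, rule mult_right_mono)
      fix bs :: "'a list" assume bs: "bs \<in> words (Suc n)"
      show "(\<integral>\<^sup>+F. ennreal \<bar>lin_comb (incr n bs) F\<bar> \<partial>M) \<le> ennreal (2 * ?q (length bs))"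
        using W incr_points[OF bs, of W n] by (intro spectral_bound_abs[OF M] incr_symbol_bound[OF bs]) auto
    qed simp
    also have "\<dots> = ennreal (\<Sum>bs\<in>(words (Suc n) :: 'a list set). 2 * ?q (length bs) * weight s W (length bs))"
      using W by (simp add: ennreal_mult'[symmetric] weight_nonneg flip: sum_ennreal)
    also have "(\<Sum>bs\<in>(words (Suc n) :: 'a list set). 2 * ?q (length bs) * weight s W (length bs))
      = (\<Sum>k\<le>Suc n. real DIM('a) ^ k * (2 * ?q k * weight s W k))"
      by (rule sum_words_card)
    also have "\<dots> = (1 / 2) ^ n * (8 * pi) * (\<Sum>k\<le>Suc n. X ^ k * weight s W k)"
      unfolding sum_distrib_left by (intro sum.cong refl) (simp add: X_def power_mult_distrib mult_ac)
    also have "\<dots> \<le> (1 / 2) ^ n * (8 * pi) * (fact s * exp 1 * exp (X * W * exp 1))"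
      using W by (intro mult_left_mono weighted_sum_le) (auto simp: X_def)
    also have "\<dots> = T * (1 / 2) ^ n" by (simp add: T_def)
    finally show ?thesis by (simp add: ennreal_leI)
  qed
  then show ?thesis by (intro that[of T]) (auto simp: T_def)
qed

section \<open>Pointwise convergence of the Taylor polynomials in mean\<close>

definition taylor_symbol :: "nat \<Rightarrow> 'a::euclidean_space \<Rightarrow> 'a \<Rightarrow> complex" where
  "taylor_symbol n x y = (\<Sum>bs\<in>words n. (mon bs y / fact (length bs)) *\<^sub>R (\<Prod>b\<leftarrow>bs. dsym ((1 / 2) ^ n) (x \<bullet> b)))"

text \<open>By the word form of the multinomial theorem the symbol is a truncated exponential series
  at a point z, and z differs from 2 pi i (x \<bullet> y) by an error proportional to the step.
  Truncation and step errors are both of order 2^-n, uniformly on the sphere and the ball.\<close>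

lemma taylor_symbol_bound:
  assumes W: "W \<ge> 1"
  shows "\<exists>c>0. \<forall>n x y :: 'a::euclidean_space. norm x = 1 \<longrightarrow> y \<in> cball 0 W \<longrightarrow>
    cmod (taylor_symbol n x y - ee (x \<bullet> y)) \<le> c * (1 / 2) ^ n"
proof -
  define Y where "Y = 2 * pi * DIM('a) * W"
  define D where "D = DIM('a) * W * (2 * pi)\<^sup>2"
  have Y: "Y \<ge> 0" and D: "D \<ge> 0" using W by (auto simp: Y_def D_def)
  have "D > 0" using W by (simp add: D_def)
  have bound: "cmod (taylor_symbol n x y - ee (x \<bullet> y))
      \<le> (exp Y * Y * exp (2 * Y) + exp D * D) * (1 / 2) ^ n"
    if x: "norm x = 1" and y: "y \<in> cball 0 W" for n and x y :: 'a
  proof -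
    define h :: real where "h = (1 / 2) ^ n"
    have h: "0 < h" "h \<le> 1" by (auto simp: h_def power_le_one)
    define z where "z = (\<Sum>b\<in>Basis. complex_of_real (y \<bullet> b) * dsym h (x \<bullet> b))"
    define z0 where "z0 = 2 * pi * \<i> * (x \<bullet> y)"
    have yb: "\<bar>y \<bullet> b\<bar> \<le> W" and xb: "\<bar>x \<bullet> b\<bar> \<le> 1" if "b \<in> Basis" for b
      using Basis_le_norm[OF that, of y] Basis_le_norm[OF that, of x] x y by auto
    have zY: "cmod z \<le> Y"
    proof -
      have "cmod z \<le> (\<Sum>b\<in>(Basis :: 'a set). W * (2 * pi))"
        unfolding z_def using W yb xb dsym_bound[OF h(1)]
        by (intro order.trans[OF norm_sum] sum_mono) (auto simp: norm_mult intro!: mult_mono)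
      then show ?thesis by (simp add: Y_def mult_ac)
    qed
    have z0: "z0 = (\<Sum>b\<in>Basis. complex_of_real (y \<bullet> b) * (2 * pi * \<i> * (x \<bullet> b)))"
      unfolding z0_def euclidean_inner[of x y] by (simp add: sum_distrib_left mult_ac)
    have dz: "cmod (z - z0) \<le> D * h"
    proof -
      have "cmod (z - z0) \<le> (\<Sum>b\<in>(Basis :: 'a set). W * ((2 * pi)\<^sup>2 * h / 2))"
        unfolding z_def z0 sum_subtractf[symmetric] right_diff_distrib[symmetric]
        using W yb xb dsym_approx[OF h(1)]
        by (intro order.trans[OF norm_sum] sum_mono) (auto simp: norm_mult intro!: mult_mono)
      also have "\<dots> = D * h / 2" by (simp add: D_def)
      also have "\<dots> \<le> D * h" using D h by simp
      finally show ?thesis .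
    qed
    have "taylor_symbol n x y
      = (\<Sum>bs\<in>words n. (\<Prod>b\<leftarrow>bs. complex_of_real (y \<bullet> b) * dsym h (x \<bullet> b)) * (1 / fact (length bs)))"
      unfolding taylor_symbol_def h_def[symmetric]
    proof (intro sum.cong refl)
      fix bs :: "'a list"
      have "(\<Prod>b\<leftarrow>bs. complex_of_real (y \<bullet> b) * dsym h (x \<bullet> b)) = complex_of_real (mon bs y) * (\<Prod>b\<leftarrow>bs. dsym h (x \<bullet> b))"
        by (induction bs) auto
      then show "(mon bs y / fact (length bs)) *\<^sub>R (\<Prod>b\<leftarrow>bs. dsym h (x \<bullet> b)) = (\<Prod>b\<leftarrow>bs. complex_of_real (y \<bullet> b) * dsym h (x \<bullet> b)) * (1 / fact (length bs))"
        by (simp add: scaleR_conv_of_real)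
    qed
    also have "\<dots> = (\<Sum>k\<le>n. z ^ k * (1 / fact k))" unfolding z_def by (rule sum_words)
    finally have eq: "taylor_symbol n x y = (\<Sum>k\<le>n. z ^ k / fact k)"
      by simp
    have ee: "ee (x \<bullet> y) = exp z0" by (simp add: ee_iexp z0_def mult_ac)
    have "cmod ((\<Sum>k\<le>n. z ^ k / fact k) - exp z) \<le> exp Y * Y * exp (2 * Y) * h"
    proof -
      have "cmod ((\<Sum>k\<le>n. z ^ k / fact k) - exp z) \<le> exp \<bar>Re z\<bar> * cmod z ^ Suc n / fact n"
        using Taylor_exp[of z n] by (simp add: norm_minus_commute)
      also have "\<dots> \<le> exp Y * Y ^ Suc n / fact n"
        using zY abs_Re_le_cmod[of z] by (intro divide_right_mono mult_mono power_mono) auto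
      \<comment> \<open>The power Y^n is written as (2 Y)^n * 2^-n; a single term of the exponential
        series for 2 Y bounds the rest.\<close>
      also have "\<dots> = exp Y * Y * (((2 * Y) ^ n / fact n) * h)" by (simp add: h_def power_mult_distrib power_divide)
      also have "(2 * Y) ^ n / fact n \<le> (\<Sum>k\<le>n. (2 * Y) ^ k / fact k)" using Y by (intro member_le_sum) auto
      also have "\<dots> \<le> exp (2 * Y)" using Y by (intro exp_partial_sum_le) auto
      finally show ?thesis using Y h by (simp add: mult_left_mono mult_right_mono mult.assoc)
    qed
    moreover have "cmod (exp z - exp z0) \<le> exp D * D * h"
    proof -
      have "exp z - exp z0 = exp z0 * (exp (z - z0) - 1)" by (simp add: right_diff_distrib flip: exp_add)
      then have "cmod (exp z - exp z0) = cmod (exp (z - z0) - 1)" by (simp add: norm_mult flip: ee)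
      also have "\<dots> \<le> exp \<bar>Re (z - z0)\<bar> * cmod (z - z0)" using Taylor_exp[of "z - z0" 0] by simp
      also have "\<dots> \<le> exp D * (D * h)"
      proof (intro mult_mono dz)
        have "\<bar>Re (z - z0)\<bar> \<le> D * h" by (rule order.trans[OF abs_Re_le_cmod dz])
        also have "\<dots> \<le> D" using D h by (simp add: mult_left_le)
        finally show "exp \<bar>Re (z - z0)\<bar> \<le> exp D" by simp
      qed auto
      finally show ?thesis by (simp add: mult.assoc)
    qed
    ultimately have "cmod ((\<Sum>k\<le>n. z ^ k / fact k) - exp z0) \<le> exp Y * Y * exp (2 * Y) * h + exp D * D * h"
      by (rule norm_diff_triangle_le)
    then show ?thesis unfolding h_def[symmetric] eq ee by (simp add: distrib_right)
  qed
  have "exp Y * Y * exp (2 * Y) + exp D * D > 0" using Y \<open>D > 0\<close> by (intro add_nonneg_pos) auto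
  then show ?thesis using bound by blast
qed

text \<open>Adjoining y with coefficient -1 turns the interpolation error into one functional, whose
  symbol was just estimated. This is what ties the limit of the polynomials to F; the increments
  alone only show that some limit exists.\<close>

lemma taylor_pointwise_mean:
  assumes W: "W > 1"
  obtains c where "c > 0" "\<And>(M :: ('a::euclidean_space \<Rightarrow> real) measure) n y. spectral_bound s W M \<Longrightarrow> y \<in> cball 0 W \<Longrightarrow>
    (\<lambda>F. taylor n F y - F y) \<in> borel_measurable M \<and> (\<integral>\<^sup>+F. ennreal \<bar>taylor n F y - F y\<bar> \<partial>M) \<le> ennreal (c * (1 / 2) ^ n)"
proof -
  obtain c where c: "c > 0" and sym: "\<And>n (x :: 'a) y. norm x = 1 \<Longrightarrow> y \<in> cball 0 W \<Longrightarrow>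
    cmod (taylor_symbol n x y - ee (x \<bullet> y)) \<le> c * (1 / 2) ^ n"
    using taylor_symbol_bound[of W, where 'a='a] W by fastforce
  have "(\<lambda>F. taylor n F y - F y) \<in> borel_measurable M \<and> (\<integral>\<^sup>+F. ennreal \<bar>taylor n F y - F y\<bar> \<partial>M) \<le> ennreal (2 * c * (1 / 2) ^ n)"
    if M: "spectral_bound s W M" and y: "y \<in> cball 0 W" for M :: "('a \<Rightarrow> real) measure" and n y
  proof -
    obtain L where L: "\<forall>g :: 'a \<Rightarrow> real. lin_comb L g = (\<Sum>bs\<in>words n. (mon bs y / fact (length bs)) *\<^sub>R lin_comb (coef n bs) g)"
      "\<forall>g :: 'a \<Rightarrow> complex. lin_comb L g = (\<Sum>bs\<in>words n. (mon bs y / fact (length bs)) *\<^sub>R lin_comb (coef n bs) g)"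
      "snd ` set L \<subseteq> (\<Union>bs\<in>words n. snd ` set (coef n bs))"
      using lin_comb_sum[OF finite_words, of "\<lambda>bs. mon bs y / fact (length bs)" "coef n" n] by blast
    define L' where "L' = (-1, y) # L"
    have pts: "snd ` set L' \<subseteq> cball 0 W"
      using L(3) coef_points[of _ n W n] W y unfolding L'_def by fastforce
    have val: "lin_comb L' F = taylor n F y - F y" for F :: "'a \<Rightarrow> real"
      by (simp add: L'_def L(1) taylor_def mult.commute)
    have "cmod (symbol L' x) \<le> c * (1 / 2) ^ n" if "norm x = 1" for x
    proof -
      have "symbol (coef n bs) x = (\<Prod>b\<leftarrow>bs. dsym ((1 / 2) ^ n) (x \<bullet> b))" if "bs \<in> words n" for bs
        using that by (simp add: coef_def fdiff_symbol words_def)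
      then have "symbol L' x = taylor_symbol n x y - ee (x \<bullet> y)"
        by (simp add: L'_def L(2) taylor_symbol_def)
      then show ?thesis using sym[OF that y] by simp
    qed
    then have "(\<integral>\<^sup>+F. ennreal \<bar>lin_comb L' F\<bar> \<partial>M) \<le> ennreal (2 * (c * (1 / 2) ^ n))"
      using W c by (intro spectral_bound_abs[OF M _ pts]) auto
    moreover have "(\<lambda>F. lin_comb L' F) \<in> borel_measurable M"
      using W M by (intro lin_comb_measurable[OF _ pts]) (auto simp: spectral_bound_def)
    ultimately show ?thesis by (simp add: val mult.assoc)
  qed
  then show ?thesis using c by (intro that[of "2 * c"]) auto
qed

section \<open>From bounds in mean to approximation in C^s\<close>

lemma incr_size_measurable:
  fixes M :: "('a::euclidean_space \<Rightarrow> real) measure"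
  assumes "W > 1" "sets M = sets (cs_borel s W)"
  shows "(\<lambda>F. incr_size s W n F) \<in> borel_measurable M"
proof -
  have "(\<lambda>F. lin_comb (incr n bs) F) \<in> borel_measurable M" if "bs \<in> words (Suc n)" for bs :: "'a list"
    using assms incr_points[OF that, of W n] by (intro lin_comb_measurable) auto
  then show ?thesis unfolding incr_size_def by measurable
qed

text \<open>Bounded increment sums make the Taylor polynomials Cauchy in C^s. Their uniform limit
  agrees with F on a dense set, hence on the ball by continuity, and the derivatives follow by
  \<open>iter_pd_limit\<close>. The statement is deterministic; probability enters only through its
  hypotheses.\<close>

lemma taylor_tail:
  fixes F :: "'a::euclidean_space \<Rightarrow> real"
  assumes W: "W > 1" and F: "F \<in> Cs_space s W"
    and Y0: "Y0 \<subseteq> cball 0 W" "cball 0 W \<subseteq> closure Y0"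
    and pw: "\<And>y. y \<in> Y0 \<Longrightarrow> (\<lambda>n. taylor n F y) \<longlonglongrightarrow> F y"
    and S: "\<And>m. (\<Sum>i<m. incr_size s W (n + i) F) \<le> \<epsilon>"
  shows "cs_close s W F (taylor n F) \<epsilon>"
proof -
  let ?K = "cball 0 W :: 'a set"
  have K: "convex ?K" "interior ?K \<noteq> {}" using W by auto
  define fn where "fn m = taylor (n + m) F" for m
  define a where "a i = incr_size s W (n + i) F" for i
  have a0: "a i \<ge> 0" for i using W by (simp add: a_def incr_size_nonneg)
  have summ: "summable a"
    by (rule summableI_nonneg_bounded[where x=\<epsilon>]) (use a0 S in \<open>auto simp: a_def\<close>)
  have tele: "cs_close s W (fn (m + p)) (fn m) (\<Sum>i<p. a (m + i))" for m p
  proof (induction p)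
    case (Suc p)
    have "cs_close s W (fn (m + Suc p)) (fn (m + p)) (a (m + p))"
      using taylor_increment[of W s "n + (m + p)" F] W by (simp add: fn_def a_def)
    then show ?case by (rule cs_close_triangle[OF _ Suc]) simp
  qed (simp add: cs_close_def)
  have cau: "uniformly_Cauchy_on ?K (\<lambda>m. iter_pd ?K l (fn m))" if l: "set l \<subseteq> Basis" "length l \<le> s" for l
    unfolding uniformly_Cauchy_on_def
  proof (intro allI impI)
    fix e :: real assume e: "e > 0"
    obtain N where N: "\<And>m p. m \<ge> N \<Longrightarrow> norm (\<Sum>i\<in>{m..<p}. a i) < e / 2"
      using summ[unfolded summable_Cauchy] e by (metis half_gt_zero)
    have d: "\<bar>iter_pd ?K l (fn m) x - iter_pd ?K l (fn N) x\<bar> < e / 2" if "m \<ge> N" "x \<in> ?K" for m x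
    proof -
      have "\<bar>iter_pd ?K l (fn (N + (m - N))) x - iter_pd ?K l (fn N) x\<bar> \<le> (\<Sum>i<m - N. a (N + i))"
        using tele[of N "m - N"] l that(2) unfolding cs_close_def by blast
      also have "(\<Sum>i<m - N. a (N + i)) = (\<Sum>i\<in>{N..<m}. a i)"
        using that(1) sum.shift_bounds_nat_ivl[of a 0 N "m - N"] by (simp add: atLeast0LessThan add.commute)
      also have "\<dots> < e / 2" using N[of N m] by simp
      finally show ?thesis using that(1) by simp
    qed
    show "\<exists>M. \<forall>x\<in>?K. \<forall>m\<ge>M. \<forall>n\<ge>M. dist (iter_pd ?K l (fn m) x) (iter_pd ?K l (fn n) x) < e"
    proof (intro exI[of _ N] ballI allI impI)
      fix x m p assume "x \<in> ?K" "N \<le> m" "N \<le> p"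
      then show "dist (iter_pd ?K l (fn m) x) (iter_pd ?K l (fn p) x) < e"
        using d[of m x] d[of p x] unfolding dist_real_def by linarith
    qed
  qed
  have fn: "Cs_on s ?K (fn m)" for m unfolding fn_def by (rule taylor_Cs_on[OF K])
  have FC: "Cs_on s ?K F" using F by (simp add: Cs_space_def)
  obtain G where G: "uniform_limit ?K (\<lambda>m. iter_pd ?K [] (fn m)) G sequentially"
    using Cauchy_uniformly_convergent[OF cau[of "[]"]] by (auto simp: uniformly_convergent_on_def)
  then have G: "uniform_limit ?K fn G sequentially" by simp
  have contfn: "continuous_on ?K (fn m)" for m
    using fn[of m] unfolding Cs_on_def by (metis iter_pd.simps(1) empty_subsetI list.set(1) list.size(3) zero_le)
  have contF: "continuous_on ?K F"
    using FC unfolding Cs_on_def by (metis iter_pd.simps(1) empty_subsetI list.set(1) list.size(3) zero_le)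
  have contG: "continuous_on ?K G"
    by (rule uniform_limit_theorem[OF _ G]) (use contfn in auto)
  have clY: "closure Y0 = ?K" using Y0 closure_minimal[OF Y0(1) closed_cball] by blast
  have "G y - F y = 0" if "y \<in> ?K" for y
  proof (rule continuous_constant_on_closure[of Y0 "\<lambda>y. G y - F y"])
    show "continuous_on (closure Y0) (\<lambda>y. G y - F y)" unfolding clY by (intro continuous_intros contG contF)
    fix x assume x: "x \<in> Y0"
    have "(\<lambda>m. fn m x) \<longlonglongrightarrow> G x" using tendsto_uniform_limitI[OF G] x Y0 by blast
    moreover have "(\<lambda>m. fn m x) \<longlonglongrightarrow> F x"
      unfolding fn_def using LIMSEQ_ignore_initial_segment[OF pw[OF x], of n] by (simp add: add.commute)
    ultimately show "G x - F x = 0" using LIMSEQ_unique by fastforce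
  qed (use that clY in auto)
  then have lim: "(\<lambda>m. fn m y) \<longlonglongrightarrow> F y" if "y \<in> ?K" for y
    using tendsto_uniform_limitI[OF G that] that by auto
  show ?thesis
    unfolding cs_close_def
  proof (intro allI impI)
    fix l :: "'a list" and y :: 'a assume l: "set l \<subseteq> Basis" "length l \<le> s" and y: "y \<in> ?K"
    have "(\<lambda>m. iter_pd ?K l (fn m) y) \<longlonglongrightarrow> iter_pd ?K l F y"
      by (rule iter_pd_limit[OF K FC fn lim cau l y])
    then have "(\<lambda>m. \<bar>iter_pd ?K l (fn m) y - iter_pd ?K l (fn 0) y\<bar>) \<longlonglongrightarrow> \<bar>iter_pd ?K l F y - iter_pd ?K l (fn 0) y\<bar>"
      by (intro tendsto_intros)
    moreover have "\<bar>iter_pd ?K l (fn m) y - iter_pd ?K l (fn 0) y\<bar> \<le> \<epsilon>" for m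
    proof -
      have "\<bar>iter_pd ?K l (fn (0 + m)) y - iter_pd ?K l (fn 0) y\<bar> \<le> (\<Sum>i<m. a (0 + i))"
        using tele[of 0 m] l y unfolding cs_close_def by blast
      then show ?thesis using S[of m] by (simp add: a_def)
    qed
    ultimately show "\<bar>iter_pd ?K l F y - iter_pd ?K l (taylor n F) y\<bar> \<le> \<epsilon>"
      using LIMSEQ_le_const2[of _ _ \<epsilon>] by (fastforce simp: fn_def)
  qed
qed

text \<open>The degree n is found before the law, so one n serves the limit field and all the
  trigonometric sums. The good event is cut out by the series of increments and a null set, which
  settles its measurability without examining the C^s distance.\<close>

lemma interpolation_tail:
  assumes W: "W > 1" and \<epsilon>: "\<epsilon> > 0"
  obtains n where "\<And>M :: ('a::euclidean_space \<Rightarrow> real) measure. spectral_bound s W M \<Longrightarrow>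
    \<exists>G\<in>sets M. measure M (space M - G) \<le> \<epsilon> \<and> (\<forall>F\<in>G. cs_close s W F (taylor n F) \<epsilon>)"
proof -
  obtain T where T: "T > 0" "\<And>(M :: ('a \<Rightarrow> real) measure) n. spectral_bound s W M \<Longrightarrow>
    (\<integral>\<^sup>+F. ennreal (incr_size s W n F) \<partial>M) \<le> ennreal (T * (1 / 2) ^ n)"
    using incr_size_mean[OF W] by blast
  obtain c where c: "c > 0" "\<And>(M :: ('a \<Rightarrow> real) measure) n y. spectral_bound s W M \<Longrightarrow> y \<in> cball 0 W \<Longrightarrow>
    (\<lambda>F. taylor n F y - F y) \<in> borel_measurable M \<and> (\<integral>\<^sup>+F. ennreal \<bar>taylor n F y - F y\<bar> \<partial>M) \<le> ennreal (c * (1 / 2) ^ n)"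
    using taylor_pointwise_mean[OF W] by blast
  obtain Y0 :: "'a set" where Y0: "countable Y0" "Y0 \<subseteq> cball 0 W" "cball 0 W \<subseteq> closure Y0"
    by (rule separable)
  have geo: "(\<lambda>i. C * (1 / 2) ^ (n + i)) sums (2 * C * (1 / 2) ^ n)" for C :: real and n
    using sums_mult[OF geometric_sums[of "1 / 2 :: real"], of "C * (1 / 2) ^ n"] by (simp add: power_add mult_ac)
  \<comment> \<open>The quantity 2 T 2^-n bounds the mean of the tail series from n on. Below
    \<epsilon> * \<epsilon>, Markov's inequality at level \<epsilon> leaves an exceptional
    probability of at most \<epsilon>.\<close>
  have "(\<lambda>n. 2 * T * (1 / 2) ^ n) \<longlonglongrightarrow> 2 * T * 0"
    by (intro tendsto_intros LIMSEQ_realpow_zero) auto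
  then have "\<forall>\<^sub>F n in sequentially. 2 * T * (1 / 2) ^ n < \<epsilon> * \<epsilon>"
    using \<epsilon> by (intro order_tendstoD(2)) auto
  then obtain n where n: "2 * T * (1 / 2) ^ n < \<epsilon> * \<epsilon>" by (auto simp: eventually_sequentially)
  show ?thesis
  proof (rule that)
    fix M :: "('a \<Rightarrow> real) measure" assume M: "spectral_bound s W M"
    then have sM: "sets M = sets (cs_borel s W)" by (simp add: spectral_bound_def)
    interpret prob_space M using M by (simp add: spectral_bound_def)
    have spM: "space M = Cs_space s W" using sets_eq_imp_space_eq[OF sM] by simp
    define Z where "Z F = (\<Sum>i. ennreal (incr_size s W (n + i) F))" for F :: "'a \<Rightarrow> real"
    have [measurable]: "(\<lambda>F. incr_size s W m F) \<in> borel_measurable M" for m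
      by (rule incr_size_measurable[OF W sM])
    have [measurable]: "Z \<in> borel_measurable M" unfolding Z_def by measurable
    have EZ: "(\<integral>\<^sup>+F. Z F \<partial>M) \<le> ennreal (\<epsilon> * \<epsilon>)"
    proof -
      have "(\<integral>\<^sup>+F. Z F \<partial>M) = (\<Sum>i. \<integral>\<^sup>+F. ennreal (incr_size s W (n + i) F) \<partial>M)"
        unfolding Z_def by (intro nn_integral_suminf) measurable
      also have "\<dots> \<le> (\<Sum>i. ennreal (T * (1 / 2) ^ (n + i)))"
        by (intro suminf_le T(2)[OF M]) auto
      also have "\<dots> = ennreal (2 * T * (1 / 2) ^ n)" using T geo[of T n] by (intro suminf_ennreal_eq) auto
      also have "\<dots> \<le> ennreal (\<epsilon> * \<epsilon>)" using n by (intro ennreal_leI) auto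
      finally show ?thesis .
    qed
    define B where "B = {F \<in> space M. 1 \<le> ennreal (1 / \<epsilon>) * Z F}"
    have B: "B \<in> sets M" unfolding B_def by measurable
    have EB: "emeasure M B \<le> ennreal \<epsilon>"
    proof -
      have "emeasure M B \<le> ennreal (1 / \<epsilon>) * (\<integral>\<^sup>+F. Z F * indicator (space M) F \<partial>M)"
        unfolding B_def by (rule nn_integral_Markov_inequality) auto
      also have "(\<integral>\<^sup>+F. Z F * indicator (space M) F \<partial>M) = (\<integral>\<^sup>+F. Z F \<partial>M)"
        by (intro nn_integral_cong) (simp add: indicator_def)
      also have "ennreal (1 / \<epsilon>) * \<dots> \<le> ennreal (1 / \<epsilon>) * ennreal (\<epsilon> * \<epsilon>)" by (intro mult_left_mono EZ) auto
      also have "\<dots> = ennreal \<epsilon>" using \<epsilon> by (simp add: ennreal_mult'[symmetric])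
      finally show ?thesis .
    qed
    \<comment> \<open>Only a countable dense set is treated, so the exceptional null sets can be
      united. At each point the mean errors are summable, so the errors themselves are almost surely
      summable and tend to 0.\<close>
    have "AE F in M. \<forall>y\<in>Y0. (\<lambda>n. taylor n F y) \<longlonglongrightarrow> F y"
      unfolding AE_ball_countable[OF Y0(1)]
    proof
      fix y assume "y \<in> Y0"
      then have y: "y \<in> cball 0 W" using Y0 by blast
      have [measurable]: "(\<lambda>F. taylor n F y - F y) \<in> borel_measurable M" for n using c(2)[OF M y] by blast
      have "(\<integral>\<^sup>+F. (\<Sum>n. ennreal \<bar>taylor n F y - F y\<bar>) \<partial>M) = (\<Sum>n. \<integral>\<^sup>+F. ennreal \<bar>taylor n F y - F y\<bar> \<partial>M)"
        by (intro nn_integral_suminf) measurable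
      also have "\<dots> \<le> (\<Sum>n. ennreal (c * (1 / 2) ^ (0 + n)))"
        using c(2)[OF M y] by (intro suminf_le) auto
      also have "\<dots> = ennreal (2 * c * (1 / 2) ^ 0)" using c(1) geo[of c 0] by (intro suminf_ennreal_eq) auto
      finally have "(\<integral>\<^sup>+F. (\<Sum>n. ennreal \<bar>taylor n F y - F y\<bar>) \<partial>M) \<noteq> \<infinity>" by (auto simp: top_unique)
      then have "AE F in M. (\<Sum>n. ennreal \<bar>taylor n F y - F y\<bar>) \<noteq> \<infinity>"
        by (intro nn_integral_PInf_AE) measurable
      then show "AE F in M. (\<lambda>n. taylor n F y) \<longlonglongrightarrow> F y"
      proof eventually_elim
        case (elim F)
        then have "summable (\<lambda>n. \<bar>taylor n F y - F y\<bar>)" by (intro summable_suminf_not_top) auto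
        then have "(\<lambda>n. \<bar>taylor n F y - F y\<bar>) \<longlonglongrightarrow> 0" by (rule summable_LIMSEQ_zero)
        then show ?case by (simp add: tendsto_rabs_zero_iff LIM_zero_iff)
      qed
    qed
    then obtain N where N': "{F \<in> space M. \<not> (\<forall>y\<in>Y0. (\<lambda>n. taylor n F y) \<longlonglongrightarrow> F y)} \<subseteq> N"
      "emeasure M N = 0" "N \<in> sets M" by (rule AE_E)
    then have N: "\<And>F. F \<in> space M - N \<Longrightarrow> \<forall>y\<in>Y0. (\<lambda>n. taylor n F y) \<longlonglongrightarrow> F y" "N \<in> null_sets M"
      by blast+
    define G where "G = space M - (B \<union> N)"
    show "\<exists>G\<in>sets M. measure M (space M - G) \<le> \<epsilon> \<and> (\<forall>F\<in>G. cs_close s W F (taylor n F) \<epsilon>)"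
    proof (intro bexI[of _ G] conjI ballI)
      show "G \<in> sets M" unfolding G_def using B N(2) by auto
      have "space M - G \<subseteq> B \<union> N" unfolding G_def by blast
      then have "emeasure M (space M - G) \<le> emeasure M (B \<union> N)" using B N(2) by (intro emeasure_mono) auto
      also have "\<dots> = emeasure M B" using B N(2) by (rule emeasure_Un_null_set)
      also note EB
      finally show "measure M (space M - G) \<le> \<epsilon>" using \<epsilon> by (simp add: emeasure_eq_measure)
      fix F assume F: "F \<in> G"
      have FM: "F \<in> space M" "F \<notin> B" "F \<in> space M - N" using F by (auto simp: G_def)
      have ZF: "ennreal (1 / \<epsilon>) * Z F < 1" using FM by (auto simp: B_def not_le)
      have "(\<Sum>i<m. incr_size s W (n + i) F) \<le> \<epsilon>" for m
      proof -
        have S0: "0 \<le> (\<Sum>i<m. incr_size s W (n + i) F)" using W by (intro sum_nonneg incr_size_nonneg) auto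
        have "ennreal (\<Sum>i<m. incr_size s W (n + i) F) = (\<Sum>i<m. ennreal (incr_size s W (n + i) F))"
          using W by (simp add: incr_size_nonneg sum_ennreal)
        also have "\<dots> \<le> Z F" unfolding Z_def by (intro sum_le_suminf) auto
        finally have "ennreal (1 / \<epsilon>) * ennreal (\<Sum>i<m. incr_size s W (n + i) F) \<le> ennreal (1 / \<epsilon>) * Z F"
          by (intro mult_left_mono) auto
        also note ZF
        finally have "ennreal (1 / \<epsilon> * (\<Sum>i<m. incr_size s W (n + i) F)) < ennreal 1"
          using \<epsilon> S0 by (subst ennreal_mult) auto
        then have "1 / \<epsilon> * (\<Sum>i<m. incr_size s W (n + i) F) < 1"
          using \<epsilon> S0 by (subst (asm) ennreal_less_iff) auto
        then show ?thesis using \<epsilon> by (simp add: field_simps)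
      qed
      then show "cs_close s W F (taylor n F) \<epsilon>"
        using FM spM N(1)[OF FM(3)] by (intro taylor_tail[OF W _ Y0(2,3)]) auto
    qed
  qed
qed

section \<open>The Gaussian field\<close>

lemma centred_normal_eq_distr:
  assumes "v > 0"
  shows "centred_normal v = distr std_normal_distribution borel (\<lambda>x. sqrt v * x)"
proof -
  interpret real_distribution std_normal_distribution by (rule real_dist_normal_dist)
  have "distr std_normal_distribution lborel (\<lambda>x. x) = std_normal_distribution"
    by (intro distr_id2) simp
  then have "distributed std_normal_distribution lborel (\<lambda>x. x) (normal_density 0 1)"
    by (simp add: distributed_def)
  from normal_density_affine[OF this, of "sqrt v" 0] assms
  have "distributed std_normal_distribution lborel (\<lambda>x. sqrt v * x) (normal_density 0 (sqrt v))" by simp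
  then have "distr std_normal_distribution lborel (\<lambda>x. sqrt v * x) = density lborel (normal_density 0 (sqrt v))"
    by (simp add: distributed_def)
  moreover have "distr std_normal_distribution lborel (\<lambda>x. sqrt v * x) = distr std_normal_distribution borel (\<lambda>x. sqrt v * x)"
    by (intro distr_cong) auto
  ultimately show ?thesis using assms by (simp add: centred_normal_def)
qed

lemma centred_normal_char:
  assumes "v \<ge> 0"
  shows "(\<integral>x. iexp x \<partial>centred_normal v) = exp (- v / 2)"
proof (cases "v = 0")
  case True
  have "(\<integral>x. iexp x \<partial>return borel (0::real)) = iexp 0" by (intro integral_return) auto
  then show ?thesis using True by (simp add: centred_normal_def)
next
  case False
  then have v: "v > 0" using assms by simp
  have "(\<integral>x. iexp x \<partial>centred_normal v) = char std_normal_distribution (sqrt v)"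
    unfolding centred_normal_eq_distr[OF v] char_def by (subst integral_distr) auto
  then show ?thesis using assms by (simp add: char_std_normal_distribution)
qed

lemma centred_normal_second_moment:
  assumes "v \<ge> 0"
  shows "(\<integral>\<^sup>+x. ennreal (x\<^sup>2) \<partial>centred_normal v) = ennreal v"
proof (cases "v = 0")
  case True
  then show ?thesis by (simp add: centred_normal_def nn_integral_return)
next
  case False
  then have v: "v > 0" using assms by simp
  have "(\<integral>\<^sup>+x. ennreal (x\<^sup>2) \<partial>centred_normal v) = (\<integral>\<^sup>+x. ennreal ((sqrt v * x)\<^sup>2) \<partial>std_normal_distribution)"
    unfolding centred_normal_eq_distr[OF v] by (subst nn_integral_distr) auto
  also have "\<dots> = (\<integral>\<^sup>+x. ennreal (v * x ^ (2 * 1)) \<partial>std_normal_distribution)"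
    using v by (simp add: power_mult_distrib)
  also have "\<dots> = ennreal (\<integral>x. v * x ^ (2 * 1) \<partial>std_normal_distribution)"
    using v std_normal_distribution_even_moments(2)[of 1] by (intro nn_integral_eq_integral) auto
  also have "(\<integral>x. v * x ^ (2 * 1) \<partial>std_normal_distribution) = v"
    using std_normal_distribution_even_moments(1)[of 1] by simp
  finally show ?thesis .
qed

abbreviation field_char :: "('a::euclidean_space \<Rightarrow> real) measure \<Rightarrow> (real \<times> 'a) list \<Rightarrow> complex" where
  "field_char M L \<equiv> \<integral>F. iexp (lin_comb L F) \<partial>M"

abbreviation symbol_var :: "'a measure \<Rightarrow> (real \<times> 'a::euclidean_space) list \<Rightarrow> real" where
  "symbol_var \<mu> L \<equiv> \<integral>x. (cmod (symbol L x))\<^sup>2 \<partial>\<mu>"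

lemma lin_comb_nth: "lin_comb L F = (\<Sum>i<length (map snd L). (map fst L) ! i *\<^sub>R F ((map snd L) ! i))"
  by (simp add: lin_comb_def sum_list_sum_nth atLeast0LessThan case_prod_beta)

lemma lin_comb_cnj: "cnj (lin_comb L g) = lin_comb L (\<lambda>y. cnj (g y))"
  by (induction L) auto

lemma lin_comb_Re: "Re (lin_comb L g) = lin_comb L (\<lambda>y. Re (g y))"
  by (induction L) auto

lemma lin_comb_cong: "(\<And>y. y \<in> snd ` set L \<Longrightarrow> f y = g y) \<Longrightarrow> lin_comb L f = lin_comb L g"
  by (induction L) auto

lemma lin_comb_sum_right:
  fixes g :: "'i \<Rightarrow> 'a \<Rightarrow> complex"
  shows "lin_comb L (\<lambda>y. \<Sum>i\<in>A. c i * g i y) = (\<Sum>i\<in>A. c i * lin_comb L (g i))"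
  by (induction L) (auto simp: sum.distrib distrib_left scaleR_sum_right)

lemma symbol_bounded:
  fixes L :: "(real \<times> 'a::euclidean_space) list"
  obtains c where "c > 0" "\<And>x. cmod (symbol L x) \<le> c"
proof -
  have "cmod (symbol L x) \<le> (\<Sum>(c, y)\<leftarrow>L. \<bar>c\<bar>)" for x
  proof (induction L)
    case (Cons p L)
    then show ?case
      using norm_triangle_ineq[of "fst p *\<^sub>R ee (x \<bullet> snd p)" "symbol L x"]
      by (cases p) auto
  qed simp
  moreover have "(\<Sum>(c, y)\<leftarrow>L. \<bar>c\<bar>) < (\<Sum>(c, y)\<leftarrow>L. \<bar>c\<bar>) + 1" "(\<Sum>(c, y)\<leftarrow>L. \<bar>c\<bar>) \<ge> 0"
    by (auto intro!: sum_list_nonneg)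
  ultimately show ?thesis by (intro that[of "(\<Sum>(c, y)\<leftarrow>L. \<bar>c\<bar>) + 1"]) (auto intro: order.trans add_increasing2)
qed

lemma continuous_on_symbol: "continuous_on A (\<lambda>x. symbol L x)"
  by (induction L) (auto intro!: continuous_intros)

context
  fixes \<mu> :: "'a::euclidean_space measure" and P :: "('a \<Rightarrow> real) measure" and s :: nat and W :: real
  assumes mu: "prob_space \<mu>" "sets \<mu> = sets borel" "emeasure \<mu> (sphere 0 1) = 1"
    and P: "gaussian_field_law s W \<mu> P" and W: "W > 1"
begin

lemma symbol_measurable: "(\<lambda>x. symbol L x) \<in> borel_measurable \<mu>"
  using borel_measurable_continuous_onI[OF continuous_on_symbol] measurable_cong_sets[OF mu(2) refl] by blast

text \<open>Spectral isometry: the point evaluation at y corresponds to the character of y in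
  L^2(\<mu>), so the covariance form of a functional is the squared L^2 norm of its symbol.\<close>

lemma symbol_variance:
  "Re (\<Sum>i<length L. \<Sum>j<length L. complex_of_real (fst (L ! i) * fst (L ! j)) * cov_kernel \<mu> (snd (L ! i)) (snd (L ! j)))
    = symbol_var \<mu> L"
proof -
  interpret prob_space \<mu> by (rule mu)
  have int: "integrable \<mu> (\<lambda>l. ee (v \<bullet> l))" for v :: 'a
  proof (rule integrable_const_bound[where B=1])
    show "(\<lambda>l. ee (v \<bullet> l)) \<in> borel_measurable \<mu>"
      using ee_inner_measurable measurable_cong_sets[OF mu(2) refl] by blast
  qed auto
  have sq: "complex_of_real ((cmod (symbol L x))\<^sup>2) =
     (\<Sum>i<length L. \<Sum>j<length L. complex_of_real (fst (L ! i) * fst (L ! j)) * ee ((snd (L ! i) - snd (L ! j)) \<bullet> x))" for x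
  proof -
    have Z: "symbol L x = (\<Sum>i<length L. complex_of_real (fst (L ! i)) * ee (snd (L ! i) \<bullet> x))"
      by (simp add: lin_comb_nth scaleR_conv_of_real inner_commute)
    show ?thesis
      unfolding complex_norm_square Z cnj_sum sum_product inner_diff_left ee_diff
      by (simp add: cnj_ee mult_ac)
  qed
  have "complex_of_real (symbol_var \<mu> L)
     = (\<integral>x. (\<Sum>i<length L. \<Sum>j<length L. complex_of_real (fst (L ! i) * fst (L ! j)) * ee ((snd (L ! i) - snd (L ! j)) \<bullet> x)) \<partial>\<mu>)"
    unfolding sq[symmetric] by (rule integral_complex_of_real[symmetric])
  also have "\<dots> = (\<Sum>i<length L. \<Sum>j<length L. complex_of_real (fst (L ! i) * fst (L ! j)) * cov_kernel \<mu> (snd (L ! i)) (snd (L ! j)))"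
    unfolding cov_kernel_def
    by (subst Bochner_Integration.integral_sum, intro Bochner_Integration.integrable_sum integrable_mult_right int,
        intro sum.cong refl, subst Bochner_Integration.integral_sum, intro integrable_mult_right int,
        intro sum.cong refl integral_mult_right_zero)
  finally show ?thesis by (metis Re_complex_of_real)
qed

lemma gaussian_lin_comb:
  assumes "snd ` set L \<subseteq> cball 0 W"
  shows "distr P borel (lin_comb L) = centred_normal (symbol_var \<mu> L)"
proof -
  have "distr P borel (\<lambda>F. \<Sum>i<length (map snd L). map fst L ! i * F (map snd L ! i)) =
     centred_normal (Re (\<Sum>i<length (map snd L). \<Sum>j<length (map snd L).
        complex_of_real (map fst L ! i * map fst L ! j) * cov_kernel \<mu> (map snd L ! i) (map snd L ! j)))"
    using P assms unfolding gaussian_field_law_def by (elim conjE allE[of _ "map snd L"] allE[of _ "map fst L"]) auto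
  moreover have "(\<lambda>F. \<Sum>i<length (map snd L). map fst L ! i * F (map snd L ! i)) = lin_comb L"
    by (auto simp: lin_comb_nth fun_eq_iff)
  moreover have "(\<Sum>i<length (map snd L). \<Sum>j<length (map snd L).
        complex_of_real (map fst L ! i * map fst L ! j) * cov_kernel \<mu> (map snd L ! i) (map snd L ! j))
     = (\<Sum>i<length L. \<Sum>j<length L. complex_of_real (fst (L ! i) * fst (L ! j)) * cov_kernel \<mu> (snd (L ! i)) (snd (L ! j)))"
    by (intro sum.cong) auto
  ultimately show ?thesis by (simp only: symbol_variance)
qed

lemma P_prob: "prob_space P" and P_sets: "sets P = sets (cs_borel s W)"
  using P by (auto simp: gaussian_field_law_def)

lemma P_measurable: "snd ` set L \<subseteq> cball 0 W \<Longrightarrow> lin_comb L \<in> borel_measurable P"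
  using lin_comb_measurable[OF _ _ P_sets, of L] W by simp

lemma P_char:
  assumes "snd ` set L \<subseteq> cball 0 W"
  shows "field_char P L = exp (- symbol_var \<mu> L / 2)"
proof -
  have "field_char P L = (\<integral>x. iexp x \<partial>distr P borel (lin_comb L))"
    using P_measurable[OF assms] by (subst integral_distr) auto
  then show ?thesis unfolding gaussian_lin_comb[OF assms] by (subst (asm) centred_normal_char) auto
qed

text \<open>Since \<mu> is carried by the sphere, the variance is at most c^2. The factor 4 in
  \<open>spectral_bound\<close> is slack for the trigonometric sums.\<close>

lemma P_spectral_bound: "spectral_bound s W P"
  unfolding spectral_bound_def
proof (intro conjI P_prob P_sets allI impI)
  fix L :: "(real \<times> 'a) list" and c
  assume L: "snd ` set L \<subseteq> cball 0 W" and c: "\<forall>x. norm x = 1 \<longrightarrow> cmod (symbol L x) \<le> c"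
  interpret prob_space \<mu> by (rule mu)
  let ?v = "symbol_var \<mu> L"
  have sph: "AE x in \<mu>. x \<in> sphere 0 1"
    using mu(3) by (intro AE_prob_1) (simp add: measure_def)
  have "?v \<le> (\<integral>x. c\<^sup>2 \<partial>\<mu>)"
  proof (rule integral_mono_AE)
    have bd: "AE x in \<mu>. (cmod (symbol L x))\<^sup>2 \<le> c\<^sup>2"
      using sph by eventually_elim (auto intro!: power_mono c[rule_format])
    then show "AE x in \<mu>. (cmod (symbol L x))\<^sup>2 \<le> c\<^sup>2" .
    show "integrable \<mu> (\<lambda>x. (cmod (symbol L x))\<^sup>2)"
      using bd symbol_measurable[of L] by (intro integrable_const_bound[where B="c\<^sup>2"]) auto
  qed simp
  then have v: "?v \<le> c\<^sup>2" by (simp add: prob_space)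
  have "(\<integral>\<^sup>+F. ennreal ((lin_comb L F)\<^sup>2) \<partial>P) = (\<integral>\<^sup>+x. ennreal (x\<^sup>2) \<partial>distr P borel (lin_comb L))"
    using P_measurable[OF L] by (subst nn_integral_distr) auto
  also have "\<dots> = ennreal ?v" unfolding gaussian_lin_comb[OF L] by (rule centred_normal_second_moment) simp
  also have "\<dots> \<le> ennreal (4 * c\<^sup>2)" using v by (intro ennreal_leI) (simp add: order.trans[OF v])
  finally show "(\<integral>\<^sup>+F. ennreal ((lin_comb L F)\<^sup>2) \<partial>P) \<le> ennreal (4 * c\<^sup>2)" .
qed

end

section \<open>The trigonometric sums\<close>

lemma ee_has_derivative:
  fixes v :: "'a::euclidean_space"
  shows "((\<lambda>y. ee (v \<bullet> y)) has_derivative (\<lambda>h. 2 * pi * \<i> * (v \<bullet> h) * ee (v \<bullet> y))) (at y within K)"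
proof -
  have "((\<lambda>y. \<i> * complex_of_real (2 * pi * (v \<bullet> y))) has_derivative (\<lambda>h. \<i> * complex_of_real (2 * pi * (v \<bullet> h)))) (at y within K)"
    by (intro has_derivative_mult_right has_derivative_of_real has_derivative_inner_right has_derivative_ident)
  from has_derivative_compose[OF this DERIV_exp[unfolded has_field_derivative_def]] show ?thesis
    unfolding ee_iexp by (simp add: mult_ac)
qed

definition wave_sum :: "'i set \<Rightarrow> ('i \<Rightarrow> 'a::euclidean_space) \<Rightarrow> ('i \<Rightarrow> complex) \<Rightarrow> 'a \<Rightarrow> real" where
  "wave_sum S r d y = Re (\<Sum>n\<in>S. d n * ee (r n \<bullet> y))"

lemma wave_sum_family:
  fixes r :: "'i \<Rightarrow> 'a::euclidean_space"
  assumes K: "convex K" "interior K \<noteq> {}" and f: "\<And>y. y \<in> K \<Longrightarrow> f y = wave_sum S r d y"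
  shows iter_pd_wave_sum: "set l \<subseteq> Basis \<Longrightarrow> y \<in> K \<Longrightarrow>
      iter_pd K l f y = wave_sum S r (\<lambda>n. d n * (\<Prod>b\<leftarrow>l. 2 * pi * \<i> * (r n \<bullet> b))) y"
    and wave_sum_Cs_on: "Cs_on s K f"
proof -
  let ?p = "\<lambda>l n. \<Prod>b\<leftarrow>l. 2 * pi * \<i> * complex_of_real (r n \<bullet> b)"
  let ?D = "\<lambda>l y h. Re (\<Sum>n\<in>S. (d n * ?p l n) * (2 * pi * \<i> * (r n \<bullet> h) * ee (r n \<bullet> y)))"
  have der: "(wave_sum S r (\<lambda>n. d n * ?p l n) has_derivative ?D l y) (at y within K)" for l y
    unfolding wave_sum_def
    by (intro has_derivative_Re has_derivative_sum has_derivative_mult_right ee_has_derivative)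
  have D: "?D l y i = wave_sum S r (\<lambda>n. d n * ?p (i # l) n) y" for l y i
    by (simp add: wave_sum_def mult_ac)
  note * = iter_pd_family[OF K, of f "\<lambda>l. wave_sum S r (\<lambda>n. d n * ?p l n)" _ ?D]
  have base: "f y = wave_sum S r (\<lambda>n. d n * ?p [] n) y" if "y \<in> K" for y
    using f[OF that] by simp
  show "set l \<subseteq> Basis \<Longrightarrow> y \<in> K \<Longrightarrow> iter_pd K l f y = wave_sum S r (\<lambda>n. d n * ?p l n) y"
    by (rule *(1)[where s="length l"]; (erule base | rule der | rule D | rule order_refl | assumption))
  show "Cs_on s K f"
    by (rule *(2); (erule base | rule der | rule D))
qed

lemma Re_square_le: "(Re z)\<^sup>2 \<le> (cmod z)\<^sup>2"
  by (simp add: cmod_power2)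

lemma Re_mult_real_left: "Re (complex_of_real c * z) = c * Re z"
  by simp

context
  fixes r :: "int \<Rightarrow> 'a::euclidean_space" and a :: "int \<Rightarrow> complex" and W :: real and s :: nat
  assumes r_unit: "\<forall>n\<ge>1. norm (r n) = 1" and r_indep: "rat_lin_indep r"
    and r_neg: "\<forall>n. n \<noteq> 0 \<longrightarrow> r (- n) = - r n"
    and a_unit: "\<forall>n. n \<noteq> 0 \<longrightarrow> cmod (a n) = 1"
    and a_neg: "\<forall>n. n \<noteq> 0 \<longrightarrow> a (- n) = cnj (a n)"
    and W: "W > 1"
begin

lemma sum_symmetric_range:
  fixes f :: "int \<Rightarrow> 'b::comm_monoid_add"
  shows "(\<Sum>n\<in>{- int N..int N} - {0}. f n) = (\<Sum>n\<in>{1..int N}. f n + f (- n))"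
proof -
  have "{- int N..int N} - {0} = {1..int N} \<union> uminus ` {1..int N}"
    unfolding image_uminus_atLeastAtMost by auto
  moreover have "sum f ({1..int N} \<union> uminus ` {1..int N}) = sum f {1..int N} + sum f (uminus ` {1..int N})"
    by (rule sum.union_disjoint) auto
  moreover have "sum f (uminus ` {1..int N}) = (\<Sum>n\<in>{1..int N}. f (- n))"
    by (subst sum.reindex) (auto simp: inj_on_def)
  ultimately show ?thesis by (simp add: sum.distrib)
qed

text \<open>The indices n and -n contribute conjugate terms, so the sum runs over positive n with
  doubled amplitude and real parts; independence of frequencies is available for these indices
  only.\<close>

definition amp :: "nat \<Rightarrow> int \<Rightarrow> complex" where
  "amp N n = complex_of_real (2 / sqrt (2 * real N)) * a n"

lemma Fx_wave_sum:
  assumes y: "y \<in> cball 0 W"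
  shows "Fx a r N W x y = wave_sum {1..int N} r (\<lambda>n. amp N n * ee (r n \<bullet> x)) y"
proof -
  have pair: "a n * ee (r n \<bullet> (x + y)) + a (- n) * ee (r (- n) \<bullet> (x + y)) = complex_of_real (2 * Re (a n * ee (r n \<bullet> (x + y))))"
    if "n \<in> {1..int N}" for n
  proof -
    have "a (- n) * ee (r (- n) \<bullet> (x + y)) = cnj (a n * ee (r n \<bullet> (x + y)))"
      using that r_neg[rule_format, of n] a_neg[rule_format, of n] by (simp add: cnj_ee)
    then show ?thesis by (simp only: complex_add_cnj)
  qed
  have "fN a r N (x + y) = complex_of_real (1 / sqrt (2 * real N)) * (\<Sum>n\<in>{1..int N}. complex_of_real (2 * Re (a n * ee (r n \<bullet> (x + y)))))"
    unfolding fN_def sum_symmetric_range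
    by (rule arg_cong[where f="\<lambda>t. complex_of_real (1 / sqrt (2 * real N)) * t"], rule sum.cong[OF refl pair])
  also have "\<dots> = complex_of_real (1 / sqrt (2 * real N) * (\<Sum>n\<in>{1..int N}. 2 * Re (a n * ee (r n \<bullet> (x + y)))))"
    by (simp only: of_real_mult of_real_sum)
  finally have "Fx a r N W x y = 1 / sqrt (2 * real N) * (\<Sum>n\<in>{1..int N}. 2 * Re (a n * ee (r n \<bullet> (x + y))))"
    using y by (simp only: Fx_def if_True Re_complex_of_real)
  also have "\<dots> = (\<Sum>n\<in>{1..int N}. 2 / sqrt (2 * real N) * Re (a n * ee (r n \<bullet> (x + y))))"
    unfolding sum_distrib_left by (intro sum.cong) auto
  also have "\<dots> = wave_sum {1..int N} r (\<lambda>n. amp N n * ee (r n \<bullet> x)) y"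
    unfolding wave_sum_def Re_sum
  proof (intro sum.cong refl)
    fix n
    have "amp N n * ee (r n \<bullet> x) * ee (r n \<bullet> y) = complex_of_real (2 / sqrt (2 * real N)) * (a n * ee (r n \<bullet> (x + y)))"
      by (simp only: amp_def inner_add_right ee_add mult.assoc)
    then show "2 / sqrt (2 * real N) * Re (a n * ee (r n \<bullet> (x + y))) = Re (amp N n * ee (r n \<bullet> x) * ee (r n \<bullet> y))"
      by (simp only: Re_mult_real_left)
  qed
  finally show ?thesis .
qed

lemma Fx_Cs_space: "Fx a r N W x \<in> Cs_space s W"
proof -
  have "Cs_on s (cball 0 W) (Fx a r N W x)"
    by (rule wave_sum_Cs_on[OF _ _ Fx_wave_sum]) (use W in auto)
  then show ?thesis by (auto simp: Cs_space_def Fx_def)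
qed

text \<open>The centre enters only through the phases of finitely many waves, and up to s
  derivatives multiply a wave by at most (2 pi)^s. Continuity into C^s pulls open sets back to open
  sets, which is how the law becomes a Borel measure.\<close>

lemma Fx_continuous:
  assumes e: "e > 0"
  shows "\<exists>d>0. \<forall>x'. dist x' x < d \<longrightarrow> cs_norm s W (Fx a r N W x' - Fx a r N W x) < e"
proof -
  let ?K = "cball 0 W :: 'a set"
  have K: "convex ?K" "interior ?K \<noteq> {}" using W by auto
  define \<phi> where "\<phi> x' = (2 * pi) ^ s * (\<Sum>n\<in>{1..int N}. cmod (amp N n) * cmod (ee (r n \<bullet> x') - ee (r n \<bullet> x)))" for x'
  have "continuous_on UNIV \<phi>" unfolding \<phi>_def by (intro continuous_intros)
  then have "isCont \<phi> x" by (simp add: continuous_on_eq_continuous_at)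
  moreover have "\<phi> x = 0" by (simp add: \<phi>_def)
  ultimately obtain d where d: "d > 0" "\<And>x'. dist x' x < d \<Longrightarrow> \<bar>\<phi> x'\<bar> < e"
    using e unfolding continuous_at_eps_delta dist_real_def by (metis diff_zero)
  have "cs_norm s W (Fx a r N W x' - Fx a r N W x) \<le> \<phi> x'" for x'
  proof (rule cs_norm_leI)
    fix l :: "'a list" and y assume l: "set l \<subseteq> Basis" "length l \<le> s" and y: "y \<in> ?K"
    let ?p = "\<lambda>n. \<Prod>b\<leftarrow>l. 2 * pi * \<i> * complex_of_real (r n \<bullet> b)"
    have p: "cmod (?p n) \<le> (2 * pi) ^ s" if n: "n \<in> {1..int N}" for n
    proof -
      have "cmod (?p n) \<le> (2 * pi) ^ length l"
        using l(1)
      proof (induction l)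
        case (Cons b l)
        have "\<bar>r n \<bullet> b\<bar> \<le> 1" using Cons.prems Basis_le_norm[of b "r n"] r_unit n by auto
        then have "cmod (2 * pi * \<i> * complex_of_real (r n \<bullet> b)) \<le> 2 * pi" by (simp add: norm_mult)
        moreover have "cmod (\<Prod>b\<leftarrow>l. 2 * pi * \<i> * complex_of_real (r n \<bullet> b)) \<le> (2 * pi) ^ length l"
          using Cons by simp
        ultimately show ?case unfolding list.map prod_list.Cons norm_mult[of "_ * complex_of_real _"] list.size(4) 
          power_add power_one_right by (subst mult.commute) (intro mult_mono, auto)
      qed simp
      also have "\<dots> \<le> (2 * pi) ^ s" using l(2) pi_gt3 by (intro power_increasing) auto
      finally show ?thesis .
    qed
    have ip: "iter_pd ?K l (Fx a r N W x) y = wave_sum {1..int N} r (\<lambda>n. amp N n * ee (r n \<bullet> x) * ?p n) y" for x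
      by (rule iter_pd_wave_sum[OF K _ l(1) y]) (rule Fx_wave_sum)
    have "iter_pd ?K l (Fx a r N W x' - Fx a r N W x) y = iter_pd ?K l (Fx a r N W x') y - iter_pd ?K l (Fx a r N W x) y"
      using Fx_Cs_space by (intro iter_pd_diff[OF K _ _ l y]) (auto simp: Cs_space_def)
    also have "\<dots> = Re (\<Sum>n\<in>{1..int N}. (amp N n * (ee (r n \<bullet> x') - ee (r n \<bullet> x))) * ?p n * ee (r n \<bullet> y))"
      unfolding ip wave_sum_def
      by (simp only: minus_complex.sel(1)[symmetric] sum_subtractf[symmetric]) (simp only: right_diff_distrib left_diff_distrib)
    finally have "\<bar>iter_pd ?K l (Fx a r N W x' - Fx a r N W x) y\<bar> \<le> cmod (\<Sum>n\<in>{1..int N}. (amp N n * (ee (r n \<bullet> x') - ee (r n \<bullet> x))) * ?p n * ee (r n \<bullet> y))"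
      by (simp only: abs_Re_le_cmod)
    also have "\<dots> \<le> (\<Sum>n\<in>{1..int N}. (cmod (amp N n) * cmod (ee (r n \<bullet> x') - ee (r n \<bullet> x))) * (2 * pi) ^ s)"
    proof (rule order.trans[OF norm_sum sum_mono])
      fix n assume n: "n \<in> {1..int N}"
      have "(cmod (amp N n) * cmod (ee (r n \<bullet> x') - ee (r n \<bullet> x))) * cmod (?p n) \<le> (cmod (amp N n) * cmod (ee (r n \<bullet> x') - ee (r n \<bullet> x))) * (2 * pi) ^ s"
        by (intro mult_left_mono p n) auto
      then show "cmod ((amp N n * (ee (r n \<bullet> x') - ee (r n \<bullet> x))) * ?p n * ee (r n \<bullet> y)) \<le> (cmod (amp N n) * cmod (ee (r n \<bullet> x') - ee (r n \<bullet> x))) * (2 * pi) ^ s"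
        by (simp only: norm_mult norm_ee mult_1_right)
    qed
    also have "\<dots> = \<phi> x'" unfolding \<phi>_def by (subst mult.commute) (rule sum_distrib_right[symmetric])
    finally show "\<bar>iter_pd ?K l (Fx a r N W x' - Fx a r N W x) y\<bar> \<le> \<phi> x'" .
  qed (use W in auto)
  then have "cs_norm s W (Fx a r N W x' - Fx a r N W x) < e" if "dist x' x < d" for x'
    using d(2)[OF that] abs_ge_self[of "\<phi> x'"] by (meson le_less_trans)
  then show ?thesis using d(1) by blast
qed

lemma Fx_measurable: "Fx a r N W \<in> measurable borel (cs_borel s W)"
proof (rule measurable_sigma_sets[OF sets_cs_borel])
  show "{U :: ('a \<Rightarrow> real) set. cs_open s W U} \<subseteq> Pow (Cs_space s W)" by (auto simp: cs_open_def)
  show "Fx a r N W \<in> space borel \<rightarrow> Cs_space s W" using Fx_Cs_space by auto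
  fix U :: "('a \<Rightarrow> real) set" assume "U \<in> {U. cs_open s W U}"
  then have U: "\<And>f. f \<in> U \<Longrightarrow> \<exists>e>0. \<forall>g\<in>Cs_space s W. cs_norm s W (g - f) < e \<longrightarrow> g \<in> U"
    by (auto simp: cs_open_def)
  have "open (Fx a r N W -` U)"
    unfolding open_dist
  proof
    fix x assume "x \<in> Fx a r N W -` U"
    then obtain e where e: "e > 0" "\<And>g. g \<in> Cs_space s W \<Longrightarrow> cs_norm s W (g - Fx a r N W x) < e \<Longrightarrow> g \<in> U"
      using U by (metis vimageE)
    then obtain d where "d > 0" "\<And>x'. dist x' x < d \<Longrightarrow> cs_norm s W (Fx a r N W x' - Fx a r N W x) < e"
      using Fx_continuous[of e x N] by blast
    then show "\<exists>d>0. \<forall>x'. dist x' x < d \<longrightarrow> x' \<in> Fx a r N W -` U"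
      using e(2)[OF Fx_Cs_space] by (intro exI[of _ d]) auto
  qed
  then show "Fx a r N W -` U \<inter> space borel \<in> sets borel" by simp
qed

lemma Fx_measurable': "Fx a r N W \<in> measurable (volR R) (cs_borel s W)"
  using Fx_measurable measurable_cong_sets[of "volR R" borel "cs_borel s W" "cs_borel s W"] by simp

lemma Fx_law_prob: "R > 0 \<Longrightarrow> prob_space (Fx_law s W a r N R)"
  unfolding Fx_law_def by (intro prob_space.prob_space_distr prob_space_volR Fx_measurable')

lemma Fx_law_sets: "sets (Fx_law s W a r N R) = sets (cs_borel s W)"
  by (simp add: Fx_law_def)

section \<open>Functionals of the trigonometric sums as lacunary sums\<close>

lemma lin_comb_Fx:
  assumes L: "snd ` set L \<subseteq> cball 0 W"
  shows "lin_comb L (Fx a r N W x) = Re (\<Sum>n\<in>{1..int N}. (amp N n * symbol L (r n)) * ee (r n \<bullet> x))"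
proof -
  have "lin_comb L (Fx a r N W x) = lin_comb L (wave_sum {1..int N} r (\<lambda>n. amp N n * ee (r n \<bullet> x)))"
    using L by (intro lin_comb_cong Fx_wave_sum) auto
  also have "\<dots> = Re (\<Sum>n\<in>{1..int N}. amp N n * ee (r n \<bullet> x) * symbol L (r n))"
    unfolding wave_sum_def[abs_def] lin_comb_Re[symmetric] lin_comb_sum_right ..
  finally show ?thesis by (simp add: mult_ac)
qed

lemma r_int_indep:
  assumes "(\<Sum>n\<in>{1..int N}. of_int (\<kappa> n) *\<^sub>R r n) = 0" "n \<in> {1..int N}"
  shows "\<kappa> n = 0"
proof -
  have "(\<Sum>n\<in>{1..int N}. real_of_rat (of_int (\<kappa> n)) *\<^sub>R r n) = 0" using assms(1) by simp
  then have "\<forall>n\<in>{1..int N}. rat_of_int (\<kappa> n) = 0"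
    using r_indep[unfolded rat_lin_indep_def, rule_format, of "{1..int N}" "\<lambda>n. of_int (\<kappa> n)"] by auto
  then show ?thesis using assms(2) by auto
qed

lemma r_inj: "inj_on r {1..int N}"
  by (rule inj_on_int_indep) (use r_int_indep in auto)

lemma cmod_amp: "n \<in> {1..int N} \<Longrightarrow> cmod (amp N n) = 2 / sqrt (2 * real N)"
  using a_unit unfolding amp_def norm_mult norm_of_real by simp

text \<open>The N coefficients are at most 2 c / sqrt (2 N), so near-orthogonality bounds the mean
  square of the complex sum by 2 N * 2 c^2 / N = 4 c^2, and the real part is dominated by the
  modulus. The radius is fixed before L, as the approximation argument requires.\<close>

lemma Fx_law_spectral_bound:
  assumes "N > 0"
  shows "\<forall>\<^sub>F R in at_top. spectral_bound s W (Fx_law s W a r N R)"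
  using trig_poly_mean_square[OF finite_atLeastAtMost_int r_inj[of N]] eventually_gt_at_top[of 0]
proof eventually_elim
  case (elim R)
  show ?case
    unfolding spectral_bound_def
  proof (intro conjI Fx_law_prob Fx_law_sets elim(2) allI impI)
    fix L :: "(real \<times> 'a) list" and c
    assume L: "snd ` set L \<subseteq> cball 0 W" and c: "\<forall>x. norm x = 1 \<longrightarrow> cmod (symbol L x) \<le> c"
    let ?S = "{1..int N}"
    define b where "b n = amp N n * symbol L (r n)" for n
    define C where "C = 2 / sqrt (2 * real N) * c"
    have b: "cmod (b n) \<le> C" if "n \<in> ?S" for n
      unfolding b_def C_def norm_mult cmod_amp[OF that] using c r_unit that by (intro mult_left_mono) auto
    have "(\<integral>x. (cmod (\<Sum>n\<in>?S. b n * ee (r n \<bullet> x)))\<^sup>2 \<partial>volR R) \<le> 2 * card ?S * C\<^sup>2"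
      using elim(1) b by blast
    also have "\<dots> = 4 * c\<^sup>2" using assms by (simp add: C_def power_mult_distrib power_divide)
    finally have mean: "(\<integral>x. (cmod (\<Sum>n\<in>?S. b n * ee (r n \<bullet> x)))\<^sup>2 \<partial>volR R) \<le> 4 * c\<^sup>2" .
    have bound: "cmod (\<Sum>n\<in>?S. b n * ee (r n \<bullet> x)) \<le> (\<Sum>n\<in>?S. cmod (b n))" for x
      by (intro order.trans[OF norm_sum]) (simp add: norm_mult)
    have int: "integrable (volR R) (\<lambda>x. (cmod (\<Sum>n\<in>?S. b n * ee (r n \<bullet> x)))\<^sup>2)"
      by (rule integrable_volR[OF elim(2), where B="(\<Sum>n\<in>?S. cmod (b n))\<^sup>2"]) (use bound in \<open>auto intro!: power_mono\<close>)
    have "(\<integral>\<^sup>+F. ennreal ((lin_comb L F)\<^sup>2) \<partial>Fx_law s W a r N R) = (\<integral>\<^sup>+x. ennreal ((lin_comb L (Fx a r N W x))\<^sup>2) \<partial>volR R)"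
      unfolding Fx_law_def
      using lin_comb_measurable[OF _ L refl, of s] W by (intro nn_integral_distr Fx_measurable') auto
    also have "\<dots> \<le> (\<integral>\<^sup>+x. ennreal ((cmod (\<Sum>n\<in>?S. b n * ee (r n \<bullet> x)))\<^sup>2) \<partial>volR R)"
      unfolding lin_comb_Fx[OF L] b_def[symmetric]
      by (intro nn_integral_mono ennreal_leI Re_square_le)
    also have "\<dots> = ennreal (\<integral>x. (cmod (\<Sum>n\<in>?S. b n * ee (r n \<bullet> x)))\<^sup>2 \<partial>volR R)"
      by (rule nn_integral_eq_integral[OF int]) auto
    also have "\<dots> \<le> ennreal (4 * c\<^sup>2)" using mean by (rule ennreal_leI)
    finally show "(\<integral>\<^sup>+F. ennreal ((lin_comb L F)\<^sup>2) \<partial>Fx_law s W a r N R) \<le> ennreal (4 * c\<^sup>2)" .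
  qed
qed

end

section \<open>Comparison in the Levy-Prokhorov metric\<close>

text \<open>On good events both fields are near polynomials determined by finitely many
  coefficients, so comparing the laws of these coefficients suffices. The hypotheses are symmetric
  in M and M', so the other half of the metric follows by exchanging them.\<close>

lemma levy_prokhorov_one_sided:
  fixes W \<epsilon> :: real
  assumes W: "W > 1" and \<epsilon>: "\<epsilon> > 0"
  obtains \<L> :: "(real \<times> 'a::euclidean_space) list set" and \<eta> :: real
  where "finite \<L>" "\<eta> > 0" "\<And>L. L \<in> \<L> \<Longrightarrow> snd ` set L \<subseteq> cball 0 W"
    "\<And>(M :: ('a \<Rightarrow> real) measure) M' A. spectral_bound s W M \<Longrightarrow> spectral_bound s W M' \<Longrightarrow>
      (\<And>L. L \<in> \<L> \<Longrightarrow> cmod (field_char M L - field_char M' L) \<le> \<eta>) \<Longrightarrow>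
      A \<in> sets (cs_borel s W) \<Longrightarrow> measure M A \<le> measure M' (cs_enlarge s W A \<epsilon>) + \<epsilon>"
proof -
  \<comment> \<open>Three errors occur both in distance (two interpolations, one change of
    coefficients) and in probability (two exceptional events, one comparison of laws). Quarters
    leave room for the strict inequality in the enlargement.\<close>
  define \<epsilon>1 where "\<epsilon>1 = \<epsilon> / 4"
  have \<epsilon>1: "\<epsilon>1 > 0" using \<epsilon> by (simp add: \<epsilon>1_def)
  have W1: "W \<ge> 1" "W > 0" using W by auto
  obtain n where n: "\<And>M :: ('a \<Rightarrow> real) measure. spectral_bound s W M \<Longrightarrow>
    \<exists>G\<in>sets M. measure M (space M - G) \<le> \<epsilon>1 \<and> (\<forall>F\<in>G. cs_close s W F (taylor n F) \<epsilon>1)"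
    using interpolation_tail[OF W \<epsilon>1] by blast
  define J where "J = card (words n :: 'a list set)"
  \<comment> \<open>The words are numbered because \<open>joint_law_close\<close> asks for a
    countable index type, which lists of vectors do not form.\<close>
  obtain w :: "nat \<Rightarrow> 'a list" where w: "bij_betw w {0..<J} (words n)"
    unfolding J_def using ex_bij_betw_nat_finite[OF finite_words] by blast
  define I where "I = {0..<J}"
  have finI: "finite I" by (simp add: I_def)
  have wI: "w i \<in> words n" if "i \<in> I" for i using w that by (auto simp: I_def bij_betw_def)
  define V where "V i F = lin_comb (coef n (w i)) F" for i and F :: "'a \<Rightarrow> real"
  define C where "C = 4 * ((2 * pi) ^ n)\<^sup>2"
  define \<delta> where "\<delta> = \<epsilon>1 / (1 + (\<Sum>bs\<in>(words n :: 'a list set). weight s W (length bs)))"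
  have w0: "(\<Sum>bs\<in>(words n :: 'a list set). weight s W (length bs)) \<ge> 0"
    using W1 by (intro sum_nonneg weight_nonneg) auto
  have \<delta>: "\<delta> > 0" using \<epsilon>1 w0 by (simp add: \<delta>_def add_pos_nonneg)
  have \<delta>w: "(\<Sum>bs\<in>(words n :: 'a list set). \<delta> * weight s W (length bs)) \<le> \<epsilon>1"
  proof -
    let ?T = "\<Sum>bs\<in>(words n :: 'a list set). weight s W (length bs)"
    have "\<delta> * ?T \<le> \<delta> * (1 + ?T)" using \<delta> by (intro mult_left_mono) auto
    also have "\<dots> = \<epsilon>1"
    proof -
      have "1 + ?T \<noteq> 0" using w0 by linarith
      moreover have "\<epsilon>1 / T * T = \<epsilon>1" if "T \<noteq> 0" for T using that by simp
      ultimately show ?thesis unfolding \<delta>_def by blast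
    qed
    finally show ?thesis unfolding sum_distrib_left .
  qed
  have pts: "snd ` set (coef n (w i)) \<subseteq> cball 0 W" if "i \<in> I" for i
    by (rule coef_points[OF wI[OF that] W1(1)])
  have V2: "second_moments_le I C M V" if M: "spectral_bound s W M" for M
    unfolding second_moments_le_def
  proof (intro conjI ballI)
    show "prob_space M" using M by (simp add: spectral_bound_def)
    fix i assume i: "i \<in> I"
    show "V i \<in> borel_measurable M"
      unfolding V_def[abs_def] using lin_comb_measurable[OF W1(2) pts[OF i]] M by (auto simp: spectral_bound_def)
    have "cmod (symbol (coef n (w i)) x) \<le> (2 * pi) ^ n" if x: "norm x = 1" for x
    proof -
      have "cmod (symbol (coef n (w i)) x) \<le> (2 * pi) ^ length (w i)"
        by (rule coef_symbol_bound[OF wI[OF i] x])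
      also have "\<dots> \<le> (2 * pi) ^ n" using wI[OF i] pi_gt3 by (intro power_increasing) (auto simp: words_def)
      finally show ?thesis .
    qed
    then show "(\<integral>\<^sup>+F. ennreal ((V i F)\<^sup>2) \<partial>M) \<le> ennreal C"
      using M pts[OF i] unfolding V_def C_def spectral_bound_def by blast
  qed
  obtain \<Xi> :: "(nat \<Rightarrow> real) set" and \<eta> where \<Xi>: "finite \<Xi>" and \<eta>: "\<eta> > 0" and close:
    "\<And>(M :: ('a \<Rightarrow> real) measure) V (M' :: ('a \<Rightarrow> real) measure) V'. second_moments_le I C M V \<Longrightarrow> second_moments_le I C M' V' \<Longrightarrow>
      (\<And>\<xi>. \<xi> \<in> \<Xi> \<Longrightarrow> cmod (joint_char I M V \<xi> - joint_char I M' V' \<xi>) \<le> \<eta>) \<Longrightarrow> law_le I \<delta> \<epsilon>1 M V M' V'"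
    by (rule joint_law_close[OF finI \<epsilon>1 \<delta>, of C]) (simp add: C_def, blast)
  \<comment> \<open>A joint characteristic function of the coefficients is the characteristic
    function of one functional, obtained by concatenating the scaled coefficient lists.\<close>
  have "\<exists>L. (\<forall>g :: 'a \<Rightarrow> real. lin_comb L g = (\<Sum>i\<in>I. \<xi> i *\<^sub>R lin_comb (coef n (w i)) g)) \<and> snd ` set L \<subseteq> cball 0 W" for \<xi>
    using lin_comb_sum[OF finI, of \<xi> "\<lambda>i. coef n (w i)"] pts by (meson UN_least order.trans)
  then obtain Lc where Lc: "\<And>\<xi> g. lin_comb (Lc \<xi>) (g :: 'a \<Rightarrow> real) = (\<Sum>i\<in>I. \<xi> i *\<^sub>R lin_comb (coef n (w i)) g)"
    "\<And>\<xi>. snd ` set (Lc \<xi>) \<subseteq> cball 0 W" by metis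
  have jc: "joint_char I M V \<xi> = field_char M (Lc \<xi>)" for M \<xi>
    by (simp add: joint_char_def Lc V_def)
  show ?thesis
  proof (rule that[of "Lc ` \<Xi>" \<eta>])
    show "finite (Lc ` \<Xi>)" "\<eta> > 0" using \<Xi> \<eta> by auto
    show "snd ` set L \<subseteq> cball 0 W" if "L \<in> Lc ` \<Xi>" for L using that Lc(2) by auto
    fix M M' :: "('a \<Rightarrow> real) measure" and A :: "('a \<Rightarrow> real) set"
    assume sb: "spectral_bound s W M" "spectral_bound s W M'"
      and ch: "\<And>L. L \<in> Lc ` \<Xi> \<Longrightarrow> cmod (field_char M L - field_char M' L) \<le> \<eta>"
      and A: "A \<in> sets (cs_borel s W)"
    have M: "prob_space M" "prob_space M'" and sM: "sets M = sets (cs_borel s W)" and sM': "sets M' = sets (cs_borel s W)"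
      using sb by (auto simp: spectral_bound_def)
    interpret M: prob_space M by fact
    interpret M': prob_space M' by fact
    have sp: "space M = Cs_space s W" "space M' = Cs_space s W"
      using sets_eq_imp_space_eq[OF sM] sets_eq_imp_space_eq[OF sM'] by auto
    obtain G where G: "G \<in> sets M" "M.prob (space M - G) \<le> \<epsilon>1" "\<And>F. F \<in> G \<Longrightarrow> cs_close s W F (taylor n F) \<epsilon>1"
      using n[OF sb(1)] by blast
    obtain G' where G': "G' \<in> sets M'" "M'.prob (space M' - G') \<le> \<epsilon>1" "\<And>F. F \<in> G' \<Longrightarrow> cs_close s W F (taylor n F) \<epsilon>1"
      using n[OF sb(2)] by blast
    have AM: "A \<in> sets M" using A sM by simp
    have Asub: "A \<subseteq> Cs_space s W" using sets.sets_into_space[OF A] by simp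
    define E where "E = cs_enlarge s W A \<epsilon>"
    have E: "E \<in> sets M'" unfolding E_def sM' by (rule cs_open_sets[OF cs_enlarge_open[OF W1(2) Asub]])
    have "law_le I \<delta> \<epsilon>1 M V M' V"
      by (rule close[OF V2[OF sb(1)] V2[OF sb(2)]]) (use ch in \<open>auto simp: jc\<close>)
    note law = this[unfolded law_le_def]
    have "M.prob (A \<inter> G) \<le> M'.prob (E \<union> (space M' - G')) + \<epsilon>1"
    proof (intro law[THEN bspec, THEN bspec, THEN mp] ballI impI)
      show "A \<inter> G \<in> sets M" "E \<union> (space M' - G') \<in> sets M'" using AM G(1) G'(1) E by auto
      fix F F' assume F: "F \<in> A \<inter> G" and F': "F' \<in> space M'" and d: "\<forall>i\<in>I. \<bar>V i F - V i F'\<bar> < \<delta>"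
      have d': "\<bar>lin_comb (coef n bs) F' - lin_comb (coef n bs) F\<bar> \<le> \<delta>" if bs: "bs \<in> words n" for bs
      proof -
        have "bs \<in> w ` I" using bij_betw_imp_surj_on[OF w] bs by (simp add: I_def)
        then obtain i where i: "bs = w i" "i \<in> I" by (rule imageE)
        have "\<bar>V i F - V i F'\<bar> < \<delta>" by (rule bspec[OF d i(2)])
        then show ?thesis unfolding V_def i(1)[symmetric] by linarith
      qed
      show "F' \<in> E \<union> (space M' - G')"
      proof (cases "F' \<in> G'")
        case True
        have FC: "Cs_on s (cball 0 W) F" "Cs_on s (cball 0 W) F'" "F' \<in> Cs_space s W"
          using F F' Asub sp by (auto simp: Cs_space_def)
        have "(\<Sum>bs\<in>words n. \<bar>lin_comb (coef n bs) F' - lin_comb (coef n bs) F\<bar> * weight s W (length bs))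
            \<le> (\<Sum>bs\<in>(words n :: 'a list set). \<delta> * weight s W (length bs))"
          using W1 by (intro sum_mono mult_right_mono d' weight_nonneg) auto
        also note \<delta>w
        finally have "cs_close s W F' (taylor n F) (2 * \<epsilon>1)"
          by (intro cs_close_triangle[OF G'(3)[OF True] taylor_Lipschitz[OF W1(1)]]) simp
        moreover have "cs_close s W (taylor n F) F \<epsilon>1" by (rule cs_close_sym, rule G(3)) (use F in auto)
        ultimately have cl: "cs_close s W F' F (3 * \<epsilon>1)" by (rule cs_close_triangle) simp
        have "cs_norm s W (F' - F) \<le> 3 * \<epsilon>1"
        proof (rule cs_norm_leI[OF W1(2)])
          fix l :: "'a list" and y :: 'a
          assume l: "set l \<subseteq> Basis" "length l \<le> s" and y: "y \<in> cball 0 W"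
          show "\<bar>iter_pd (cball 0 W) l (F' - F) y\<bar> \<le> 3 * \<epsilon>1"
            unfolding iter_pd_diff[OF cball_body[OF W1(2)] FC(2,1) l y] using cl l y unfolding cs_close_def by blast
        qed
        also have "\<dots> < \<epsilon>" using \<epsilon> by (simp add: \<epsilon>1_def)
        finally have "cs_norm s W (F' - F) < \<epsilon>" .
        then show ?thesis using F FC(3) by (auto simp: E_def cs_enlarge_def)
      qed (use F' in auto)
    qed
    moreover have "M'.prob (E \<union> (space M' - G')) \<le> M'.prob E + M'.prob (space M' - G')"
      using E G'(1) by (intro measure_Un_le) auto
    moreover have "M.prob A \<le> M.prob (A \<inter> G) + M.prob (space M - G)"
    proof -
      have "M.prob A \<le> M.prob ((A \<inter> G) \<union> (space M - G))"
      proof (rule M.finite_measure_mono)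
        show "A \<subseteq> (A \<inter> G) \<union> (space M - G)" using Asub sp by auto
        show "(A \<inter> G) \<union> (space M - G) \<in> sets M" using AM G(1) by (intro sets.Un sets.Int sets.compl_sets)
      qed
      also have "\<dots> \<le> M.prob (A \<inter> G) + M.prob (space M - G)"
        using AM G(1) by (intro measure_Un_le) auto
      finally show ?thesis .
    qed
    ultimately show "M.prob A \<le> M'.prob (cs_enlarge s W A \<epsilon>) + \<epsilon>"
      using G(2) G'(2) \<epsilon> unfolding E_def \<epsilon>1_def by linarith
  qed
qed

text \<open>For a fixed functional the variance of the lacunary sum is the average of |symbol|^2
  over the first N pairs of frequencies. That function is continuous, so weak convergence gives its
  limit, while the error of the central limit theorem vanishes as N grows.\<close>

lemma Fx_law_char:
  fixes r :: "int \<Rightarrow> 'a::euclidean_space"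
  assumes r_unit: "\<forall>n\<ge>1. norm (r n) = 1" and r_indep: "rat_lin_indep r"
    and r_neg: "\<forall>n. n \<noteq> 0 \<longrightarrow> r (- n) = - r n"
    and a_unit: "\<forall>n. n \<noteq> 0 \<longrightarrow> cmod (a n) = 1"
    and a_neg: "\<forall>n. n \<noteq> 0 \<longrightarrow> a (- n) = cnj (a n)"
    and W: "W > 1" and Ns: "filterlim Ns at_top sequentially"
    and weak_conv: "\<forall>f::'a \<Rightarrow> real. continuous_on UNIV f \<longrightarrow>
        ((\<lambda>k. (1 / (2 * real (Ns k))) * (\<Sum>n\<in>{- int (Ns k)..int (Ns k)} - {0}. f (r n))) \<longlongrightarrow> integral\<^sup>L \<mu> f) sequentially"
    and L: "snd ` set L \<subseteq> cball 0 W" and \<eta>: "\<eta> > 0"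
  shows "\<forall>\<^sub>F k in sequentially. \<forall>\<^sub>F R in at_top.
    cmod (field_char (Fx_law s W a r (Ns k) R) L
      - exp (- symbol_var \<mu> L / 2)) \<le> \<eta>"
proof -
  note ctx = r_unit r_indep r_neg a_unit a_neg W
  define Z where "Z x = symbol L x" for x
  obtain c where c: "c > 0" "\<And>x. cmod (Z x) \<le> c" using symbol_bounded[of L] unfolding Z_def by blast
  define v where "v = (\<integral>x. (cmod (Z x))\<^sup>2 \<partial>\<mu>)"
  define vN where "vN N = 1 / (2 * real N) * (\<Sum>n\<in>{- int N..int N} - {0}. (cmod (Z (r n)))\<^sup>2)" for N
  have contZ: "continuous_on UNIV (\<lambda>x. (cmod (Z x))\<^sup>2)"
    unfolding Z_def by (intro continuous_intros continuous_on_symbol)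
  then have vlim: "(\<lambda>k. vN (Ns k)) \<longlonglongrightarrow> v" unfolding vN_def v_def using weak_conv by blast
  define B where "B N = 2 / sqrt (2 * real N) * c" for N :: nat
  define err where "err N = exp (real N * (B N)\<^sup>2 / 2) * (real N * B N ^ 3 + (B N)\<^sup>2 * sqrt (real N))" for N
  \<comment> \<open>The amplitudes shrink exactly fast enough to keep this product constant, so the
    exponential prefactor of the error is exp (c^2) for every N.\<close>
  have B2: "real N * (B N)\<^sup>2 = 2 * c\<^sup>2" if "N > 0" for N
    using that by (simp add: B_def power_mult_distrib power_divide)
  have err_eq: "err N = exp (c\<^sup>2) * (2 * c\<^sup>2 * (B N + 1 / sqrt (real N)))" if N: "N > 0" for N
  proof -
    have "real N * B N ^ 3 = 2 * c\<^sup>2 * B N" using B2[OF N] by (simp add: power3_eq_cube power2_eq_square)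
    moreover have "(B N)\<^sup>2 * sqrt (real N) = 2 * c\<^sup>2 * (1 / sqrt (real N))"
    proof -
      have "(B N)\<^sup>2 = 2 * c\<^sup>2 / real N" using B2[OF N] N by (simp add: field_simps)
      moreover have "2 * c\<^sup>2 / (t * t) * t = 2 * c\<^sup>2 * (1 / t)" if "t > 0" for t using that by simp
      from this[of "sqrt (real N)"] have "2 * c\<^sup>2 / real N * sqrt (real N) = 2 * c\<^sup>2 * (1 / sqrt (real N))"
        using N by simp
      ultimately show ?thesis by simp
    qed
    ultimately show ?thesis unfolding err_def B2[OF N] by (simp add: distrib_left)
  qed
  have Nr: "filterlim (\<lambda>k. real (Ns k)) at_top sequentially"
    by (rule filterlim_compose[OF filterlim_real_sequentially Ns])
  have sq: "(\<lambda>k. 1 / sqrt (real (Ns k))) \<longlonglongrightarrow> 0"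
    by (intro tendsto_divide_0[OF tendsto_const] filterlim_at_top_imp_at_infinity filterlim_compose[OF sqrt_at_top Nr])
  have Blim: "(\<lambda>k. B (Ns k)) \<longlonglongrightarrow> 0"
  proof -
    have "(\<lambda>k. 2 * c / sqrt 2 * (1 / sqrt (real (Ns k)))) \<longlonglongrightarrow> 2 * c / sqrt 2 * 0" by (intro tendsto_intros sq)
    then show ?thesis by (simp add: B_def real_sqrt_mult)
  qed
  have ev0: "\<forall>\<^sub>F k in sequentially. Ns k > 0"
    by (rule eventually_compose_filterlim[OF eventually_gt_at_top[of 0] Ns])
  have "(\<lambda>k. exp (c\<^sup>2) * (2 * c\<^sup>2 * (B (Ns k) + 1 / sqrt (real (Ns k))))) \<longlonglongrightarrow> exp (c\<^sup>2) * (2 * c\<^sup>2 * (0 + 0))"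
    by (intro tendsto_intros Blim sq)
  then have "(\<lambda>k. exp (c\<^sup>2) * (2 * c\<^sup>2 * (B (Ns k) + 1 / sqrt (real (Ns k))))) \<longlonglongrightarrow> 0" by simp
  then have "\<forall>\<^sub>F k in sequentially. exp (c\<^sup>2) * (2 * c\<^sup>2 * (B (Ns k) + 1 / sqrt (real (Ns k)))) < \<eta> / 3"
    by (rule order_tendstoD(2)) (use \<eta> in simp)
  moreover have "\<forall>\<^sub>F k in sequentially. B (Ns k) < 1" using Blim by (intro order_tendstoD(2)) auto
  moreover have "\<forall>\<^sub>F k in sequentially. dist (exp (- vN (Ns k) / 2)) (exp (- v / 2)) < \<eta> / 3"
    using \<eta> by (intro tendstoD tendsto_intros vlim) auto
  ultimately show ?thesis using ev0
  proof eventually_elim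
    case (elim k)
    define N where "N = Ns k"
    have N: "N > 0" using elim by (simp add: N_def)
    let ?S = "{1..int N}"
    define b where "b n = amp a N n * Z (r n)" for n
    have bB: "cmod (b n) \<le> B N" if "n \<in> ?S" for n
      unfolding b_def norm_mult cmod_amp[OF ctx that] B_def using c by (intro mult_left_mono) auto
    \<comment> \<open>The symbol at -x is the conjugate of that at x, so |Z| is even and the sum
      over positive indices equals the average over the symmetric range, the form in which weak
      convergence is assumed.\<close>
    have var: "(\<Sum>n\<in>?S. (cmod (b n))\<^sup>2 / 2) = vN N"
    proof -
      have "cmod (Z (r (- n))) = cmod (Z (r n))" if "n \<in> ?S" for n
      proof -
        have "Z (r (- n)) = cnj (Z (r n))"
          using that r_neg[rule_format, of n] by (simp add: Z_def lin_comb_cnj cnj_ee)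
        then show ?thesis by simp
      qed
      then have "vN N = 1 / (2 * real N) * (\<Sum>n\<in>?S. 2 * (cmod (Z (r n)))\<^sup>2)"
        unfolding vN_def sum_symmetric_range[OF ctx] by (intro arg_cong[where f="\<lambda>t. 1 / (2 * real N) * t"] sum.cong) auto
      also have "\<dots> = (\<Sum>n\<in>?S. (cmod (b n))\<^sup>2 / 2)"
        unfolding sum_distrib_left
        by (intro sum.cong refl) (simp add: b_def norm_mult cmod_amp[OF ctx] power_mult_distrib power_divide)
      finally show ?thesis by simp
    qed
    have "\<forall>\<^sub>F R in at_top. cmod ((\<integral>x. iexp (\<Sum>n\<in>?S. Re (b n * ee (r n \<bullet> x))) \<partial>volR R) - exp (- (\<Sum>n\<in>?S. (cmod (b n))\<^sup>2 / 2) / 2))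
       \<le> \<eta> / 3 + exp (card ?S * (B N)\<^sup>2 / 2) * (card ?S * B N ^ 3 + (B N)\<^sup>2 * sqrt (card ?S))"
    proof (rule iexp_lacunary_mean)
      show "\<forall>n\<in>?S. \<kappa> n = 0" if "(\<Sum>n\<in>?S. of_int (\<kappa> n) *\<^sub>R r n) = 0" for \<kappa>
        using r_int_indep[OF ctx that] by blast
    qed (use bB elim(2) \<eta> c in \<open>auto simp: N_def B_def\<close>)
    moreover have "\<forall>\<^sub>F R in at_top. R > (0::real)" by (rule eventually_gt_at_top)
    ultimately show ?case
    proof eventually_elim
      case (elim R)
      have law: "field_char (Fx_law s W a r (Ns k) R) L = (\<integral>x. iexp (\<Sum>n\<in>?S. Re (b n * ee (r n \<bullet> x))) \<partial>volR R)"
      proof -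
        have m: "lin_comb L \<in> borel_measurable (cs_borel s W)"
          using lin_comb_measurable[OF _ L refl, of s] W by simp
        have "field_char (Fx_law s W a r N R) L = (\<integral>x. iexp (lin_comb L (Fx a r N W x)) \<partial>volR R)"
          unfolding Fx_law_def by (rule integral_distr[OF Fx_measurable'[OF ctx]]) (use m in measurable)
        then show ?thesis unfolding N_def[symmetric] lin_comb_Fx[OF ctx L] Re_sum b_def Z_def .
      qed
      have "cmod (field_char (Fx_law s W a r (Ns k) R) L - exp (- vN N / 2)) \<le> \<eta> / 3 + err N"
        using elim(1) unfolding law var err_def by simp
      moreover have "err N < \<eta> / 3" using \<open>exp (c\<^sup>2) * _ < _\<close> err_eq[OF N] by (simp add: N_def)
      moreover have "cmod (complex_of_real (exp (- vN N / 2)) - complex_of_real (exp (- v / 2))) < \<eta> / 3"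
        using \<open>dist (exp (- vN (Ns k) / 2)) (exp (- v / 2)) < \<eta> / 3\<close>
        by (simp add: N_def dist_real_def flip: of_real_diff)
      ultimately have "cmod (field_char (Fx_law s W a r (Ns k) R) L - complex_of_real (exp (- v / 2))) \<le> \<eta>"
        using norm_triangle_ineq[of "field_char (Fx_law s W a r (Ns k) R) L - complex_of_real (exp (- vN N / 2))"
           "complex_of_real (exp (- vN N / 2)) - complex_of_real (exp (- v / 2))"] by simp
      then show ?case by (simp add: v_def Z_def)
    qed
  qed
qed

text \<open>The witness e matters for the lower bound as well: it shows the set of admissible values
  to be nonempty, and the real \<open>Inf\<close> of an empty set gives no information.\<close>

lemma levy_prokhorov_bounds:
  assumes "e > 0" "\<And>A. A \<in> sets (cs_borel s W) \<Longrightarrow> measure M1 A \<le> measure M2 (cs_enlarge s W A e) + e"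
    "\<And>A. A \<in> sets (cs_borel s W) \<Longrightarrow> measure M2 A \<le> measure M1 (cs_enlarge s W A e) + e"
  shows "0 \<le> levy_prokhorov s W M1 M2" "levy_prokhorov s W M1 M2 \<le> e"
proof -
  let ?X = "{e. e > 0 \<and> (\<forall>A\<in>sets (cs_borel s W).
        measure M1 A \<le> measure M2 (cs_enlarge s W A e) + e \<and> measure M2 A \<le> measure M1 (cs_enlarge s W A e) + e)}"
  have e: "e \<in> ?X" using assms by blast
  show "0 \<le> levy_prokhorov s W M1 M2" unfolding levy_prokhorov_def
    by (rule cInf_greatest) (use e in \<open>blast, simp\<close>)
  show "levy_prokhorov s W M1 M2 \<le> e" unfolding levy_prokhorov_def
    by (rule cInf_lower[OF e]) (rule bdd_belowI[of _ 0], simp)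
qed

theorem theorem1p5:
  fixes r :: "int \<Rightarrow> 'a::euclidean_space"
    and a :: "int \<Rightarrow> complex"
    and \<mu> :: "'a measure"
    and Ns :: "nat \<Rightarrow> nat"
    and W :: real and s :: nat
    and P :: "('a \<Rightarrow> real) measure"
  assumes dim: "DIM('a) \<ge> 2"
    and r_unit: "\<forall>n\<ge>1. norm (r n) = 1"
    and r_indep: "rat_lin_indep r"
    and r_span: "\<not> (\<exists>v. v \<noteq> 0 \<and> (\<forall>n\<ge>1. v \<bullet> r n = 0))"
    and r_neg: "\<forall>n. n \<noteq> 0 \<longrightarrow> r (- n) = - r n"
    and a_unit: "\<forall>n. n \<noteq> 0 \<longrightarrow> cmod (a n) = 1"
    and a_neg: "\<forall>n. n \<noteq> 0 \<longrightarrow> a (- n) = cnj (a n)"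
    and mu_prob: "prob_space \<mu>" and mu_sets: "sets \<mu> = sets borel"
    and mu_sphere: "emeasure \<mu> (sphere 0 1) = 1"
    and Ns_mono: "strict_mono Ns"
    and weak_conv: "\<forall>f::'a \<Rightarrow> real. continuous_on UNIV f \<longrightarrow>
        ((\<lambda>k. (1 / (2 * real (Ns k))) *
               (\<Sum>n\<in>{- int (Ns k)..int (Ns k)} - {0}. f (r n)))
          \<longlongrightarrow> integral\<^sup>L \<mu> f) sequentially"
    and W_gt: "W > 1"
    and P_law: "gaussian_field_law s W \<mu> P"
  shows "((\<lambda>k. Limsup at_top (\<lambda>R. ereal (levy_prokhorov s W (Fx_law s W a r (Ns k) R) P)))
           \<longlongrightarrow> 0) sequentially"
proof -
  note ctx = r_unit r_indep r_neg a_unit a_neg W_gt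
  note pctx = mu_prob mu_sets mu_sphere P_law W_gt
  have Ns: "filterlim Ns at_top sequentially" by (rule filterlim_subseq[OF Ns_mono])
  let ?l = "\<lambda>k. Limsup at_top (\<lambda>R. ereal (levy_prokhorov s W (Fx_law s W a r (Ns k) R) P))"
  have bounds: "\<forall>\<^sub>F k in sequentially. 0 \<le> ?l k \<and>
      ?l k \<le> ereal \<epsilon>" if \<epsilon>: "\<epsilon> > 0" for \<epsilon>
  proof -
    obtain \<L> :: "(real \<times> 'a) list set" and \<eta> where \<L>: "finite \<L>" "\<eta> > 0" "\<And>L. L \<in> \<L> \<Longrightarrow> snd ` set L \<subseteq> cball 0 W"
      and close: "\<And>(M :: ('a \<Rightarrow> real) measure) M' A. spectral_bound s W M \<Longrightarrow> spectral_bound s W M' \<Longrightarrow>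
        (\<And>L. L \<in> \<L> \<Longrightarrow> cmod (field_char M L - field_char M' L) \<le> \<eta>) \<Longrightarrow>
        A \<in> sets (cs_borel s W) \<Longrightarrow> measure M A \<le> measure M' (cs_enlarge s W A \<epsilon>) + \<epsilon>"
      by (rule levy_prokhorov_one_sided[OF W_gt \<epsilon>, of s]) blast
    \<comment> \<open>Finiteness of \<L> gives one threshold for k here and, with k fixed, one
      threshold for R below. The latter may depend on k because the upper limit in R is taken inside
      the limit in k.\<close>
    have "\<forall>\<^sub>F k in sequentially. \<forall>L\<in>\<L>. \<forall>\<^sub>F R in at_top.
      cmod (field_char (Fx_law s W a r (Ns k) R) L - field_char P L) \<le> \<eta>"
    proof (intro eventually_ball_finite \<L> ballI)
      fix L assume "L \<in> \<L>"
      then have L: "snd ` set L \<subseteq> cball 0 W" by (rule \<L>(3))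
      show "\<forall>\<^sub>F k in sequentially. \<forall>\<^sub>F R in at_top.
        cmod (field_char (Fx_law s W a r (Ns k) R) L - field_char P L) \<le> \<eta>"
        unfolding P_char[OF pctx L] by (rule Fx_law_char[OF ctx Ns weak_conv L \<L>(2)])
    qed
    moreover have "\<forall>\<^sub>F k in sequentially. Ns k > 0"
    by (rule eventually_compose_filterlim[OF eventually_gt_at_top[of 0] Ns])
    ultimately show ?thesis
    proof eventually_elim
      case (elim k)
      have "\<forall>\<^sub>F R in at_top. \<forall>L\<in>\<L>. cmod (field_char (Fx_law s W a r (Ns k) R) L - field_char P L) \<le> \<eta>"
        by (intro eventually_ball_finite \<L> elim(1))
      moreover have "\<forall>\<^sub>F R in at_top. spectral_bound s W (Fx_law s W a r (Ns k) R)"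
        by (rule Fx_law_spectral_bound[OF ctx elim(2)])
      ultimately have ev: "\<forall>\<^sub>F R in at_top. 0 \<le> levy_prokhorov s W (Fx_law s W a r (Ns k) R) P \<and>
        levy_prokhorov s W (Fx_law s W a r (Ns k) R) P \<le> \<epsilon>"
      proof eventually_elim
        case (elim R)
        note sb = elim(2) P_spectral_bound[OF pctx]
        have 1: "measure (Fx_law s W a r (Ns k) R) A \<le> measure P (cs_enlarge s W A \<epsilon>) + \<epsilon>" if "A \<in> sets (cs_borel s W)" for A
          using elim(1) by (intro close[OF sb _ that]) blast
        have 2: "measure P A \<le> measure (Fx_law s W a r (Ns k) R) (cs_enlarge s W A \<epsilon>) + \<epsilon>" if "A \<in> sets (cs_borel s W)" for A
          using elim(1) by (intro close[OF sb(2,1) _ that]) (simp add: norm_minus_commute)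
        show ?case
          by (intro conjI; rule levy_prokhorov_bounds[OF \<epsilon>]; (erule 1 | erule 2))
      qed
      have "0 \<le> ?l k"
        using ev by (intro le_Limsup trivial_limit_at_top_linorder) (auto elim: eventually_mono)
      moreover have "?l k \<le> ereal \<epsilon>"
        using ev by (intro Limsup_bounded) (auto elim: eventually_mono)
      ultimately show ?case by blast
    qed
  qed
  show ?thesis
  proof (rule order_tendstoI)
    fix u :: ereal assume "u < 0"
    then show "\<forall>\<^sub>F k in sequentially. u < ?l k"
      using bounds[of 1] by (auto elim: eventually_mono)
  next
    fix u :: ereal assume "0 < u"
    then obtain \<epsilon> where \<epsilon>: "\<epsilon> > 0" "ereal \<epsilon> < u"
      using ereal_dense2[of 0 u] by (auto simp: zero_ereal_def)
    then show "\<forall>\<^sub>F k in sequentially. ?l k < u"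
      using bounds[of \<epsilon>] by (auto elim!: eventually_mono)
  qed
qed

end
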